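(* Let $K$ be a field of characteristic different from $2$ and $3$, let $T=T_0\cup T_1$ be a totally ordered set of even and odd letters, and let $L\langle T\rangle$ be the free Lie superalgebra on $T$ over $K$. Let $I$ be an ideal of $L\langle T\rangle$ generated by $S$, where $S$ is a Gröbner–Shirshov basis for $I$. Fix an admissible bracketing $(u)$ for every super-Lyndon–Shirshov word $u\in T^*$. Then a linear basis of $L\langle T\rangle/I$ is given by all monomials $(u)$ such that $u$ is an $S$-reduced super-Lyndon–Shirshov word.
   Context: $T=T_0\cup T_1$ is a disjoint union with a total (linear) order $<$; letters of $T_0$ are even, those of $T_1$ odd. $T^*$ is the semigroup (with $1$) of associative words on $T$, and nonassociative words are bracketed words on $T$. A word is even if it contains an even number of letters of $T_1$, otherwise odd. $A\langle T\rangle$ is the free associative $K$-algebra on $T$, regarded as a Lie superalgebra via $[x,y]=xy-(-1)^{|x||y|}yx$ for homogeneous $x,y$. $L\langle T\rangle\subseteq A\langle T\rangle$ is the subalgebra generated by $T$ under this bracket; it is the free Lie superalgebra on $T$. Nonassociative words are evaluated in $L\langle T\rangle$ using this bracket. Ideals and elements considered are $\mathbb Z_2$-homogeneous. Orders: $<$ extends to $T^*$ lexicographically by: $u<1$ for $u\neq 1$; and $xv<yw$ (for $x,y\in T$) if $x<y$, or $x=y$ and $v<w$. The length-lexicographic order $\ll$ is: $u\ll v$ if $u$ is shorter than $v$, or they have the same length and $u<v$. Nonassociative words are compared by forgetting brackets. For $0\ne p\in A\langle T\rangle$, $\overline p$ is the $\ll$-largest associative word occurring in $p$, and its coefficient is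 the leading coefficient; $p\in L\langle T\rangle\setminus\{0\}$ is a monic polynomial if its leading coefficient is $1$. A Lyndon–Shirshov word is a nonempty word $w\in T^*$ such that $w=uv>vu$ for every proper decomposition $w=uv$. A super-Lyndon–Shirshov word is either a Lyndon–Shirshov word or a word $uu$ with $u$ an odd Lyndon–Shirshov word. A Lyndon–Shirshov monomial is a nonempty nonassociative word $u$ such that either $u\in T$, or $u=u_1u_2$ with $u_1,u_2$ Lyndon–Shirshov monomials, $u_1>u_2$, and if $u_1=v_1v_2$ then $v_2\le u_2$. A super-Lyndon–Shirshov monomial is a Lyndon–Shirshov monomial or $uu$ with $u$ an odd Lyndon–Shirshov monomial. Forgetting brackets is a bijection from super-Lyndon–Shirshov monomials to super-Lyndon–Shirshov words; $[u]$ denotes the super-Lyndon–Shirshov monomial with underlying word $u$ (the standard bracketing). Admissible bracketing: a bracketing $(u)$ of a super-Lyndon–Shirshov word $u$ (a nonassociative word with underlying word $u$) is admissible if $\overline{(u)}=u$ and its leading coefficient is the same as the leading coefficient of $[u]$ (hence it is $1$ or $2$). The elements $[u]_v$ and $[u]_p$: if $u,v$ are super-Lyndon–Shirshov words and $u=avb$ with $a,b\in T^*$, there is an arrangement of brackets $(a[v]b)$ on $u$, in which $v$ carries its standard bracketing $[v]$, such that $\overline{(a[v]b)}=u$ and the leading coefficient $\alpha$ is $1$ or $2$; put $[u]_v:=\frac1\alpha(a[v]b)$. If $p\in L\langle T\rangle$ is a monic polynomial whose leading word $\overline p$ is a subword of $u$, then $[u]_p$ is the element of $L\langle T\rangle$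 obtained from $[u]_{\overline p}$ by substituting $p$ for $[\overline p]$. Lie compositions of monic polynomials $p,q\in L\langle T\rangle$: (1) if $\overline p\,a=b\,\overline q=w$ with $a,b,w\in T^*$ and $\overline p$ longer than $b$, then $\langle p,q\rangle_w:=[w]_p-[w]_q$; (2) if $\overline p=b\,\overline q\,a=w$ with $a,b\in T^*$, then $\langle p,q\rangle_w:=p-[w]_q$. A set $S$ of monic polynomials of $L\langle T\rangle$ is closed under Lie composition if for all $p,q\in S$ every composition can be written as $\langle p,q\rangle_w=\sum_i\alpha_i(a_i[s_i]b_i)$ with $\alpha_i\in K$, $s_i\in S$, $a_i,b_i\in T^*$ and $\overline{(a_i[s_i]b_i)}\ll w$ for every $i$. Here $(a_i[s_i]b_i)$ is an arrangement of brackets on the letters of $a_i$, the element $[s_i]=s_i$ (treated as a single bracketed entry), and the letters of $b_i$. If $I$ is the ideal of $L\langle T\rangle$ generated by $S$, then $S$ is a Gröbner–Shirshov basis for $I$ if $S$ is closed under Lie composition. A word $u\in T^*$ is $S$-reduced if it is not of the form $a\overline s b$ with $s\in S$, $a,b\in T^*$.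
   Formalization: The order on T is assumed to be a well-order: for even letters x_0 > x_1 > ... and S = {x_n - x_(n+1)} the claim fails. The arrangement (a[v]b) is required to have leading coefficient 1 or 2 only where such an arrangement exists. *)

theory Defs
  imports
    "HOL-Library.Poly_Mapping"
    "HOL-Algebra.AbelCoset"
    "Jordan_Normal_Form.VS_Connect"
begin

hide_const (open) Poly_Mapping.degree Poly_Mapping.range Poly_Mapping.map Poly_Mapping.nth

section \<open>The free associative superalgebra\<close>

text \<open>The letters are the elements of a type \<open>'x\<close>; \<open>isodd\<close> is the characteristic predicate of the
  odd letters, so the even letters are its complement. Words are lists. Lists form the free monoid,
  written additively so that the type \<open>'x list \<Rightarrow>\<^sub>0 'k\<close> carries the library's convolution product:
  it is the free associative algebra on \<open>'x\<close>.\<close>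

instantiation list :: (type) monoid_add
begin
definition zero_list :: "'a list" where "zero_list = []"
definition plus_list :: "'a list \<Rightarrow> 'a list \<Rightarrow> 'a list" where "plus_list = (@)"
instance by standard (simp_all add: zero_list_def plus_list_def)
end

type_synonym ('x, 'k) free_alg = "'x list \<Rightarrow>\<^sub>0 'k"

definition letter :: "'x \<Rightarrow> ('x, 'k::field) free_alg" where
  "letter x = Poly_Mapping.single [x] 1"

definition scal :: "'k::field \<Rightarrow> ('x, 'k) free_alg \<Rightarrow> ('x, 'k) free_alg" (infixr \<open>\<bullet>\<^sub>K\<close> 75) where
  "c \<bullet>\<^sub>K p = Poly_Mapping.single [] c * p"

definition odd_word :: "('x \<Rightarrow> bool) \<Rightarrow> 'x list \<Rightarrow> bool" where
  "odd_word isodd w \<longleftrightarrow> odd (length (filter isodd w))"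

text \<open>The homogeneous component of \<open>p\<close> of parity \<open>i\<close> (\<open>True\<close> is odd).\<close>

definition hom_part :: "('x \<Rightarrow> bool) \<Rightarrow> bool \<Rightarrow> ('x, 'k::field) free_alg \<Rightarrow> ('x, 'k) free_alg" where
  "hom_part isodd i p =
     (\<Sum>w | w \<in> Poly_Mapping.keys p \<and> odd_word isodd w = i. Poly_Mapping.single w (Poly_Mapping.lookup p w))"

definition homogeneous :: "('x \<Rightarrow> bool) \<Rightarrow> ('x, 'k::field) free_alg \<Rightarrow> bool" where
  "homogeneous isodd p \<longleftrightarrow> (\<exists>i. hom_part isodd i p = p)"

text \<open>The formula \<open>xy - (-1)\<^bsup>|x||y|\<^esup> yx\<close> for homogeneous \<open>x\<close>, \<open>y\<close>, extended biadditively.\<close>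

definition sbracket ::
  "('x \<Rightarrow> bool) \<Rightarrow> ('x, 'k::field) free_alg \<Rightarrow> ('x, 'k) free_alg \<Rightarrow> ('x, 'k) free_alg" where
  "sbracket isodd p q =
     (\<Sum>i\<in>UNIV. \<Sum>j\<in>UNIV.
        let x = hom_part isodd i p; y = hom_part isodd j q
        in x * y - (if i \<and> j then -1 else 1) * (y * x))"

lemma hom_part_single: "hom_part isodd i (Poly_Mapping.single w c) =
   (if odd_word isodd w = i then Poly_Mapping.single w c else 0)"
proof (cases "c = 0")
  case False
  have "{v. v \<in> Poly_Mapping.keys (Poly_Mapping.single w c) \<and> odd_word isodd v = i} = (if odd_word isodd w = i then {w} else {})"
    using False by auto
  then show ?thesis by (simp add: hom_part_def)
qed (auto simp: hom_part_def)

lemma sbracket_single: "sbracket isodd (Poly_Mapping.single u a) (Poly_Mapping.single v b) =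
   Poly_Mapping.single (u @ v) (a * b) - (if odd_word isodd u \<and> odd_word isodd v then -1 else 1) * Poly_Mapping.single (v @ u) (a * b)"
  by (auto simp: sbracket_def hom_part_single UNIV_bool mult_single plus_list_def Let_def mult.commute)

section \<open>The free Lie superalgebra and its ideals\<close>

definition lin_subspace :: "('x, 'k::field) free_alg set \<Rightarrow> bool" where
  "lin_subspace V \<longleftrightarrow> 0 \<in> V \<and> (\<forall>p\<in>V. \<forall>q\<in>V. p + q \<in> V) \<and> (\<forall>c. \<forall>p\<in>V. c \<bullet>\<^sub>K p \<in> V)"

definition lie_subalgebra :: "('x \<Rightarrow> bool) \<Rightarrow> ('x, 'k::field) free_alg set \<Rightarrow> bool" where
  "lie_subalgebra isodd V \<longleftrightarrow> lin_subspace V \<and> (\<forall>p\<in>V. \<forall>q\<in>V. sbracket isodd p q \<in> V)"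

definition free_lie_set :: "('x \<Rightarrow> bool) \<Rightarrow> ('x, 'k::field) free_alg set" where
  "free_lie_set isodd = lie_subalgebra isodd hull (range letter)"

text \<open>As a record of HOL-Algebra; the multiplication is the bracket and there is no unit.\<close>

definition free_lie :: "('x \<Rightarrow> bool) \<Rightarrow> ('k::field, ('x, 'k) free_alg) module" where
  "free_lie isodd =
     \<lparr>carrier = free_lie_set isodd, mult = sbracket isodd, one = undefined,
      zero = 0, add = (+), smult = scal\<rparr>"

definition lie_ideal :: "('x \<Rightarrow> bool) \<Rightarrow> ('x, 'k::field) free_alg set \<Rightarrow> bool" where
  "lie_ideal isodd I \<longleftrightarrow>
     I \<subseteq> free_lie_set isodd \<and> lin_subspace I \<and>
     (\<forall>p\<in>free_lie_set isodd. \<forall>q\<in>I. sbracket isodd p q \<in> I \<and> sbracket isodd q p \<in> I)"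

text \<open>The quotient of a module by a submodule, built from the library's additive cosets in the same
  way as the library's quotient of a ring by an ideal. Only the module structure is formed.\<close>

definition quotient_module :: "('k, 'v, 'm) module_scheme \<Rightarrow> 'v set \<Rightarrow> ('k, 'v set) module" where
  "quotient_module M N =
     \<lparr>carrier = a_rcosets\<^bsub>M\<^esub> N, mult = undefined, one = undefined, zero = N, add = set_add M,
      smult = (\<lambda>c X. \<Union>x\<in>X. N +>\<^bsub>M\<^esub> (c \<odot>\<^bsub>M\<^esub> x))\<rparr>"

lemma quotient_module_vectorspace:
  assumes vs: "vectorspace K M" and sub: "submodule K N M"
  shows "vectorspace K (quotient_module M N)"
proof -
  interpret vectorspace K M by fact
  interpret N: submodule K N M by fact
  have neg: "\<ominus>\<^bsub>M\<^esub> x \<in> N" if "x \<in> N" for x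
  proof -
    have "(\<ominus>\<^bsub>K\<^esub> \<one>\<^bsub>K\<^esub>) \<odot>\<^bsub>M\<^esub> x \<in> N" using that by (intro N.smult_closed) auto
    moreover have "(\<ominus>\<^bsub>K\<^esub> \<one>\<^bsub>K\<^esub>) \<odot>\<^bsub>M\<^esub> x = \<ominus>\<^bsub>M\<^esub> x"
      using that N.subset by (subst smult_l_minus) auto
    ultimately show ?thesis by simp
  qed
  have ag: "additive_subgroup N M"
    by (intro additive_subgroupI subgroup.intro)
       (use N.subset neg in \<open>auto simp flip: a_inv_def\<close>)
  interpret abelian_subgroup N M
    by (intro abelian_subgroupI3 ag) (rule abelian_group_axioms)
  have car: "carrier (quotient_module M N) = (\<lambda>x. N +>\<^bsub>M\<^esub> x) ` carrier M"
    by (auto simp: quotient_module_def A_RCOSETS_def')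
  have add: "(N +>\<^bsub>M\<^esub> x) \<oplus>\<^bsub>quotient_module M N\<^esub> (N +>\<^bsub>M\<^esub> y) = N +>\<^bsub>M\<^esub> (x \<oplus>\<^bsub>M\<^esub> y)"
    if "x \<in> carrier M" "y \<in> carrier M" for x y
    using that by (simp add: quotient_module_def a_rcos_sum)
  have sm: "c \<odot>\<^bsub>quotient_module M N\<^esub> (N +>\<^bsub>M\<^esub> x) = N +>\<^bsub>M\<^esub> (c \<odot>\<^bsub>M\<^esub> x)"
    if "c \<in> carrier K" "x \<in> carrier M" for c x
  proof -
    have "N +>\<^bsub>M\<^esub> (c \<odot>\<^bsub>M\<^esub> y) = N +>\<^bsub>M\<^esub> (c \<odot>\<^bsub>M\<^esub> x)" if y: "y \<in> N +>\<^bsub>M\<^esub> x" for y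
    proof -
      from y obtain n where n: "n \<in> N" "y = n \<oplus>\<^bsub>M\<^esub> x" by (auto simp: a_r_coset_def')
      have nc: "n \<in> carrier M" using n N.subset by auto
      have "c \<odot>\<^bsub>M\<^esub> y = c \<odot>\<^bsub>M\<^esub> n \<oplus>\<^bsub>M\<^esub> c \<odot>\<^bsub>M\<^esub> x"
        using n nc \<open>c \<in> carrier K\<close> \<open>x \<in> carrier M\<close> by (simp add: smult_r_distr)
      then have "c \<odot>\<^bsub>M\<^esub> y \<in> N +>\<^bsub>M\<^esub> (c \<odot>\<^bsub>M\<^esub> x)"
        using n \<open>c \<in> carrier K\<close> by (auto simp: a_r_coset_def')
      then show ?thesis
        using a_repr_independence'[of "c \<odot>\<^bsub>M\<^esub> y" "c \<odot>\<^bsub>M\<^esub> x"] \<open>c \<in> carrier K\<close> \<open>x \<in> carrier M\<close> by simp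
    qed
    moreover have "x \<in> N +>\<^bsub>M\<^esub> x" using that by (simp add: a_rcos_self)
    ultimately have "(\<Union>y\<in>N +>\<^bsub>M\<^esub> x. N +>\<^bsub>M\<^esub> (c \<odot>\<^bsub>M\<^esub> y)) = N +>\<^bsub>M\<^esub> (c \<odot>\<^bsub>M\<^esub> x)" by blast
    then show ?thesis by (simp add: quotient_module_def)
  qed
  have zero: "\<zero>\<^bsub>quotient_module M N\<^esub> = N +>\<^bsub>M\<^esub> \<zero>\<^bsub>M\<^esub>"
    using N.subset by (simp add: quotient_module_def)
  show ?thesis
  proof (rule vs_criteria, goal_cases)
    case 1 show ?case by (rule field_axioms)
  next
    case 4
    show ?case
    proof
      fix v assume "v \<in> carrier (quotient_module M N)"
      then obtain x where x: "x \<in> carrier M" "v = N +>\<^bsub>M\<^esub> x" by (auto simp: car)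
      then show "\<exists>w\<in>carrier (quotient_module M N). v \<oplus>\<^bsub>quotient_module M N\<^esub> w = \<zero>\<^bsub>quotient_module M N\<^esub>"
        by (intro bexI[of _ "N +>\<^bsub>M\<^esub> (\<ominus>\<^bsub>M\<^esub> x)"]) (auto simp: car add zero r_neg)
    qed
  qed (auto simp: car add sm zero a_ac smult_assoc1 smult_l_distr smult_r_distr simp del: a_coset_add_zero)
qed

section \<open>Orders on words, leading words\<close>

text \<open>A proper prefix of a word is lexicographically larger than the word.\<close>

fun lex_less :: "'x::linorder list \<Rightarrow> 'x list \<Rightarrow> bool" where
  "lex_less [] _ = False"
| "lex_less (x # v) [] = True"
| "lex_less (x # v) (y # w) = (x < y \<or> x = y \<and> lex_less v w)"

definition lex_le :: "'x::linorder list \<Rightarrow> 'x list \<Rightarrow> bool" where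
  "lex_le u v \<longleftrightarrow> lex_less u v \<or> u = v"

definition llex_less :: "'x::linorder list \<Rightarrow> 'x list \<Rightarrow> bool" (infix \<open>\<lless>\<close> 50) where
  "u \<lless> v \<longleftrightarrow> length u < length v \<or> length u = length v \<and> lex_less u v"

text \<open>Unspecified for \<open>p = 0\<close>.\<close>

definition lead_word :: "('x::linorder, 'k::field) free_alg \<Rightarrow> 'x list" where
  "lead_word p = (THE w. w \<in> Poly_Mapping.keys p \<and> (\<forall>v\<in>Poly_Mapping.keys p. v \<noteq> w \<longrightarrow> v \<lless> w))"

definition lead_cf :: "('x::linorder, 'k::field) free_alg \<Rightarrow> 'k" where
  "lead_cf p = Poly_Mapping.lookup p (lead_word p)"

definition monic_poly :: "('x::linorder \<Rightarrow> bool) \<Rightarrow> ('x, 'k::field) free_alg \<Rightarrow> bool" where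
  "monic_poly isodd p \<longleftrightarrow> p \<in> free_lie_set isodd \<and> p \<noteq> 0 \<and> lead_cf p = 1"

section \<open>Nonassociative words\<close>

datatype 'y nword = Leaf 'y | Node "'y nword" "'y nword"

fun und :: "'y nword \<Rightarrow> 'y list" where
  "und (Leaf y) = [y]"
| "und (Node l r) = und l @ und r"

text \<open>Evaluation by the bracket, with the leaves replaced by given elements.\<close>

fun ev :: "('x \<Rightarrow> bool) \<Rightarrow> ('y \<Rightarrow> ('x, 'k::field) free_alg) \<Rightarrow> 'y nword \<Rightarrow> ('x, 'k) free_alg" where
  "ev isodd f (Leaf y) = f y"
| "ev isodd f (Node l r) = sbracket isodd (ev isodd f l) (ev isodd f r)"

section \<open>Super-Lyndon-Shirshov words and monomials\<close>

definition ls_word :: "'x::linorder list \<Rightarrow> bool" where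
  "ls_word w \<longleftrightarrow> w \<noteq> [] \<and> (\<forall>u v. w = u @ v \<and> u \<noteq> [] \<and> v \<noteq> [] \<longrightarrow> lex_less (v @ u) w)"

definition sls_word :: "('x::linorder \<Rightarrow> bool) \<Rightarrow> 'x list \<Rightarrow> bool" where
  "sls_word isodd w \<longleftrightarrow> ls_word w \<or> (\<exists>u. ls_word u \<and> odd_word isodd u \<and> w = u @ u)"

fun ls_monomial :: "'x::linorder nword \<Rightarrow> bool" where
  "ls_monomial (Leaf x) = True"
| "ls_monomial (Node u1 u2) =
     (ls_monomial u1 \<and> ls_monomial u2 \<and> lex_less (und u2) (und u1) \<and>
      (\<forall>v1 v2. u1 = Node v1 v2 \<longrightarrow> lex_le (und v2) (und u2)))"

definition sls_monomial :: "('x::linorder \<Rightarrow> bool) \<Rightarrow> 'x nword \<Rightarrow> bool" where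
  "sls_monomial isodd m \<longleftrightarrow>
     ls_monomial m \<or> (\<exists>u. ls_monomial u \<and> odd_word isodd (und u) \<and> m = Node u u)"

text \<open>The standard bracketing of a super-Lyndon-Shirshov word.\<close>

definition std :: "('x::linorder \<Rightarrow> bool) \<Rightarrow> 'x list \<Rightarrow> 'x nword" where
  "std isodd u = (THE m. sls_monomial isodd m \<and> und m = u)"

text \<open>The type argument is the coefficient field.\<close>

definition admissible :: "'k::field itself \<Rightarrow> ('x::linorder \<Rightarrow> bool) \<Rightarrow> 'x list \<Rightarrow> 'x nword \<Rightarrow> bool" where
  "admissible _ isodd u m \<longleftrightarrow>
     und m = u \<and>
     (let p = ev isodd letter m :: ('x, 'k) free_alg in
        p \<noteq> 0 \<and> lead_word p = u \<and> lead_cf p = lead_cf (ev isodd letter (std isodd u)))"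

section \<open>Brackets around a distinguished entry\<close>

text \<open>An arrangement of brackets \<open>(a[\<cdot>]b)\<close> is a nonassociative word over \<open>'x option\<close> with underlying
  word \<open>map Some a @ None # map Some b\<close>; the leaf \<open>None\<close> is the distinguished entry. In \<open>plug\<close> the
  element \<open>s\<close> is put in that place, which gives \<open>(a[s]b)\<close>.\<close>

definition arrangement :: "'x list \<Rightarrow> 'x list \<Rightarrow> 'x option nword \<Rightarrow> bool" where
  "arrangement a b m \<longleftrightarrow> und m = map Some a @ None # map Some b"

definition plug ::
  "('x \<Rightarrow> bool) \<Rightarrow> 'x option nword \<Rightarrow> ('x, 'k::field) free_alg \<Rightarrow> ('x, 'k) free_alg" where
  "plug isodd m s = ev isodd (case_option s letter) m"

definition plug_std :: "('x::linorder \<Rightarrow> bool) \<Rightarrow> 'x option nword \<Rightarrow> 'x list \<Rightarrow> ('x, 'k::field) free_alg" where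
  "plug_std isodd m v = plug isodd m (ev isodd letter (std isodd v))"

definition good_arrangement ::
  "'k::field itself \<Rightarrow> ('x::linorder \<Rightarrow> bool) \<Rightarrow> 'x list \<Rightarrow> 'x list \<Rightarrow> 'x list \<Rightarrow> 'x option nword \<Rightarrow> bool" where
  "good_arrangement _ isodd a v b m \<longleftrightarrow>
     arrangement a b m \<and>
     (let p = plug_std isodd m v :: ('x, 'k) free_alg in
        p \<noteq> 0 \<and> lead_word p = a @ v @ b \<and> lead_cf p \<in> {1, 2})"

text \<open>\<open>arr a v b\<close> is the chosen arrangement \<open>(a[v]b)\<close>. The choice is only constrained where it is
  possible: with odd letters \<open>x > y\<close>, every arrangement for \<open>v = xx\<close>, \<open>a = 1\<close>, \<open>b = yxxy\<close> with
  leading word \<open>xxyxxy\<close> has leading coefficient 4 or 8.\<close>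

definition arrangement_choice ::
  "'k::field itself \<Rightarrow> ('x::linorder \<Rightarrow> bool) \<Rightarrow> ('x list \<Rightarrow> 'x list \<Rightarrow> 'x list \<Rightarrow> 'x option nword) \<Rightarrow> bool" where
  "arrangement_choice K isodd arr \<longleftrightarrow>
     (\<forall>a v b. sls_word isodd v \<and> sls_word isodd (a @ v @ b) \<and>
        (\<exists>m. good_arrangement K isodd a v b m) \<longrightarrow> good_arrangement K isodd a v b (arr a v b))"

text \<open>\<open>sub_elem isodd arr a p b\<close> is \<open>[u]\<^sub>p\<close>, where \<open>u\<close> is \<open>a\<close>, the leading word of \<open>p\<close>, and \<open>b\<close>; it
  depends on the occurrence of the leading word in \<open>u\<close>. The scalar is the one that makes \<open>[u]\<^sub>v\<close>
  monic for the leading word \<open>v\<close> of \<open>p\<close>, as it stands before \<open>p\<close> is substituted for \<open>[v]\<close>.\<close>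

definition sub_elem ::
  "('x::linorder \<Rightarrow> bool) \<Rightarrow> ('x list \<Rightarrow> 'x list \<Rightarrow> 'x list \<Rightarrow> 'x option nword) \<Rightarrow>
   'x list \<Rightarrow> ('x, 'k::field) free_alg \<Rightarrow> 'x list \<Rightarrow> ('x, 'k) free_alg" where
  "sub_elem isodd arr a p b =
     (let v = lead_word p; m = arr a v b; \<alpha> = lead_cf (plug_std isodd m v :: ('x, 'k) free_alg)
      in (1 / \<alpha>) \<bullet>\<^sub>K plug isodd m p)"

section \<open>Lie compositions and Groebner-Shirshov bases\<close>

inductive lie_composition ::
  "('x::linorder \<Rightarrow> bool) \<Rightarrow> ('x list \<Rightarrow> 'x list \<Rightarrow> 'x list \<Rightarrow> 'x option nword) \<Rightarrow>
   ('x, 'k::field) free_alg \<Rightarrow> ('x, 'k) free_alg \<Rightarrow> 'x list \<Rightarrow> ('x, 'k) free_alg \<Rightarrow> bool"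
  for isodd arr p q where
  intersection:
    "lead_word p @ a = w \<Longrightarrow> b @ lead_word q = w \<Longrightarrow> length b < length (lead_word p) \<Longrightarrow>
     lie_composition isodd arr p q w (sub_elem isodd arr [] p a - sub_elem isodd arr b q [])"
| inclusion:
    "lead_word p = w \<Longrightarrow> b @ lead_word q @ a = w \<Longrightarrow>
     lie_composition isodd arr p q w (p - sub_elem isodd arr b q a)"

definition trivial_below ::
  "('x::linorder \<Rightarrow> bool) \<Rightarrow> ('x, 'k::field) free_alg set \<Rightarrow> 'x list \<Rightarrow> ('x, 'k) free_alg \<Rightarrow> bool" where
  "trivial_below isodd S w f \<longleftrightarrow>
     (\<exists>ts :: ('k \<times> 'x option nword \<times> ('x, 'k) free_alg) list.
        f = (\<Sum>(\<alpha>, m, s)\<leftarrow>ts. \<alpha> \<bullet>\<^sub>K plug isodd m s) \<and>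
        (\<forall>(\<alpha>, m, s)\<in>set ts. s \<in> S \<and> (\<exists>a b. arrangement a b m) \<and>
           plug isodd m s \<noteq> 0 \<and> lead_word (plug isodd m s) \<lless> w))"

definition closed_under_composition ::
  "('x::linorder \<Rightarrow> bool) \<Rightarrow> ('x list \<Rightarrow> 'x list \<Rightarrow> 'x list \<Rightarrow> 'x option nword) \<Rightarrow>
   ('x, 'k::field) free_alg set \<Rightarrow> bool" where
  "closed_under_composition isodd arr S \<longleftrightarrow>
     (\<forall>p\<in>S. \<forall>q\<in>S. \<forall>w f. lie_composition isodd arr p q w f \<longrightarrow> trivial_below isodd S w f)"

definition gs_basis ::
  "('x::linorder \<Rightarrow> bool) \<Rightarrow> ('x list \<Rightarrow> 'x list \<Rightarrow> 'x list \<Rightarrow> 'x option nword) \<Rightarrow>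
   ('x, 'k::field) free_alg set \<Rightarrow> ('x, 'k) free_alg set \<Rightarrow> bool" where
  "gs_basis isodd arr S I \<longleftrightarrow>
     (\<forall>s\<in>S. monic_poly isodd s \<and> homogeneous isodd s) \<and>
     I = lie_ideal isodd hull S \<and> closed_under_composition isodd arr S"

definition reduced :: "('x::linorder, 'k::field) free_alg set \<Rightarrow> 'x list \<Rightarrow> bool" where
  "reduced S u \<longleftrightarrow> \<not> (\<exists>s\<in>S. \<exists>a b. u = a @ lead_word s @ b)"

end

theory Submission
  imports Defs
begin

text \<open>The closure hypothesis excludes elements of \<open>S\<close> with a square \<open>uu\<close> as leading word, so all
  leading words are Lyndon--Shirshov words, and these do not overlap with themselves. Therefore every
  single element of \<open>S\<close> is an associative Groebner--Shirshov basis of the two-sided ideal that it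
  generates. Consequently, once \<open>[w]\<^sub>p\<close> has leading word \<open>w\<close>, it differs from the associative
  product \<open>apb\<close> with that leading word by multiples of \<open>p\<close> below \<open>w\<close>, and trivial Lie compositions make the
  associative compositions of \<open>S\<close> trivial. The associative composition-diamond lemma
  then gives independence modulo \<open>I\<close>. For the spanning part, a nonzero element of the free Lie superalgebra
  has a super-Lyndon--Shirshov leading word, and one that is not reduced is the leading
  word of a bracketing around an element of \<open>S\<close>, which lies in \<open>I\<close>.\<close>

section \<open>Orders on words\<close>

text \<open>The obstacle is that \<open>arr\<close> is tested only on the standard monomial
  \<open>[v]\<close>. Different placements of \<open>v\<close> may cancel, and then lower terms of
  the entry decide the leading word; those differ between \<open>[v]\<close> and a substituted
  \<open>p\<close>. So it is not automatic that \<open>[w]_p\<close> has leading word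
  \<open>w\<close>. If the letters around the hole are fewer than those of \<open>v\<close>, an
  unbordered \<open>v\<close> rules out such cancellation. In an overlap at least one of the two
  sides is short in this sense, and triviality of the composition carries the leading term over to
  the other side. In an inclusion triviality alone supplies it.

  A similar cancellation affects \<open>(a[s]b)\<close> in a trivial composition: written out in
  products \<open>asb\<close>, it may contain products above \<open>w\<close> whose sum is small.
  This is why the composition-diamond lemma is used for each \<open>{s}\<close> before it is
  available for \<open>S\<close>.

  The inductions descend along leading words. Over infinitely many letters this needs a well-founded
  order on the letters. The characteristic enters through the leading coefficient 2 of the monomials
  \<open>[uu]\<close>.\<close>

fun mless :: "'x::linorder list \<Rightarrow> 'x list \<Rightarrow> bool" where
  "mless (x # u) (y # v) = (x < y \<or> x = y \<and> mless u v)"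
| "mless _ _ = False"

text \<open>The reason for \<open>mless\<close>: an inequality decided at a differing letter
  survives any extension of either word. \<open>lex_less\<close> lacks this property, since it also
  puts \<open>u @ t\<close> below \<open>u\<close>.\<close>

lemma mless_append: "mless u v \<Longrightarrow> mless (u @ s) (v @ t)"
  by (induction u v rule: mless.induct) auto

lemma mless_append_left [simp]: "mless (c @ u) (c @ v) = mless u v"
  by (induction c) auto

lemma mless_trans: "mless u v \<Longrightarrow> mless v w \<Longrightarrow> mless u w"
proof (induction u v arbitrary: w rule: mless.induct)
  case (1 x u y v)
  then show ?case by (cases w) auto
qed auto

lemma mless_irrefl [simp]: "\<not> mless u u"
  by (induction u) auto

lemma mless_prefix [simp]: "\<not> mless (u @ t) u" "\<not> mless u (u @ t)"
  by (induction u) auto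

lemma lex_less_iff: "lex_less u v \<longleftrightarrow> mless u v \<or> (\<exists>t. t \<noteq> [] \<and> u = v @ t)"
  by (induction u v rule: lex_less.induct) auto

lemma lex_less_same_length: "length u = length v \<Longrightarrow> lex_less u v \<longleftrightarrow> mless u v"
  by (auto simp: lex_less_iff)

lemma mless_lex: "mless u v \<Longrightarrow> lex_less u v"
  by (simp add: lex_less_iff)

lemma lex_less_irrefl [simp]: "\<not> lex_less u u"
  by (induction u) auto

lemma lex_less_trans: "lex_less u v \<Longrightarrow> lex_less v w \<Longrightarrow> lex_less u w"
proof (induction u v arbitrary: w rule: lex_less.induct)
  case (3 x v y w)
  then show ?case by (cases w) auto
qed auto

lemma lex_less_linear: "lex_less u v \<or> u = v \<or> lex_less v u"
proof (induction u v rule: lex_less.induct)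
  case (1 v)
  then show ?case by (cases v) auto
qed auto

lemma lex_le_trans: "lex_le u v \<Longrightarrow> lex_le v w \<Longrightarrow> lex_le u w"
  by (auto simp: lex_le_def intro: lex_less_trans)

lemma lex_le_less_trans: "lex_le u v \<Longrightarrow> lex_less v w \<Longrightarrow> lex_less u w"
  by (auto simp: lex_le_def intro: lex_less_trans)

lemma lex_less_le_trans: "lex_less u v \<Longrightarrow> lex_le v w \<Longrightarrow> lex_less u w"
  by (auto simp: lex_le_def intro: lex_less_trans)

lemma not_lex_less: "\<not> lex_less u v \<longleftrightarrow> lex_le v u"
  using lex_less_linear[of u v] lex_less_trans[of u v u] by (auto simp: lex_le_def)

lemma not_lex_le: "\<not> lex_le u v \<longleftrightarrow> lex_less v u"
  using not_lex_less by blast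

lemma lex_le_prefix: "lex_le (u @ t) u"
  by (cases "t = []") (auto simp: lex_le_def lex_less_iff)

lemma lex_less_prefix: "t \<noteq> [] \<Longrightarrow> lex_less (u @ t) u"
  by (auto simp: lex_less_iff)

lemma lex_mless_trans: "lex_le u v \<Longrightarrow> mless v w \<Longrightarrow> mless u w"
  by (auto simp: lex_le_def lex_less_iff intro: mless_trans dest: mless_append[of v w _ "[]"])

lemma llex_less_iff: "u \<lless> v \<longleftrightarrow> length u < length v \<or> length u = length v \<and> mless u v"
  by (auto simp: llex_less_def lex_less_same_length)

lemma llex_less_irrefl [simp]: "\<not> u \<lless> u"
  by (simp add: llex_less_iff)

lemma llex_less_trans: "u \<lless> v \<Longrightarrow> v \<lless> w \<Longrightarrow> u \<lless> w"
  by (auto simp: llex_less_iff intro: mless_trans)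

lemma llex_less_linear: "u \<lless> v \<or> u = v \<or> v \<lless> u"
  using lex_less_linear[of u v] by (auto simp: llex_less_def)

lemma llex_less_append: "u \<lless> v \<Longrightarrow> a @ u @ b \<lless> a @ v @ b"
  by (auto simp: llex_less_iff intro: mless_append)

lemma llex_less_append': "u \<lless> v \<Longrightarrow> a @ u \<lless> a @ v" "u \<lless> v \<Longrightarrow> u @ b \<lless> v @ b"
  using llex_less_append[of u v a "[]"] llex_less_append[of u v "[]" b] by auto

lemma llex_less_append2_strict:
  assumes "u \<lless> v \<and> (u' \<lless> v' \<or> u' = v') \<or> u = v \<and> u' \<lless> v'"
  shows "u @ u' \<lless> v @ v'"
  using assms llex_less_append'(2)[of u v u'] llex_less_append'(1)[of u' v' v]
  by (auto intro: llex_less_trans)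

text \<open>Comparing lengths first is essential: the lexicographic order alone has the infinite
  descending chain \<open>x, xx, xxx, ...\<close>.\<close>

lemma wfp_llex_less:
  assumes "wfp ((<) :: 'x::linorder \<Rightarrow> 'x \<Rightarrow> bool)"
  shows "wfp ((\<lless>) :: 'x list \<Rightarrow> 'x list \<Rightarrow> bool)"
proof -
  let ?r = "{(x, y :: 'x). x < y}"
  have "wf (lenlex ?r)"
    using assms by (intro wf_lenlex) (simp add: wfp_def)
  moreover have "(u, v) \<in> lex ?r" if "length u = length v" "mless u v" for u v :: "'x list"
    using that
  proof (induction u v rule: mless.induct)
    case (1 x u y v)
    then show ?case by auto
  qed auto
  then have "(u, v) \<in> lenlex ?r" if "u \<lless> v" for u v
    using that by (auto simp: llex_less_iff lenlex_conv lex_conv)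
  ultimately show ?thesis
    unfolding wfp_def by (elim wf_subset) auto
qed

section \<open>Lyndon--Shirshov words\<close>

lemma ls_wordI:
  assumes "w \<noteq> []" "\<And>u v. w = u @ v \<Longrightarrow> u \<noteq> [] \<Longrightarrow> v \<noteq> [] \<Longrightarrow> mless v w"
  shows "ls_word w"
  unfolding ls_word_def
proof (intro conjI allI impI)
  fix u v assume *: "w = u @ v \<and> u \<noteq> [] \<and> v \<noteq> []"
  then have "mless (v @ u) (w @ [])" using assms(2) by (intro mless_append) auto
  then show "lex_less (v @ u) w" by (simp add: mless_lex)
qed fact

text \<open>A border \<open>v\<close> makes two rotations comparable: \<open>v @ u\<close> below
  \<open>v @ t\<close> forces \<open>u\<close> below \<open>t\<close>, while \<open>t @ v\<close>
  below \<open>u @ v\<close> forces the opposite.\<close>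

lemma ls_word_unbordered:
  assumes ls: "ls_word w" and w: "w = u @ v" "w = v @ t" and ne: "v \<noteq> []"
  shows "u = []"
proof (rule ccontr)
  assume u: "u \<noteq> []"
  have len: "length t = length u" using w by (metis add.commute add_right_imp_eq length_append)
  then have t: "t \<noteq> []" using u by auto
  have "lex_less (v @ u) (v @ t)" using ls w u ne by (auto simp: ls_word_def)
  then have "mless u t" using len by (simp add: lex_less_same_length)
  moreover have "lex_less (t @ v) (u @ v)" using ls w t ne unfolding ls_word_def by metis
  then have "mless (t @ v) (u @ v)" using len by (simp add: lex_less_same_length)
  ultimately show False
    using mless_append[of u t v v] mless_trans[of "u @ v" "t @ v" "u @ v"] by simp
qed

text \<open>The rotation inequality compares \<open>v @ u\<close> with the word. It could be decided
  behind \<open>v\<close> only if \<open>v\<close> were also a prefix, that is, a border. So a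
  letter of \<open>v\<close> decides, which gives \<open>mless\<close> and not merely
  \<open>lex_less\<close>.\<close>

lemma ls_word_suffix:
  assumes ls: "ls_word (u @ v)" and ne: "u \<noteq> []" "v \<noteq> []"
  shows "mless v (u @ v)"
proof -
  have "lex_less (v @ u) (u @ v)" using assms by (auto simp: ls_word_def)
  then have *: "mless (v @ u) (u @ v)" by (simp add: lex_less_same_length)
  show ?thesis
  proof (rule ccontr)
    assume n: "\<not> mless v (u @ v)"
    have nt: "v \<noteq> u @ v @ t" for t
      by (rule notI, drule arg_cong[of _ _ length]) (use ne in simp)
    consider "mless (u @ v) v" | t where "u @ v = v @ t"
      using lex_less_linear[of v "u @ v"] n
      by (auto simp: lex_less_iff ne nt)
    then show False
    proof cases
      case 1
      then show False
        using mless_append[of "u @ v" v "[]" u] mless_trans[OF *, of "v @ u"] by simp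
    next
      case 2
      then show False using ls_word_unbordered[OF ls refl 2] ne by simp
    qed
  qed
qed

lemma ls_word_ne: "ls_word w \<Longrightarrow> w \<noteq> []"
  by (simp add: ls_word_def)

lemma ls_word_suffix_le: "ls_word (u @ v) \<Longrightarrow> v \<noteq> [] \<Longrightarrow> lex_le v (u @ v)"
  using ls_word_suffix[of u v] by (cases "u = []") (auto simp: lex_le_def mless_lex)

lemma ls_word_single [simp]: "ls_word [x]"
  by (rule ls_wordI) (auto simp: Cons_eq_append_conv)

text \<open>A proper suffix of \<open>x @ y\<close> either lies in \<open>y\<close> or begins inside
  \<open>x\<close> with a smaller suffix of \<open>x\<close>, so everything reduces to
  \<open>mless y (x @ y)\<close>.\<close>

lemma ls_word_append:
  assumes x: "ls_word x" and y: "ls_word y" and less: "lex_less y x"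
  shows "ls_word (x @ y)"
proof (rule ls_wordI)
  show "x @ y \<noteq> []" using x by (simp add: ls_word_ne)
  have yxy: "mless y (x @ y)"
  proof (cases "mless y x")
    case True then show ?thesis using mless_append[of y x "[]" y] by simp
  next
    case False
    \<comment> \<open>Here \<open>y\<close> extends \<open>x\<close>, and \<open>y = x @ e\<close>
      is compared with \<open>x @ y\<close> behind the common prefix \<open>x\<close>.\<close>
    then obtain e where e: "e \<noteq> []" "y = x @ e" using less by (auto simp: lex_less_iff)
    have "mless e y" using ls_word_suffix[of x e] x y e by (auto simp: ls_word_ne)
    then have "mless (x @ e) (x @ y)" by simp
    then show ?thesis using e by simp
  qed
  fix u v assume uv: "x @ y = u @ v" "u \<noteq> []" "v \<noteq> []"
  from uv(1) consider us where "u = x @ us" "us @ v = y" | us where "u @ us = x" "us @ y = v"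
    by (auto simp: append_eq_append_conv2)
  then show "mless v (x @ y)"
  proof cases
    case 1
    then show ?thesis using ls_word_suffix_le[of us v] y uv yxy
      by (auto intro: lex_mless_trans)
  next
    case 2
    show ?thesis
    proof (cases "us = []")
      case True then show ?thesis using 2 yxy by simp
    next
      case False
      then have "mless us x" using ls_word_suffix[of u us] x 2 uv by auto
      then show ?thesis using 2 mless_append by blast
    qed
  qed
qed

lemma ls_word_append_iff_less:
  assumes "ls_word (x @ y)" "x \<noteq> []" "y \<noteq> []"
  shows "lex_less y x"
  using ls_word_suffix[OF assms] lex_le_prefix[of x y] by (blast intro: lex_less_le_trans mless_lex)

section \<open>Nondecreasing factorizations\<close>

text \<open>The Chen-Fox-Lyndon factorization. It is nondecreasing because the words here are the
  largest of their rotations.\<close>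

definition ls_fact :: "'x::linorder list list \<Rightarrow> bool" where
  "ls_fact fs \<longleftrightarrow> (\<forall>f\<in>set fs. ls_word f) \<and> sorted_wrt lex_le fs"

text \<open>As long as the next factor is smaller than \<open>g\<close>, the two merge into a longer
  Lyndon--Shirshov word; once it is not, \<open>g\<close> can stand in front.\<close>

lemma ls_fact_insert:
  assumes "ls_word g" "ls_fact fs"
  shows "\<exists>gs. ls_fact gs \<and> gs \<noteq> [] \<and> concat gs = g @ concat fs"
  using assms
proof (induction fs arbitrary: g)
  case Nil
  then show ?case by (intro exI[of _ "[g]"]) (auto simp: ls_fact_def)
next
  case (Cons f fs)
  show ?case
  proof (cases "lex_less f g")
    case True
    have "\<exists>gs. ls_fact gs \<and> gs \<noteq> [] \<and> concat gs = (g @ f) @ concat fs"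
      using Cons.prems True by (intro Cons.IH ls_word_append) (auto simp: ls_fact_def)
    then show ?thesis by simp
  next
    case False
    then have "lex_le g f" by (simp add: not_lex_less)
    then show ?thesis using Cons.prems
      by (intro exI[of _ "g # f # fs"]) (auto simp: ls_fact_def intro: lex_le_trans)
  qed
qed

lemma ls_fact_exists: "\<exists>fs. ls_fact fs \<and> concat fs = w"
proof (induction w)
  case Nil
  then show ?case by (intro exI[of _ "[]"]) (auto simp: ls_fact_def)
next
  case (Cons x w)
  then obtain fs where "ls_fact fs" "concat fs = w" by blast
  then show ?case using ls_fact_insert[of "[x]" fs] by auto
qed

text \<open>The two ends are all that is used of the factorization. Every word starting with
  \<open>f\<close> is at most \<open>f\<close>, hence at most the suffix \<open>g\<close>; the
  contradictions below arise by bounding \<open>g\<close> from above by such a word. The last two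
  clauses separate the case of a single factor.\<close>

lemma ls_fact_first_last:
  assumes "w \<noteq> []"
  obtains f r l g where "ls_word f" "ls_word g" "w = f @ r" "w = l @ g" "lex_le f g"
    "l = [] \<Longrightarrow> ls_word w" "l \<noteq> [] \<Longrightarrow> r \<noteq> []"
proof -
  obtain fs where fs: "ls_fact fs" "concat fs = w" using ls_fact_exists by blast
  then have ne: "fs \<noteq> []" using assms by auto
  show ?thesis
  proof (cases "tl fs")
    case Nil
    then have "fs = [hd fs]" using ne by (metis list.collapse)
    then have "concat fs = hd fs" by (metis append_Nil2 concat.simps)
    then have "ls_word w" using fs ne by (auto simp: ls_fact_def)
    then show ?thesis by (intro that[of w w "[]" "[]"]) (auto simp: lex_le_def)
  next
    case (Cons g gs)
    let ?g = "last (g # gs)" and ?f = "hd fs"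
    have f: "fs = ?f # g # gs" using ne Cons by (metis list.collapse)
    have f2: "fs = (?f # butlast (g # gs)) @ [?g]" using f by (simp only: append_Cons append_butlast_last_id list.distinct not_False_eq_True)
    have "w = ?f @ concat (g # gs)" using f fs(2) by (metis concat.simps(2))
    moreover have "w = concat (?f # butlast (g # gs)) @ ?g" using f2 fs(2) by (metis concat_append concat.simps append_Nil2)
    moreover have "ls_word ?g" "ls_word ?f" using fs f f2 unfolding ls_fact_def by (metis last_in_set list.set_intros(2) list.distinct(1), metis list.set_intros(1))
    moreover have "lex_le ?f ?g" using fs f unfolding ls_fact_def by (metis last_in_set list.distinct(1) sorted_wrt.simps(2))
    moreover have "ls_word g" using fs f unfolding ls_fact_def by (metis list.set_intros)
    ultimately show ?thesis by (intro that[of ?f ?g "concat (g # gs)" "concat (?f # butlast (g # gs))"]) (auto dest: ls_word_ne)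
  qed
qed

section \<open>Lyndon--Shirshov monomials\<close>

lemma und_ne [simp]: "und m \<noteq> []"
  by (induction m) auto

lemma ls_monomial_ls_word: "ls_monomial m \<Longrightarrow> ls_word (und m)"
  by (induction m) (auto intro: ls_word_append)

lemma append_eq_append_suffix:
  assumes "u @ v = s @ t" "length t \<le> length v"
  shows "\<exists>h. v = h @ t"
  using assms by (auto simp: append_eq_append_conv2)

text \<open>The split of a monomial can thus be read off from its word. For a longer suffix
  \<open>t = t' @ und m2\<close>, let \<open>f\<close> and \<open>g\<close> be the first and last
  factors of \<open>t'\<close>. By induction \<open>g\<close> is a suffix of \<open>und v2\<close>,
  and \<open>g <= und v2 <= und m2 < t < f <= g\<close> is a contradiction.\<close>

lemma ls_monomial_longest_suffix:
  assumes "ls_monomial (Node m1 m2)" "und m1 @ und m2 = s @ t" "s \<noteq> []" "ls_word t"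
  shows "length t \<le> length (und m2)"
  using assms
proof (induction m1 arbitrary: m2 s t)
  case (Leaf x)
  then show ?case by (cases s) auto
next
  case (Node v1 v2)
  show ?case
  proof (rule ccontr)
    assume long: "\<not> ?thesis"
    then obtain t' where t: "t = t' @ und m2" "und (Node v1 v2) = s @ t'"
      using Node.prems(2) by (auto simp: append_eq_append_conv2 simp del: und.simps)
    then have "t' \<noteq> []" using long by auto
    then obtain f r l g where fg: "ls_word f" "ls_word g" "t' = f @ r" "t' = l @ g" "lex_le f g"
      using ls_fact_first_last[of t'] by metis
    have "length g \<le> length (und v2)"
      using Node.IH(1)[of v2 "s @ l" g] Node.prems t fg by auto
    then obtain h where h: "und v2 = h @ g"
      using append_eq_append_suffix[of "und v1" "und v2" "s @ l" g] t(2) fg(4) by auto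
    have "lex_le g (und v2)"
      using ls_word_suffix_le[of h g] h fg(2) Node.prems(1) ls_monomial_ls_word[of v2] by (auto simp: ls_word_ne)
    moreover have "lex_le (und v2) (und m2)" using Node.prems(1) by auto
    moreover have "lex_less (und m2) t"
      using ls_word_suffix[of t' "und m2"] Node.prems(4) t(1) \<open>t' \<noteq> []\<close> by (auto intro: mless_lex)
    moreover have "lex_less t f" using t(1) fg(3) lex_less_prefix[of "r @ und m2" f] by auto
    ultimately show False using fg(5) by (meson lex_le_less_trans lex_less_trans lex_less_le_trans lex_less_irrefl)
  qed
qed

lemma ls_monomial_unique: "ls_monomial m \<Longrightarrow> ls_monomial m' \<Longrightarrow> und m = und m' \<Longrightarrow> m = m'"
proof (induction m arbitrary: m')
  case (Leaf x)
  then show ?case by (cases m') (auto simp: Cons_eq_append_conv)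
next
  case (Node m1 m2)
  show ?case
  proof (cases m')
    case (Leaf x)
    then show ?thesis using Node.prems by (auto simp: append_eq_Cons_conv)
  next
    case N: (Node n1 n2)
    have "length (und n2) \<le> length (und m2)"
      using ls_monomial_longest_suffix[OF Node.prems(1), of "und n1" "und n2"] Node.prems N
      by (auto intro: ls_monomial_ls_word)
    moreover have "length (und m2) \<le> length (und n2)"
      using ls_monomial_longest_suffix[of n1 n2 "und m1" "und m2"] Node.prems N
      by (auto intro: ls_monomial_ls_word)
    ultimately have "und m2 = und n2" "und m1 = und n1" using Node.prems(3) N by auto
    then show ?thesis using Node N by auto
  qed
qed

text \<open>The word is split at its longest proper Lyndon--Shirshov suffix \<open>v\<close>.
  Maximality of \<open>v\<close> shows both that the remaining prefix is a Lyndon--Shirshov word and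
  that the side condition on nested monomials holds.\<close>

lemma ls_monomial_exists: "ls_word w \<Longrightarrow> \<exists>m. ls_monomial m \<and> und m = w"
proof (induction "length w" arbitrary: w rule: less_induct)
  case less
  show ?case
  proof (cases "\<exists>x. w = [x]")
    case True
    then obtain x where "w = [x]" by blast
    then show ?thesis by (intro exI[of _ "Leaf x"]) auto
  next
    case False
    define P where "P = (\<lambda>v. ls_word v \<and> (\<exists>u. u \<noteq> [] \<and> w = u @ v))"
    have "w = butlast w @ [last w]" "butlast w \<noteq> []"
      using False ls_word_ne[OF less.prems] by (auto, metis append_Nil append_butlast_last_id)
    then have "P [last w]" unfolding P_def using ls_word_single by blast
    then obtain v where v: "P v" "\<And>v'. P v' \<Longrightarrow> length v' \<le> length v"
      using ex_has_greatest_nat[of P "[last w]" length "Suc (length w)"] by (fastforce simp: P_def)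
    obtain u where u: "u \<noteq> []" "w = u @ v" "ls_word v" using v(1) by (auto simp: P_def)
    have vw: "lex_less v w" using ls_word_suffix[of u v] less.prems u by (auto intro: mless_lex dest: ls_word_ne)
    have longest: "lex_le g v" if "ls_word g" "w = l @ g @ v" "l \<noteq> []" for l g
    proof (rule ccontr)
      assume "\<not> ?thesis"
      then have "ls_word (g @ v)" using that u by (intro ls_word_append) (auto simp: not_lex_le)
      then show False using v(2)[of "g @ v"] that by (auto simp: P_def dest: ls_word_ne)
    qed
    obtain f r l g where fg: "ls_word f" "ls_word g" "u = f @ r" "u = l @ g" "lex_le f g"
      "l = [] \<Longrightarrow> ls_word u"
      using ls_fact_first_last[OF u(1)] by metis
    \<comment> \<open>With more than one factor in \<open>u\<close>, the last factor would satisfy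
      \<open>g <= v < w < f <= g\<close>.\<close>
    have "l = []"
    proof (rule ccontr)
      assume "l \<noteq> []"
      then have "lex_le g v" using longest[of g l] fg(2,4) u(2) by simp
      moreover have "lex_less w f" using u fg lex_less_prefix[of "r @ v" f] by (auto dest: ls_word_ne)
      ultimately show False using vw fg(5) by (meson lex_le_less_trans lex_less_trans lex_less_le_trans lex_less_irrefl)
    qed
    then have lsu: "ls_word u" using fg by simp
    obtain m1 where m1: "ls_monomial m1" "und m1 = u" using less.hyps[of u] lsu u by (auto dest: ls_word_ne)
    obtain m2 where m2: "ls_monomial m2" "und m2 = v" using less.hyps[of v] u by auto
    have "lex_less v u" using ls_word_append_iff_less[of u v] less.prems u by (auto dest: ls_word_ne)
    moreover have "lex_le (und v2) v" if "m1 = Node v1 v2" for v1 v2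
      using longest[of "und v2" "und v1"] m1 u that by (auto intro: ls_monomial_ls_word)
    ultimately have "ls_monomial (Node m1 m2)" using m1 m2 by auto
    then show ?thesis using m1 m2 u by (intro exI[of _ "Node m1 m2"]) auto
  qed
qed

lemma not_ls_word_square: "\<not> ls_word (u @ u)"
  using ls_word_suffix[of u u] ls_word_ne[of "u @ u"] by auto

lemma sls_monomial_unique:
  assumes "sls_monomial isodd m" "sls_monomial isodd m'" "und m = und m'"
  shows "m = m'"
proof -
  have 1: "\<not> ls_monomial n" if "und n = u @ u" for n and u :: "'a list"
  proof
    assume "ls_monomial n"
    then show False using ls_monomial_ls_word[of n] not_ls_word_square[of u] that by simp
  qed
  consider "ls_monomial m" "ls_monomial m'" | u u' where "m = Node u u" "m' = Node u' u'" "ls_monomial u" "ls_monomial u'"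
    | u where "ls_monomial m" "m' = Node u u" | u where "ls_monomial m'" "m = Node u u"
    using assms(1,2) unfolding sls_monomial_def by blast
  then show ?thesis
  proof cases
    case 1
    then show ?thesis using assms(3) ls_monomial_unique by blast
  next
    case 2
    then have eq: "und u @ und u = und u' @ und u'" using assms(3) by simp
    have "length (und u) = length (und u')" using arg_cong[OF eq, of length] by simp
    then have "und u = und u'" using eq by simp
    then show ?thesis using 2 ls_monomial_unique by blast
  next
    case 3
    then show ?thesis using 1[of m "und u"] assms(3) by simp
  next
    case 4
    then show ?thesis using 1[of m' "und u"] assms(3) by simp
  qed
qed

lemma std_eq: "sls_monomial isodd m \<Longrightarrow> std isodd (und m) = m"
  unfolding std_def by (rule the_equality) (auto intro: sls_monomial_unique)

lemma std_ls_word: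
  assumes "ls_word u"
  shows "ls_monomial (std isodd u)" "und (std isodd u) = u"
proof -
  obtain m where "ls_monomial m" "und m = u" using ls_monomial_exists[OF assms] by blast
  then show "ls_monomial (std isodd u)" "und (std isodd u) = u"
    using std_eq[of isodd m] by (auto simp: sls_monomial_def)
qed

lemma std_square:
  assumes "ls_word u" "odd_word isodd u"
  shows "std isodd (u @ u) = Node (std isodd u) (std isodd u)"
  using std_eq[of isodd "Node (std isodd u) (std isodd u)"] std_ls_word[OF assms(1)] assms(2)
  by (auto simp: sls_monomial_def)

section \<open>Linear structure and leading terms\<close>

abbreviation "lookup \<equiv> Poly_Mapping.lookup"
abbreviation "keys \<equiv> Poly_Mapping.keys"

abbreviation word :: "'x list \<Rightarrow> ('x, 'k::field) free_alg" where
  "word w \<equiv> Poly_Mapping.single w 1"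

lemma lookup_scal [simp]: "lookup (c \<bullet>\<^sub>K p) w = c * lookup p w"
  unfolding scal_def zero_list_def[symmetric] mult_map_scale_conv_mult[symmetric]
  by (simp add: Poly_Mapping.map.rep_eq when_def)

interpretation scal: vector_space "scal :: 'k::field \<Rightarrow> ('x, 'k) free_alg \<Rightarrow> _"
  by standard (auto intro!: poly_mapping_eqI simp: lookup_add algebra_simps)

lemma lin_subspace_iff: "lin_subspace V \<longleftrightarrow> scal.subspace V"
  by (auto simp: lin_subspace_def scal.subspace_def)

lemma keys_scal: "keys (c \<bullet>\<^sub>K p) \<subseteq> keys p"
  by (auto simp: in_keys_iff)

lemma scal_mult_left [simp]: "(c \<bullet>\<^sub>K p) * q = c \<bullet>\<^sub>K (p * q)"
  by (simp add: scal_def mult.assoc)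

lemma word_mult [simp]: "word u * word v = word (u @ v)"
  by (simp add: mult_single plus_list_def)

lemma word_Nil [simp]: "word [] = (1 :: ('x, 'k::field) free_alg)"
  by (metis single_one zero_list_def)

lemma poly_mapping_sum_words: "p = (\<Sum>w\<in>keys p. lookup p w \<bullet>\<^sub>K word w)"
  by (rule poly_mapping_eqI)
     (auto simp: lookup_sum lookup_single when_def in_keys_iff if_distrib cong: if_cong)

lemma word_induct [case_names zero add word]:
  assumes "P 0" "\<And>p q. P p \<Longrightarrow> P q \<Longrightarrow> P (p + q)" "\<And>c w. P (c \<bullet>\<^sub>K word w)"
  shows "P (p :: ('x, 'k::field) free_alg)"
proof -
  have "P (\<Sum>w\<in>A. lookup p w \<bullet>\<^sub>K word w)" if "finite A" for A
    using that by (induction A) (use assms in auto)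
  then show ?thesis using poly_mapping_sum_words[of p] by (metis finite_keys)
qed

lemma scal_mult_right [simp]: "p * (c \<bullet>\<^sub>K q) = c \<bullet>\<^sub>K (p * q)"
proof (induction p rule: word_induct)
  case (word d w)
  have "word w * (c \<bullet>\<^sub>K q) = c \<bullet>\<^sub>K (word w * q)"
    by (simp add: scal_def mult.assoc[symmetric] mult_single plus_list_def)
  then show ?case by (simp add: mult.commute)
qed (auto simp: distrib_right scal.scale_right_distrib)

lemma keys_mult_append: "w \<in> keys (p * q) \<Longrightarrow> \<exists>u\<in>keys p. \<exists>v\<in>keys q. w = u @ v"
  using keys_mult[of p q] unfolding plus_list_def by blast

definition below :: "('x::linorder, 'k::field) free_alg \<Rightarrow> 'x list \<Rightarrow> bool" where
  "below f u \<longleftrightarrow> (\<forall>w\<in>keys f. w \<lless> u)"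

text \<open>The coefficient may be 0, and then only \<open>below f u\<close> is asserted. This makes
  the predicate compatible with sums and products without case distinctions on cancellation.\<close>

definition lead_at :: "('x::linorder, 'k::field) free_alg \<Rightarrow> 'x list \<Rightarrow> 'k \<Rightarrow> bool" where
  "lead_at f u c \<longleftrightarrow> below (f - c \<bullet>\<^sub>K word u) u"

lemma below_0 [simp]: "below 0 u"
  by (simp add: below_def)

lemma below_add: "below f u \<Longrightarrow> below g u \<Longrightarrow> below (f + g) u"
  using keys_add[of f g] by (auto simp: below_def)

lemma below_uminus [simp]: "below (- f) u = below f u"
  by (simp add: below_def)

lemma below_diff: "below f u \<Longrightarrow> below g u \<Longrightarrow> below (f - g) u"
  using below_add[of f u "- g"] by simp

lemma below_scal: "below f u \<Longrightarrow> below (c \<bullet>\<^sub>K f) u"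
  using keys_scal[of c f] by (auto simp: below_def)

lemma lookup_lead_at: "lead_at f u c \<Longrightarrow> lookup f u = c"
proof -
  assume "lead_at f u c"
  then have "u \<notin> keys (f - c \<bullet>\<^sub>K word u)" by (auto simp: lead_at_def below_def)
  then show ?thesis by (simp add: in_keys_iff lookup_minus)
qed

lemma lead_at_keys: "lead_at f u c \<Longrightarrow> w \<in> keys f \<Longrightarrow> w \<lless> u \<or> w = u"
  by (cases "w = u") (auto simp: lead_at_def below_def in_keys_iff lookup_minus lookup_single_not_eq)

lemma lead_atI: "lookup f u = c \<Longrightarrow> (\<And>w. w \<in> keys f \<Longrightarrow> w \<lless> u \<or> w = u) \<Longrightarrow> lead_at f u c"
  unfolding lead_at_def below_def
proof
  fix w assume a: "lookup f u = c" "\<And>w. w \<in> keys f \<Longrightarrow> w \<lless> u \<or> w = u" "w \<in> keys (f - c \<bullet>\<^sub>K word u)"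
  then have "w \<noteq> u" by (auto simp: in_keys_iff lookup_minus)
  moreover from this have "w \<in> keys f" using a by (auto simp: in_keys_iff lookup_minus lookup_single_not_eq)
  ultimately show "w \<lless> u" using a by blast
qed

lemma lead_at_0_iff: "lead_at f u 0 \<longleftrightarrow> below f u"
  by (simp add: lead_at_def)

lemma lead_at_scal: "lead_at f u c \<Longrightarrow> lead_at (d \<bullet>\<^sub>K f) u (d * c)"
  unfolding lead_at_def using below_scal[of "f - c \<bullet>\<^sub>K word u" u d]
  by (simp add: scal.scale_right_diff_distrib)

lemma lead_at_add: "lead_at f u c \<Longrightarrow> lead_at g u d \<Longrightarrow> lead_at (f + g) u (c + d)"
  unfolding lead_at_def using below_add[of "f - c \<bullet>\<^sub>K word u" u "g - d \<bullet>\<^sub>K word u"]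
  by (simp add: algebra_simps scal.scale_left_distrib)

lemma lead_at_diff: "lead_at f u c \<Longrightarrow> lead_at g u d \<Longrightarrow> lead_at (f - g) u (c - d)"
  unfolding lead_at_def using below_diff[of "f - c \<bullet>\<^sub>K word u" u "g - d \<bullet>\<^sub>K word u"]
  by (simp add: algebra_simps scal.scale_left_distrib scal.scale_left_diff_distrib)

lemma lead_at_word: "lead_at (word u) u 1"
  by (simp add: lead_at_def)

lemma lead_at_mult:
  assumes "lead_at f u c" "lead_at g v d"
  shows "lead_at (f * g) (u @ v) (c * d)"
proof -
  let ?f = "f - c \<bullet>\<^sub>K word u" and ?g = "g - d \<bullet>\<^sub>K word v"
  have "below (?f * g) (u @ v)"
    unfolding below_def
  proof
    fix w assume "w \<in> keys (?f * g)"
    then obtain u' v' where *: "u' \<in> keys ?f" "v' \<in> keys g" "w = u' @ v'" using keys_mult_append by blast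
    then show "w \<lless> u @ v"
      using assms lead_at_keys[OF assms(2), of v'] by (auto simp: lead_at_def below_def intro: llex_less_append2_strict)
  qed
  moreover have "below (word u * ?g) (u @ v)"
    unfolding below_def
  proof
    fix w assume "w \<in> keys (word u * ?g)"
    then obtain v' where *: "v' \<in> keys ?g" "w = u @ v'" using keys_mult_append[of w "word u" ?g] by auto
    then show "w \<lless> u @ v"
      using assms(2) by (auto simp: lead_at_def below_def intro: llex_less_append2_strict)
  qed
  ultimately have "below (?f * g + c \<bullet>\<^sub>K (word u * ?g)) (u @ v)" by (intro below_add below_scal)
  moreover have "?f * g + c \<bullet>\<^sub>K (word u * ?g) = f * g - (c * d) \<bullet>\<^sub>K word (u @ v)"
    by (simp add: algebra_simps scal.scale_right_diff_distrib)
  ultimately show ?thesis by (simp add: lead_at_def)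
qed

lemma lead_at_lower: "lead_at f u c \<Longrightarrow> u \<lless> v \<Longrightarrow> lead_at f v 0"
  unfolding lead_at_0_iff below_def using lead_at_keys llex_less_trans by blast

lemma lead_at_lead:
  assumes "lead_at f u c" "c \<noteq> 0"
  shows "lead_word f = u" "lead_cf f = c" "f \<noteq> 0"
proof -
  have u: "u \<in> keys f" using assms lookup_lead_at[OF assms(1)] by (simp add: in_keys_iff)
  show "lead_word f = u"
    unfolding lead_word_def
  proof (rule the_equality)
    show "u \<in> keys f \<and> (\<forall>v\<in>keys f. v \<noteq> u \<longrightarrow> v \<lless> u)" using u lead_at_keys[OF assms(1)] by blast
    fix w assume "w \<in> keys f \<and> (\<forall>v\<in>keys f. v \<noteq> w \<longrightarrow> v \<lless> w)"
    then have "w \<lless> u \<or> w = u" "u \<noteq> w \<Longrightarrow> u \<lless> w" using u lead_at_keys[OF assms(1), of w] by blast+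
    then show "w = u" using llex_less_trans[of u w u] by auto
  qed
  then show "lead_cf f = c" using lookup_lead_at[OF assms(1)] by (simp add: lead_cf_def)
  show "f \<noteq> 0" using u by auto
qed

lemma llex_max_exists:
  assumes "finite A" "A \<noteq> {}"
  shows "\<exists>u\<in>A. \<forall>w\<in>A. w \<lless> u \<or> w = (u :: 'x::linorder list)"
  using assms
proof (induction A rule: finite_ne_induct)
  case (insert x A)
  then obtain u where u: "u \<in> A" "\<forall>w\<in>A. w \<lless> u \<or> w = u" by blast
  then show ?case using llex_less_linear[of u x] by (metis insert_iff llex_less_trans)
qed auto

lemma lead_at_lead_word:
  assumes "f \<noteq> 0"
  shows "lead_at f (lead_word f) (lead_cf f)" "lead_cf f \<noteq> 0"
proof -
  obtain u where u: "u \<in> keys f" "\<forall>w\<in>keys f. w \<lless> u \<or> w = u"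
    using llex_max_exists[of "keys f"] assms by auto
  have *: "lead_at f u (lookup f u)" by (rule lead_atI) (use u in auto)
  have "lookup f u \<noteq> 0" using u by (simp add: in_keys_iff)
  then show "lead_at f (lead_word f) (lead_cf f)" "lead_cf f \<noteq> 0" using * lead_at_lead[OF *] by auto
qed

section \<open>Parity and the bracket\<close>

definition par :: "('x \<Rightarrow> bool) \<Rightarrow> bool \<Rightarrow> ('x, 'k::field) free_alg \<Rightarrow> bool" where
  "par isodd i p \<longleftrightarrow> (\<forall>w\<in>keys p. odd_word isodd w = i)"

lemma odd_word_append [simp]: "odd_word isodd (u @ v) \<longleftrightarrow> odd_word isodd u \<noteq> odd_word isodd v"
  by (auto simp: odd_word_def)

lemma lookup_hom_part: "lookup (hom_part isodd i p) w = (if odd_word isodd w = i then lookup p w else 0)"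
  unfolding hom_part_def
  by (auto simp: lookup_sum lookup_single when_def in_keys_iff if_distrib cong: if_cong)

lemma hom_part_0 [simp]: "hom_part isodd i 0 = 0"
  by (rule poly_mapping_eqI) (simp add: lookup_hom_part)

lemma hom_part_add: "hom_part isodd i (p + q) = hom_part isodd i p + hom_part isodd i q"
  by (rule poly_mapping_eqI) (simp add: lookup_hom_part lookup_add)

lemma hom_part_scal: "hom_part isodd i (c \<bullet>\<^sub>K p) = c \<bullet>\<^sub>K hom_part isodd i p"
  by (rule poly_mapping_eqI) (simp add: lookup_hom_part)

lemma hom_part_par: "par isodd i p \<Longrightarrow> hom_part isodd j p = (if j = i then p else 0)"
  by (rule poly_mapping_eqI) (auto simp: lookup_hom_part par_def in_keys_iff)

lemma par_hom_part: "par isodd i (hom_part isodd i p)"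
  by (auto simp: par_def in_keys_iff lookup_hom_part split: if_splits)

lemma homogeneous_iff: "homogeneous isodd p \<longleftrightarrow> (\<exists>i. par isodd i p)"
  unfolding homogeneous_def using hom_part_par par_hom_part by metis

lemma par_0 [simp]: "par isodd i 0"
  by (simp add: par_def)

lemma par_diff: "par isodd i p \<Longrightarrow> par isodd i q \<Longrightarrow> par isodd i (p - q)"
  using keys_diff[of p q] by (auto simp: par_def)

lemma par_scal: "par isodd i p \<Longrightarrow> par isodd i (c \<bullet>\<^sub>K p)"
  using keys_scal[of c p] by (auto simp: par_def)

lemma par_mult: "par isodd i p \<Longrightarrow> par isodd j q \<Longrightarrow> par isodd (i \<noteq> j) (p * q)"
  by (auto simp: par_def dest!: keys_mult_append)

lemma par_word [simp]: "par isodd (odd_word isodd w) (word w)"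
  by (simp add: par_def)

lemma par_lead_at: "par isodd i f \<Longrightarrow> lead_at f u c \<Longrightarrow> c \<noteq> 0 \<Longrightarrow> i = odd_word isodd u"
  using lookup_lead_at[of f u c] by (auto simp: par_def in_keys_iff)

definition koszul_sign :: "bool \<Rightarrow> bool \<Rightarrow> 'k::field" where
  "koszul_sign i j = (if i \<and> j then -1 else 1)"

lemma sbracket_par:
  assumes "par isodd i x" "par isodd j y"
  shows "sbracket isodd x y = x * y - koszul_sign i j \<bullet>\<^sub>K (y * x)"
  unfolding sbracket_def UNIV_bool Let_def hom_part_par[OF assms(1)] hom_part_par[OF assms(2)]
  by (cases i; cases j) (auto simp: koszul_sign_def)

lemma sbracket_add_left: "sbracket isodd (p + q) r = sbracket isodd p r + sbracket isodd q r"
  unfolding sbracket_def UNIV_bool Let_def hom_part_add by (simp add: algebra_simps)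

lemma sbracket_add_right: "sbracket isodd p (q + r) = sbracket isodd p q + sbracket isodd p r"
  unfolding sbracket_def UNIV_bool Let_def hom_part_add by (simp add: algebra_simps)

lemma sbracket_scal_left: "sbracket isodd (c \<bullet>\<^sub>K p) r = c \<bullet>\<^sub>K sbracket isodd p r"
  unfolding sbracket_def UNIV_bool Let_def hom_part_scal
  by (simp add: algebra_simps scal.scale_right_diff_distrib)

lemma sbracket_scal_right: "sbracket isodd p (c \<bullet>\<^sub>K r) = c \<bullet>\<^sub>K sbracket isodd p r"
  unfolding sbracket_def UNIV_bool Let_def hom_part_scal
  by (simp add: algebra_simps scal.scale_right_diff_distrib)

lemma sbracket_0 [simp]: "sbracket isodd 0 r = 0" "sbracket isodd r 0 = 0"
  by (simp_all add: sbracket_def)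

lemma par_sbracket: "par isodd i x \<Longrightarrow> par isodd j y \<Longrightarrow> par isodd (i \<noteq> j) (sbracket isodd x y)"
  using par_mult[of isodd i x j y] par_mult[of isodd j y i x]
  by (cases i; cases j) (simp_all add: sbracket_par par_diff par_scal)

lemma lead_at_sbracket:
  assumes "par isodd i x" "par isodd j y" "lead_at x u c" "lead_at y v d" "v @ u \<lless> u @ v"
  shows "lead_at (sbracket isodd x y) (u @ v) (c * d)"
  using lead_at_diff[OF lead_at_mult[OF assms(3,4)] lead_at_scal[OF lead_at_lower[OF lead_at_mult[OF assms(4,3)] assms(5)]]]
  by (simp add: sbracket_par[OF assms(1,2)])

text \<open>For odd entries the superbracket adds the two products, and both have leading word
  \<open>uu\<close>. This is the origin of the leading coefficient 2.\<close>

lemma lead_at_sbracket_square: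
  assumes "par isodd True x" "par isodd True y" "lead_at x u c" "lead_at y u d"
  shows "lead_at (sbracket isodd x y) (u @ u) (2 * c * d)"
  using lead_at_diff[OF lead_at_mult[OF assms(3,4)] lead_at_scal[OF lead_at_mult[OF assms(4,3)], of "-1"]]
  by (simp add: sbracket_par[OF assms(1,2)] koszul_sign_def algebra_simps)

lemma sbracket_even_self: "par isodd False x \<Longrightarrow> sbracket isodd x x = 0"
  by (simp add: sbracket_par koszul_sign_def)

lemma sbracket_swap:
  "par isodd i x \<Longrightarrow> par isodd j y \<Longrightarrow> sbracket isodd y x = (- koszul_sign i j) \<bullet>\<^sub>K sbracket isodd x y"
  by (cases i; cases j) (simp_all add: sbracket_par koszul_sign_def)

lemma sbracket_jacobi:
  assumes "par isodd i x" "par isodd j y" "par isodd k z"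
  shows "sbracket isodd (sbracket isodd x y) z =
    sbracket isodd x (sbracket isodd y z) + (- koszul_sign i j) \<bullet>\<^sub>K sbracket isodd y (sbracket isodd x z)"
  unfolding sbracket_par[OF par_sbracket[OF assms(1,2)] assms(3)]
    sbracket_par[OF assms(1) par_sbracket[OF assms(2,3)]]
    sbracket_par[OF assms(2) par_sbracket[OF assms(1,3)]]
  unfolding sbracket_par[OF assms(1,2)] sbracket_par[OF assms(1,3)] sbracket_par[OF assms(2,3)]
  by (cases i; cases j; cases k)
    (simp_all add: koszul_sign_def left_diff_distrib right_diff_distrib distrib_left distrib_right mult.assoc)

text \<open>In the Jacobi identity for two equal odd entries the two summands coincide. Bracketing
  with a square thus becomes iterated bracketing with its root.\<close>

lemma sbracket_square_left:
  assumes "par isodd True x" "par isodd k z"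
  shows "sbracket isodd (sbracket isodd x x) z = 2 \<bullet>\<^sub>K sbracket isodd x (sbracket isodd x z)"
proof -
  have "2 \<bullet>\<^sub>K p = p + p" for p :: "('a, 'b) free_alg"
    using scal.scale_left_distrib[of 1 1 p] by simp
  then show ?thesis using sbracket_jacobi[OF assms(1,1,2)] by (simp add: koszul_sign_def)
qed

text \<open>In the associative algebra \<open>[x,x]\<close> is twice the square of \<open>x\<close>;
  it is even and commutes with \<open>x\<close>.\<close>

lemma sbracket_cube:
  assumes "par isodd True x"
  shows "sbracket isodd (sbracket isodd x x) x = 0" "sbracket isodd x (sbracket isodd x x) = 0"
proof -
  have e: "par isodd False (sbracket isodd x x)" using par_sbracket[OF assms(1,1)] by simp
  have "sbracket isodd (sbracket isodd x x) x = 0"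
    unfolding sbracket_par[OF e assms(1)] unfolding sbracket_par[OF assms(1,1)]
    by (simp add: koszul_sign_def distrib_left distrib_right mult.assoc)
  then show "sbracket isodd (sbracket isodd x x) x = 0" "sbracket isodd x (sbracket isodd x x) = 0"
    using sbracket_swap[OF e assms(1)] by simp_all
qed

section \<open>Evaluation of monomials\<close>

lemma par_ev_letter: "par isodd (odd_word isodd (und m)) (ev isodd letter m :: ('x, 'k::field) free_alg)"
proof (induction m)
  case (Leaf x)
  then show ?case by (simp add: letter_def)
next
  case (Node m1 m2)
  then show ?case using par_sbracket by fastforce
qed

lemma ls_swap_less:
  assumes "ls_word u" "ls_word v" "lex_less v u"
  shows "v @ u \<lless> u @ v"
  using ls_word_append[OF assms] assms(1,2)
  unfolding ls_word_def[of "u @ v"] llex_less_def by (auto simp: ls_word_ne)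

lemma lead_at_ev_ls_monomial:
  "ls_monomial m \<Longrightarrow> lead_at (ev isodd letter m :: ('x::linorder, 'k::field) free_alg) (und m) 1"
proof (induction m)
  case (Leaf x)
  then show ?case by (simp add: letter_def lead_at_word)
next
  case (Node m1 m2)
  then have "und m2 @ und m1 \<lless> und m1 @ und m2"
    by (intro ls_swap_less) (auto intro: ls_monomial_ls_word)
  then show ?case
    using lead_at_sbracket[OF par_ev_letter[of isodd m1] par_ev_letter[of isodd m2], of "und m1" 1 "und m2" 1] Node
    by simp
qed

lemma lead_at_std:
  assumes "ls_word u"
  shows "lead_at (ev isodd letter (std isodd u) :: ('x::linorder, 'k::field) free_alg) u 1"
  using lead_at_ev_ls_monomial[OF std_ls_word(1)[OF assms, of isodd], of isodd] std_ls_word(2)[OF assms, of isodd] by simp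

lemma par_std: "ls_word u \<Longrightarrow> par isodd (odd_word isodd u) (ev isodd letter (std isodd u) :: ('x::linorder, 'k::field) free_alg)"
  using par_ev_letter[of isodd "std isodd u"] std_ls_word(2)[of u isodd] by simp

lemma lead_at_std_square:
  assumes "ls_word u" "odd_word isodd u"
  shows "lead_at (ev isodd letter (std isodd (u @ u)) :: ('x::linorder, 'k::field) free_alg) (u @ u) 2"
  using lead_at_sbracket_square[OF par_std[OF assms(1), of isodd, unfolded eqTrueI[OF assms(2)]]
      par_std[OF assms(1), of isodd, unfolded eqTrueI[OF assms(2)]] lead_at_std[OF assms(1)] lead_at_std[OF assms(1)]]
  by (simp add: std_square[OF assms])

section \<open>The super-Lyndon--Shirshov monomials span\<close>

definition std_elem :: "('x::linorder \<Rightarrow> bool) \<Rightarrow> 'x list \<Rightarrow> ('x, 'k::field) free_alg" where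
  "std_elem isodd w = ev isodd letter (std isodd w)"

lemma std_elem_square:
  "ls_word u \<Longrightarrow> odd_word isodd u \<Longrightarrow>
    std_elem isodd (u @ u) = sbracket isodd (std_elem isodd u) (std_elem isodd u)"
  by (simp add: std_elem_def std_square)

lemma par_std_elem: "ls_word u \<Longrightarrow> par isodd (odd_word isodd u) (std_elem isodd u)"
  by (simp add: std_elem_def par_std)

lemma par_std_elem_odd: "ls_word u \<Longrightarrow> odd_word isodd u \<Longrightarrow> par isodd True (std_elem isodd u)"
  by (drule par_std_elem[of u isodd]) simp

lemma par_std_elem_even: "ls_word u \<Longrightarrow> \<not> odd_word isodd u \<Longrightarrow> par isodd False (std_elem isodd u)"
  by (drule par_std_elem[of u isodd]) simp

section \<open>Rewriting brackets of standard monomials\<close>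

lemma sbracket_span_right:
  assumes "v \<in> scal.span A" "\<And>a. a \<in> A \<Longrightarrow> sbracket isodd x a \<in> scal.span W"
  shows "sbracket isodd x v \<in> scal.span W"
proof -
  have "scal.subspace {v. sbracket isodd x v \<in> scal.span W}"
    by (auto simp: scal.subspace_def sbracket_add_right sbracket_scal_right scal.span_zero
        intro: scal.span_add scal.span_scale)
  then have "scal.span A \<subseteq> {v. sbracket isodd x v \<in> scal.span W}"
    using assms(2) by (intro scal.span_minimal) auto
  then show ?thesis using assms(1) by auto
qed

lemma sbracket_swap_mem:
  assumes "par isodd i x" "par isodd j y" "sbracket isodd x y \<in> scal.span W"
  shows "sbracket isodd y x \<in> scal.span W"
  unfolding sbracket_swap[OF assms(1,2)] by (rule scal.span_scale) fact

text \<open>A square \<open>uu\<close> is compared with \<open>g\<close> through its root \<open>u\<close>: as \<open>uu < u\<close>, the bracket of \<open>[u]\<close> with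
  itself would otherwise leave the span.\<close>

definition words_above :: "('x::linorder \<Rightarrow> bool) \<Rightarrow> 'x set \<Rightarrow> nat \<Rightarrow> 'x list \<Rightarrow> 'x list set" where
  "words_above isodd X n g =
     {w. set w \<subseteq> X \<and> length w = n \<and> ls_word w \<and> lex_less g w} \<union>
     {u @ u |u. set u \<subseteq> X \<and> length u + length u = n \<and> ls_word u \<and> odd_word isodd u \<and> lex_less g u}"

definition span_above :: "('x::linorder \<Rightarrow> bool) \<Rightarrow> 'x set \<Rightarrow> nat \<Rightarrow> 'x list \<Rightarrow> ('x, 'k::field) free_alg set" where
  "span_above isodd X n g = scal.span (std_elem isodd ` words_above isodd X n g)"

lemma span_above_mono: "lex_le g g' \<Longrightarrow> span_above isodd X n g' \<subseteq> span_above isodd X n g"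
  unfolding span_above_def by (intro scal.span_mono) (auto simp: words_above_def intro: lex_le_less_trans)

lemma span_above_word:
  "set w \<subseteq> X \<Longrightarrow> ls_word w \<Longrightarrow> lex_less g w \<Longrightarrow> std_elem isodd w \<in> span_above isodd X (length w) g"
  unfolding span_above_def by (intro scal.span_base) (auto simp: words_above_def)

lemma span_above_square:
  assumes "set u \<subseteq> X" "ls_word u" "lex_less g u"
  shows "sbracket isodd (std_elem isodd u) (std_elem isodd u) \<in> span_above isodd X (length u + length u) g"
proof (cases "odd_word isodd u")
  case True
  then have "std_elem isodd (u @ u) \<in> span_above isodd X (length u + length u) g"
    unfolding span_above_def using assms by (intro scal.span_base) (auto simp: words_above_def)
  then show ?thesis using True assms by (simp add: std_elem_square)
next
  case False
  then show ?thesis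
    by (simp add: sbracket_even_self[OF par_std_elem_even[OF assms(2)]] span_above_def scal.span_zero)
qed

definition ls_bracket_above :: "'k::field itself \<Rightarrow> ('x::linorder \<Rightarrow> bool) \<Rightarrow> 'x set \<Rightarrow> nat \<Rightarrow> 'x list \<Rightarrow> bool" where
  "ls_bracket_above _ isodd X n g \<longleftrightarrow> (\<forall>f. ls_word f \<and> set f \<subseteq> X \<and> lex_less g f \<and> length f + length g = n \<longrightarrow>
     sbracket isodd (std_elem isodd f :: ('x, 'k) free_alg) (std_elem isodd g) \<in> span_above isodd X n g)"

definition square_bracket_above :: "'k::field itself \<Rightarrow> ('x::linorder \<Rightarrow> bool) \<Rightarrow> 'x set \<Rightarrow> nat \<Rightarrow> 'x list \<Rightarrow> bool" where
  "square_bracket_above _ isodd X n g \<longleftrightarrow>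
     (\<forall>k. ls_word k \<and> odd_word isodd k \<and> set k \<subseteq> X \<and> lex_less g k \<and> length k + length k + length g = n \<longrightarrow>
     sbracket isodd (sbracket isodd (std_elem isodd k :: ('x, 'k) free_alg) (std_elem isodd k)) (std_elem isodd g)
       \<in> span_above isodd X n g)"

text \<open>The two claims are proved together: rewriting a bracket of Lyndon--Shirshov monomials
  produces squares, which have to be bracketed again.\<close>

definition brackets_above :: "'k::field itself \<Rightarrow> ('x::linorder \<Rightarrow> bool) \<Rightarrow> 'x set \<Rightarrow> nat \<Rightarrow> 'x list \<Rightarrow> bool" where
  "brackets_above K isodd X n g \<longleftrightarrow> ls_bracket_above K isodd X n g \<and> square_bracket_above K isodd X n g"

text \<open>All words and roots of squares occurring in \<open>v\<close> are above \<open>k\<close>,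
  so after a swap \<open>k\<close> is the smaller entry and the hypothesis at \<open>k\<close>
  applies.\<close>

lemma bracket_span_above_self:
  fixes v :: "('x::linorder, 'k::field) free_alg"
  assumes P: "brackets_above TYPE('k) isodd X (length k + m) k" and k: "ls_word k"
    and v: "v \<in> span_above isodd X m k"
  shows "sbracket isodd (std_elem isodd k) v \<in> span_above isodd X (length k + m) k"
  using v unfolding span_above_def
proof (rule sbracket_span_right)
  fix a :: "('x, 'k) free_alg" assume "a \<in> std_elem isodd ` words_above isodd X m k"
  then consider w where "a = std_elem isodd w" "set w \<subseteq> X" "length w = m" "ls_word w" "lex_less k w"
    | u where "a = std_elem isodd (u @ u)" "set u \<subseteq> X" "length u + length u = m" "ls_word u" "odd_word isodd u" "lex_less k u"
    unfolding words_above_def by blast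
  then show "sbracket isodd (std_elem isodd k) a \<in> scal.span (std_elem isodd ` words_above isodd X (length k + m) k)"
  proof cases
    case 1
    then have "sbracket isodd a (std_elem isodd k) \<in> span_above isodd X (length k + m) k"
      using P by (auto simp: brackets_above_def ls_bracket_above_def)
    then show ?thesis
      unfolding span_above_def using sbracket_swap_mem[OF par_std_elem par_std_elem[OF k]] 1 by blast
  next
    case 2
    then have "sbracket isodd a (std_elem isodd k) \<in> span_above isodd X (length k + m) k"
      using P by (auto simp: brackets_above_def square_bracket_above_def std_elem_square)
    moreover have "\<exists>i. par isodd i a"
      unfolding 2(1) std_elem_square[OF 2(4,5)] by (rule exI, rule par_sbracket[OF par_std_elem[OF 2(4)] par_std_elem[OF 2(4)]])
    ultimately show ?thesis
      unfolding span_above_def using sbracket_swap_mem[OF _ par_std_elem[OF k]] by blast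
  qed
qed

text \<open>The entries are ordered by a swap and the hypothesis is used at the smaller one, which
  is still above \<open>g\<close>. Equal entries give a square or 0.\<close>

lemma ls_bracket_both_above:
  assumes P: "\<And>g'. ls_word g' \<Longrightarrow> lex_less g g' \<Longrightarrow> set g' \<subseteq> X \<Longrightarrow> length g' \<le> n \<Longrightarrow> brackets_above TYPE('k) isodd X n g'"
    and h: "ls_word h1" "ls_word h2" "set h1 \<subseteq> X" "set h2 \<subseteq> X" "lex_less g h1" "lex_less g h2"
    "length h1 + length h2 = n"
  shows "sbracket isodd (std_elem isodd h1) (std_elem isodd h2 :: ('x::linorder, 'k::field) free_alg) \<in> span_above isodd X n g"
proof -
  have *: "sbracket isodd (std_elem isodd f) (std_elem isodd f' :: ('x, 'k) free_alg) \<in> span_above isodd X n g"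
    if "ls_word f" "ls_word f'" "set f \<subseteq> X" "set f' \<subseteq> X" "lex_less f' f" "lex_less g f'" "length f + length f' = n" for f f'
  proof -
    have "sbracket isodd (std_elem isodd f) (std_elem isodd f' :: ('x, 'k) free_alg) \<in> span_above isodd X n f'"
      using P[of f'] that by (auto simp: brackets_above_def ls_bracket_above_def)
    then show ?thesis using span_above_mono[of g f' isodd X n] that by (auto simp: lex_le_def)
  qed
  consider "lex_less h1 h2" | "h1 = h2" | "lex_less h2 h1" using lex_less_linear by blast
  then show ?thesis
  proof cases
    case 1
    then show ?thesis using *[of h2 h1] h sbracket_swap_mem[OF par_std_elem par_std_elem]
      unfolding span_above_def by (simp add: add.commute)
  next
    case 2
    then show ?thesis using span_above_square[of h1 X g isodd] h by auto
  next
    case 3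
    then show ?thesis using *[of h1 h2] h by simp
  qed
qed

text \<open>Only \<open>k < z\<close> needs work, since the hypothesis at \<open>z\<close> then says
  nothing. There the bracket is twice \<open>[k,[k,z]]\<close>, whose inner bracket is shorter and
  lies in the span above \<open>k\<close>. For \<open>k = z\<close> the bracket vanishes.\<close>

lemma square_bracket_both_above:
  assumes P: "\<And>g'. ls_word g' \<Longrightarrow> lex_less g g' \<Longrightarrow> set g' \<subseteq> X \<Longrightarrow> length g' \<le> n \<Longrightarrow> brackets_above TYPE('k) isodd X n g'"
    and lower: "\<And>m g'. m < n \<Longrightarrow> ls_word g' \<Longrightarrow> set g' \<subseteq> X \<Longrightarrow> length g' \<le> m \<Longrightarrow> brackets_above TYPE('k) isodd X m g'"
    and h: "ls_word k" "odd_word isodd k" "ls_word z" "set k \<subseteq> X" "set z \<subseteq> X" "lex_less g k" "lex_less g z"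
    "length k + length k + length z = n"
  shows "sbracket isodd (sbracket isodd (std_elem isodd k) (std_elem isodd k)) (std_elem isodd z :: ('x::linorder, 'k::field) free_alg)
    \<in> span_above isodd X n g"
proof -
  have odd: "par isodd True (std_elem isodd k :: ('x, 'k) free_alg)"
    using par_std_elem_odd h by blast
  consider "lex_less k z" | "k = z" | "lex_less z k" using lex_less_linear by blast
  then show ?thesis
  proof cases
    case 1
    have "sbracket isodd (std_elem isodd z) (std_elem isodd k :: ('x, 'k) free_alg) \<in> span_above isodd X (length k + length z) k"
      using lower[of "length k + length z" k] h 1
      by (auto simp: brackets_above_def ls_bracket_above_def add.commute ls_word_ne)
    then have "sbracket isodd (std_elem isodd k) (std_elem isodd z :: ('x, 'k) free_alg) \<in> span_above isodd X (length k + length z) k"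
      unfolding span_above_def by (rule sbracket_swap_mem[OF par_std_elem par_std_elem, rotated 2]) (use h in auto)
    then have "sbracket isodd (std_elem isodd k) (sbracket isodd (std_elem isodd k) (std_elem isodd z :: ('x, 'k) free_alg))
      \<in> span_above isodd X n k"
      using bracket_span_above_self[of isodd X k "length k + length z"] P[of k] h by (auto simp: add.assoc)
    then have "sbracket isodd (sbracket isodd (std_elem isodd k) (std_elem isodd k)) (std_elem isodd z :: ('x, 'k) free_alg)
      \<in> span_above isodd X n k"
      unfolding sbracket_square_left[OF odd par_std_elem[OF h(3)]] span_above_def by (intro scal.span_scale)
    then show ?thesis using span_above_mono[of g k isodd X n] h by (auto simp: lex_le_def)
  next
    case 2
    then show ?thesis using sbracket_cube(1)[OF odd] by (simp add: span_above_def scal.span_zero)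
  next
    case 3
    then have "sbracket isodd (sbracket isodd (std_elem isodd k) (std_elem isodd k)) (std_elem isodd z :: ('x, 'k) free_alg)
      \<in> span_above isodd X n z"
      using P[of z] h by (auto simp: brackets_above_def square_bracket_above_def)
    then show ?thesis using span_above_mono[of g z isodd X n] h by (auto simp: lex_le_def)
  qed
qed

lemma bracket_span_above:
  fixes v :: "('x::linorder, 'k::field) free_alg"
  assumes P: "\<And>g'. ls_word g' \<Longrightarrow> lex_less g g' \<Longrightarrow> set g' \<subseteq> X \<Longrightarrow> length g' \<le> n \<Longrightarrow> brackets_above TYPE('k) isodd X n g'"
    and lower: "\<And>m g'. m < n \<Longrightarrow> ls_word g' \<Longrightarrow> set g' \<subseteq> X \<Longrightarrow> length g' \<le> m \<Longrightarrow> brackets_above TYPE('k) isodd X m g'"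
    and k: "ls_word k" "set k \<subseteq> X" "lex_less g k" "length k + m = n"
    and v: "v \<in> span_above isodd X m g"
  shows "sbracket isodd (std_elem isodd k) v \<in> span_above isodd X n g"
  using v unfolding span_above_def
proof (rule sbracket_span_right)
  fix a :: "('x, 'k) free_alg" assume "a \<in> std_elem isodd ` words_above isodd X m g"
  then consider w where "a = std_elem isodd w" "set w \<subseteq> X" "length w = m" "ls_word w" "lex_less g w"
    | u where "a = std_elem isodd (u @ u)" "set u \<subseteq> X" "length u + length u = m" "ls_word u" "odd_word isodd u" "lex_less g u"
    unfolding words_above_def by blast
  then show "sbracket isodd (std_elem isodd k) a \<in> scal.span (std_elem isodd ` words_above isodd X n g)"
  proof cases
    case 1
    have "sbracket isodd (std_elem isodd k) (std_elem isodd w :: ('x, 'k) free_alg) \<in> span_above isodd X n g"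
      by (rule ls_bracket_both_above) ((rule P; assumption) | use 1 k in simp)+
    then show ?thesis using 1 unfolding span_above_def by simp
  next
    case 2
    have "sbracket isodd a (std_elem isodd k) \<in> span_above isodd X n g"
      unfolding 2(1) std_elem_square[OF 2(4,5)]
      by (rule square_bracket_both_above) ((rule P; assumption) | (rule lower; assumption) | use 2 k in simp)+
    moreover have "\<exists>i. par isodd i a"
      unfolding 2(1) std_elem_square[OF 2(4,5)] by (rule exI, rule par_sbracket[OF par_std_elem[OF 2(4)] par_std_elem[OF 2(4)]])
    ultimately show ?thesis
      unfolding span_above_def using sbracket_swap_mem[OF _ par_std_elem[OF k(1)]] by blast
  qed
qed

text \<open>If the standard brackets of \<open>f\<close> and \<open>g\<close> do not combine to a
  monomial, then \<open>f = uv\<close> with \<open>v\<close> above \<open>g\<close>. The Jacobi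
  identity moves \<open>g\<close> inwards: the inner brackets are shorter, hence combinations of
  words above \<open>g\<close>, and the outer brackets have both entries above \<open>g\<close>,
  where the claim is already known.\<close>

lemma brackets_above_step:
  assumes g: "ls_word g" "set g \<subseteq> X"
    and P: "\<And>g'. ls_word g' \<Longrightarrow> lex_less g g' \<Longrightarrow> set g' \<subseteq> X \<Longrightarrow> length g' \<le> n \<Longrightarrow> brackets_above TYPE('k::field) isodd X n g'"
    and lower: "\<And>m g'. m < n \<Longrightarrow> ls_word g' \<Longrightarrow> set g' \<subseteq> X \<Longrightarrow> length g' \<le> m \<Longrightarrow> brackets_above TYPE('k) isodd X m g'"
  shows "brackets_above TYPE('k) isodd X n (g :: 'x::linorder list)"
  unfolding brackets_above_def ls_bracket_above_def square_bracket_above_def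
proof (intro conjI allI impI; elim conjE)
  fix f :: "'x list" assume f: "ls_word f" "set f \<subseteq> X" "lex_less g f" "length f + length g = n"
  let ?E = "std_elem isodd :: _ \<Rightarrow> ('x, 'k) free_alg"
  have m: "ls_monomial (std isodd f)" "und (std isodd f) = f"
    "ls_monomial (std isodd g)" "und (std isodd g) = g"
    using std_ls_word f g by auto
  show "sbracket isodd (?E f) (?E g) \<in> span_above isodd X n g"
  proof (cases "\<forall>v1 v2. std isodd f = Node v1 v2 \<longrightarrow> lex_le (und v2) g")
    case True
    then have mon: "ls_monomial (Node (std isodd f) (std isodd g))" using m f by auto
    then have "std isodd (f @ g) = Node (std isodd f) (std isodd g)"
      using std_eq[of isodd "Node (std isodd f) (std isodd g)"] m by (simp add: sls_monomial_def)
    then have "?E (f @ g) = sbracket isodd (?E f) (?E g)" by (simp add: std_elem_def)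
    moreover have "ls_word (f @ g)" using f g by (auto intro: ls_word_append)
    then have "lex_less g (f @ g)" using ls_word_suffix[of f g] f g by (auto intro: mless_lex dest: ls_word_ne)
    then have "?E (f @ g) \<in> span_above isodd X n g"
      using span_above_word[of "f @ g" X g isodd] \<open>ls_word (f @ g)\<close> f g by auto
    ultimately show ?thesis by simp
  next
    case False
    then obtain m1 m2 where std: "std isodd f = Node m1 m2" and less: "lex_less g (und m2)"
      by (auto simp: not_lex_le)
    let ?u = "und m1" and ?v = "und m2"
    have mon: "ls_monomial m1" "ls_monomial m2" "lex_less ?v ?u" using m(1) std by auto
    have ls: "ls_word ?u" "ls_word ?v" using mon ls_monomial_ls_word by auto
    have fe: "f = ?u @ ?v" using m(2) std by simp
    have "std isodd ?u = m1" "std isodd ?v = m2" using mon by (auto intro!: std_eq simp: sls_monomial_def)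
    then have E: "?E f = sbracket isodd (?E ?u) (?E ?v)" using std by (simp add: std_elem_def)
    have less': "lex_less g ?u" using less mon lex_less_trans by blast
    have len: "length ?u > 0" "length ?v > 0" by auto
    have a: "sbracket isodd (?E ?v) (?E g) \<in> span_above isodd X (length ?v + length g) g"
      using lower[of "length ?v + length g" g] f fe len less g ls
      by (auto simp: brackets_above_def ls_bracket_above_def)
    have 1: "sbracket isodd (?E ?u) (sbracket isodd (?E ?v) (?E g)) \<in> span_above isodd X n g"
      by (rule bracket_span_above[where m = "length ?v + length g"])
        ((rule P; assumption) | (rule lower; assumption) | rule a | use fe f less' ls in simp)+
    have b: "sbracket isodd (?E ?u) (?E g) \<in> span_above isodd X (length ?u + length g) g"
      using lower[of "length ?u + length g" g] f fe len less' g ls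
      by (auto simp: brackets_above_def ls_bracket_above_def)
    have 2: "sbracket isodd (?E ?v) (sbracket isodd (?E ?u) (?E g)) \<in> span_above isodd X n g"
      by (rule bracket_span_above[where m = "length ?u + length g"])
        ((rule P; assumption) | (rule lower; assumption) | rule b | use fe f less ls in simp)+
    show ?thesis
      unfolding E sbracket_jacobi[OF par_std_elem[OF ls(1)] par_std_elem[OF ls(2)] par_std_elem[OF g(1)]]
      using 1 2 unfolding span_above_def by (intro scal.span_add scal.span_scale)
  qed
next
  fix k :: "'x list"
  assume k: "ls_word k" "odd_word isodd k" "set k \<subseteq> X" "lex_less g k" "length k + length k + length g = n"
  let ?E = "std_elem isodd :: _ \<Rightarrow> ('x, 'k) free_alg"
  have odd: "par isodd True (?E k)" using par_std_elem_odd k by blast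
  have a: "sbracket isodd (?E k) (?E g) \<in> span_above isodd X (length k + length g) g"
    using lower[of "length k + length g" g] k g
    by (auto simp: brackets_above_def ls_bracket_above_def ls_word_ne)
  have "sbracket isodd (?E k) (sbracket isodd (?E k) (?E g)) \<in> span_above isodd X n g"
    by (rule bracket_span_above[where m = "length k + length g"])
      ((rule P; assumption) | (rule lower; assumption) | rule a | use k in simp)+
  then show "sbracket isodd (sbracket isodd (?E k) (?E k)) (?E g) \<in> span_above isodd X n g"
    unfolding sbracket_square_left[OF odd par_std_elem[OF g(1)]] span_above_def by (rule scal.span_scale)
qed

text \<open>Induction on the length, and for fixed length on the number of words above
  \<open>g\<close>. That number is finite because the letters are confined to a finite
  \<open>X\<close>; in the applications \<open>X\<close> consists of the letters of the two given
  words.\<close>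

lemma brackets_above:
  assumes X: "finite X" and g: "ls_word g" "set g \<subseteq> X" "length g \<le> n"
  shows "brackets_above TYPE('k::field) isodd X n (g :: 'x::linorder list)"
  using g
proof (induction n arbitrary: g rule: less_induct)
  case (less n)
  note outer = less.IH
  define above where "above = (\<lambda>g. {h :: 'x list. set h \<subseteq> X \<and> length h \<le> n \<and> lex_less g h})"
  have fin: "finite (above h)" for h
    by (rule finite_subset[OF _ finite_lists_length_le[OF X, of n]]) (auto simp: above_def)
  show ?case
    using less.prems
  proof (induction "card (above g)" arbitrary: g rule: less_induct)
    case less
    show ?case
    proof (rule brackets_above_step)
      fix g' assume g': "ls_word g'" "lex_less g g'" "set g' \<subseteq> X" "length g' \<le> n"
      have "above g' \<subset> above g"
      proof
        show "above g' \<subseteq> above g" using g' by (auto simp: above_def intro: lex_less_trans)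
        have "g' \<in> above g" "g' \<notin> above g'" using g' by (auto simp: above_def)
        then show "above g' \<noteq> above g" by blast
      qed
      then show "brackets_above TYPE('k) isodd X n g'"
        using less.hyps[of g'] g' fin by (auto intro: psubset_card_mono)
    qed (use less.prems outer in auto)
  qed
qed

abbreviation sls_span :: "('x::linorder \<Rightarrow> bool) \<Rightarrow> ('x, 'k::field) free_alg set" where
  "sls_span isodd \<equiv> scal.span (std_elem isodd ` {u. sls_word isodd u})"

lemma span_above_subset: "span_above isodd X n g \<subseteq> sls_span isodd"
  unfolding span_above_def by (intro scal.span_mono) (auto simp: words_above_def sls_word_def)

text \<open>Extending a word makes it smaller, so there is no least word. The bound provides the
  parameter \<open>g\<close> of \<open>span_above\<close> when both entries are arbitrary.\<close>

lemma common_lower_bound: "\<exists>g. lex_less g u \<and> lex_less g v" if "u \<noteq> []" "v \<noteq> []"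
  using lex_less_linear[of u v] lex_less_prefix[of u u] lex_less_prefix[of v v] that
  by (meson lex_less_trans)

lemma sls_wordE:
  assumes "sls_word isodd w"
  obtains "ls_word w" | u where "ls_word u" "odd_word isodd u" "w = u @ u"
  using assms unfolding sls_word_def by blast

lemma par_std_elem_sls: "sls_word isodd w \<Longrightarrow> \<exists>i. par isodd i (std_elem isodd w)"
  by (erule sls_wordE) (auto simp: std_elem_square intro: par_std_elem par_sbracket)

lemma ls_bracket_sls_span:
  fixes v :: "('x::linorder, 'k::field) free_alg"
  assumes "ls_word u" "v \<in> sls_span isodd"
  shows "sbracket isodd (std_elem isodd u) v \<in> sls_span isodd"
  using assms(2)
proof (rule sbracket_span_right)
  fix a :: "('x, 'k) free_alg" assume "a \<in> std_elem isodd ` {u. sls_word isodd u}"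
  then obtain w where w: "sls_word isodd w" "a = std_elem isodd w" by blast
  from w(1) show "sbracket isodd (std_elem isodd u) a \<in> sls_span isodd"
  proof (cases rule: sls_wordE)
    case 1
    obtain g where "lex_less g u" "lex_less g w" using common_lower_bound[of u w] assms 1 by (auto dest: ls_word_ne)
    then have "sbracket isodd (std_elem isodd u) (std_elem isodd w :: ('x, 'k) free_alg)
      \<in> span_above isodd (set u \<union> set w) (length u + length w) g"
      by (intro ls_bracket_both_above brackets_above) (use 1 assms in auto)
    then show ?thesis using span_above_subset w(2) by blast
  next
    case (2 k)
    obtain g where "lex_less g u" "lex_less g k" using common_lower_bound[of u k] assms 2 by (auto dest: ls_word_ne)
    then have "sbracket isodd (sbracket isodd (std_elem isodd k) (std_elem isodd k)) (std_elem isodd u :: ('x, 'k) free_alg)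
      \<in> span_above isodd (set u \<union> set k) (length k + length k + length u) g"
      by (intro square_bracket_both_above brackets_above) (use 2 assms in auto)
    then have "sbracket isodd a (std_elem isodd u) \<in> sls_span isodd"
      unfolding w(2) 2(3) std_elem_square[OF 2(1,2)] by (rule subsetD[OF span_above_subset])
    then show ?thesis using sbracket_swap_mem par_std_elem[OF assms(1)] par_std_elem_sls[OF w(1)] w(2) by blast
  qed
qed

lemma sbracket_sls_span:
  fixes u v :: "('x::linorder, 'k::field) free_alg"
  assumes "u \<in> sls_span isodd" "v \<in> sls_span isodd"
  shows "sbracket isodd u v \<in> sls_span isodd"
proof -
  have base: "sbracket isodd (std_elem isodd w) (std_elem isodd w' :: ('x, 'k) free_alg) \<in> sls_span isodd"
    if w: "sls_word isodd w" and w': "sls_word isodd w'" for w w'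
  proof -
    have s: "(std_elem isodd w' :: ('x, 'k) free_alg) \<in> sls_span isodd" using w' by (intro scal.span_base) auto
    from w show ?thesis
    proof (cases rule: sls_wordE)
      case 1
      then show ?thesis using ls_bracket_sls_span s by blast
    next
      case (2 k)
      obtain i where i: "par isodd i (std_elem isodd w' :: ('x, 'k) free_alg)" using par_std_elem_sls[OF w'] by blast
      \<comment> \<open>A square on the left acts as twice the iterated bracket with its root, which
        reduces it to the case of a Lyndon--Shirshov word on the left.\<close>
      have "sbracket isodd (std_elem isodd k) (sbracket isodd (std_elem isodd k) (std_elem isodd w' :: ('x, 'k) free_alg)) \<in> sls_span isodd"
        using ls_bracket_sls_span[OF 2(1)] s by blast
      then show ?thesis
        unfolding 2(3) std_elem_square[OF 2(1,2)] sbracket_square_left[OF par_std_elem_odd[OF 2(1,2)] i]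
        by (rule scal.span_scale)
    qed
  qed
  have "sbracket isodd (std_elem isodd w) v \<in> sls_span isodd" if "sls_word isodd w" for w
    using assms(2) by (rule sbracket_span_right) (use base that in auto)
  moreover have "scal.subspace {u. sbracket isodd u v \<in> sls_span isodd}"
    by (auto simp: scal.subspace_def sbracket_add_left sbracket_scal_left scal.span_zero
        intro: scal.span_add scal.span_scale)
  ultimately have "sls_span isodd \<subseteq> {u. sbracket isodd u v \<in> sls_span isodd}"
    by (intro scal.span_minimal) auto
  then show ?thesis using assms(1) by blast
qed

section \<open>The free Lie superalgebra lies in the span of the standard monomials\<close>

lemma lie_subalgebra_free_lie_set: "lie_subalgebra isodd (free_lie_set isodd)"
  unfolding free_lie_set_def
  by (rule hull_in) (auto simp: lie_subalgebra_def lin_subspace_def)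

lemma letter_free_lie_set: "letter x \<in> free_lie_set isodd"
  unfolding free_lie_set_def by (rule hull_inc) simp

lemma subspace_free_lie_set: "scal.subspace (free_lie_set isodd)"
  by (rule lie_subalgebra_free_lie_set[unfolded lie_subalgebra_def lin_subspace_iff, THEN conjunct1])

lemma sbracket_free_lie_set:
  "p \<in> free_lie_set isodd \<Longrightarrow> q \<in> free_lie_set isodd \<Longrightarrow> sbracket isodd p q \<in> free_lie_set isodd"
  by (rule lie_subalgebra_free_lie_set[unfolded lie_subalgebra_def, THEN conjunct2, rule_format])

lemma ev_free_lie_set: "(\<And>y. y \<in> set (und m) \<Longrightarrow> f y \<in> free_lie_set isodd) \<Longrightarrow> ev isodd f m \<in> free_lie_set isodd"
  by (induction m) (auto intro: sbracket_free_lie_set)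

lemma free_lie_set_subset: "free_lie_set isodd \<subseteq> sls_span isodd"
  unfolding free_lie_set_def
proof (rule hull_minimal)
  show "range letter \<subseteq> sls_span isodd"
  proof clarify
    fix x
    have "std_elem isodd [x] = letter x" "sls_word isodd [x]"
      using std_eq[of isodd "Leaf x"] by (auto simp: std_elem_def sls_monomial_def sls_word_def)
    then show "letter x \<in> sls_span isodd" by (metis (mono_tags, lifting) imageI mem_Collect_eq scal.span_base)
  qed
  show "lie_subalgebra isodd (sls_span isodd)"
    unfolding lie_subalgebra_def lin_subspace_iff using sbracket_sls_span by (auto simp: scal.subspace_span)
qed

text \<open>The coefficients belong to the indices and not to the vectors \<open>F w\<close>,
  because \<open>F\<close> need not be injective. Nonvanishing coefficients ensure later that the
  largest index gives the leading word.\<close>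

lemma span_image_explicit:
  assumes "f \<in> scal.span (F ` A)"
  obtains B c where "finite B" "B \<subseteq> A" "\<And>w. w \<in> B \<Longrightarrow> c w \<noteq> 0" "f = (\<Sum>w\<in>B. c w \<bullet>\<^sub>K F w)"
proof -
  from assms have "\<exists>B c. finite B \<and> B \<subseteq> A \<and> f = (\<Sum>w\<in>B. c w \<bullet>\<^sub>K F w)"
  proof (induction rule: scal.span_induct_alt)
    case base
    show ?case by (intro exI[of _ "{}"]) auto
  next
    case (step d x y)
    then obtain w B c where w: "w \<in> A" "x = F w" and B: "finite B" "B \<subseteq> A" "y = (\<Sum>w\<in>B. c w \<bullet>\<^sub>K F w)" by auto
    define c' where "c' = (\<lambda>v. (if v \<in> B then c v else 0) + (if v = w then d else 0))"
    have "(\<Sum>v\<in>insert w B. c' v \<bullet>\<^sub>K F v)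
      = (\<Sum>v\<in>insert w B. (if v \<in> B then c v else 0) \<bullet>\<^sub>K F v) + (\<Sum>v\<in>insert w B. (if v = w then d else 0) \<bullet>\<^sub>K F v)"
      by (simp add: c'_def scal.scale_left_distrib sum.distrib)
    also have "(\<Sum>v\<in>insert w B. (if v \<in> B then c v else 0) \<bullet>\<^sub>K F v) = y"
      unfolding B(3) using B(1) by (intro sum.mono_neutral_cong_right) auto
    also have "(\<Sum>v\<in>insert w B. (if v = w then d else 0) \<bullet>\<^sub>K F v) = (\<Sum>v\<in>{w}. d \<bullet>\<^sub>K F v)"
      using B(1) by (intro sum.mono_neutral_cong_right) auto
    finally show ?case using B w by (intro exI[of _ "insert w B"] exI[of _ c']) (auto simp: add.commute)
  qed
  then obtain B c where B: "finite B" "B \<subseteq> A" "f = (\<Sum>w\<in>B. c w \<bullet>\<^sub>K F w)" by blast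
  have "(\<Sum>w\<in>B. c w \<bullet>\<^sub>K F w) = (\<Sum>w\<in>{w\<in>B. c w \<noteq> 0}. c w \<bullet>\<^sub>K F w)"
    using B(1) by (intro sum.mono_neutral_right) auto
  then show ?thesis using B by (intro that[of "{w\<in>B. c w \<noteq> 0}" c]) auto
qed

lemma lead_at_sum_index:
  assumes "finite B" "u \<in> B" "\<And>z. z \<in> B \<Longrightarrow> z \<noteq> u \<Longrightarrow> k z \<lless> k u"
    "\<And>z. z \<in> B \<Longrightarrow> lead_at (F z) (k z) (d z)"
  shows "lead_at (\<Sum>z\<in>B. c z \<bullet>\<^sub>K F z) (k u) (c u * d u)"
proof -
  have "lead_at (\<Sum>w\<in>C. c w \<bullet>\<^sub>K F w) (k u) 0" if "finite C" "C \<subseteq> B - {u}" for C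
    using that
  proof (induction C rule: finite_induct)
    case empty
    then show ?case by (simp add: lead_at_def)
  next
    case (insert w C)
    then have "lead_at (c w \<bullet>\<^sub>K F w) (k u) 0"
      using assms(3)[of w] by (intro lead_at_lower[OF lead_at_scal[OF assms(4)[of w]]]) auto
    then show ?case using lead_at_add[of "c w \<bullet>\<^sub>K F w" "k u" 0] insert by auto
  qed
  from this[of "B - {u}"] have "lead_at (c u \<bullet>\<^sub>K F u + (\<Sum>w\<in>B-{u}. c w \<bullet>\<^sub>K F w)) (k u) (c u * d u)"
    using lead_at_add[OF lead_at_scal[OF assms(4)[of u]], of "\<Sum>w\<in>B-{u}. c w \<bullet>\<^sub>K F w" 0 "c u"] assms(1,2) by auto
  then show ?thesis using assms(1,2) by (simp add: sum.remove[of B u])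
qed

lemma lead_at_sum:
  assumes "finite B" "B \<noteq> {}" "\<And>w. w \<in> B \<Longrightarrow> lead_at (F w) w (d w)"
  shows "\<exists>u\<in>B. lead_at (\<Sum>w\<in>B. c w \<bullet>\<^sub>K F w) u (c u * d u)"
proof -
  obtain u where "u \<in> B" "\<forall>w\<in>B. w \<lless> u \<or> w = u" using llex_max_exists[OF assms(1,2)] by blast
  then show ?thesis using lead_at_sum_index[OF assms(1), of u "\<lambda>w. w" F d c] assms(3) by blast
qed

text \<open>The standard monomials have distinct leading words with coefficient 1 or 2, nonzero in
  the field. So in a combination of them the largest word cannot cancel.\<close>

lemma sls_word_lead_word:
  assumes two: "(2 :: 'k::field) \<noteq> 0" and f: "f \<in> free_lie_set isodd" "(f :: ('x::linorder, 'k) free_alg) \<noteq> 0"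
  shows "sls_word isodd (lead_word f)"
proof -
  have "f \<in> sls_span isodd" using f(1) free_lie_set_subset by blast
  then obtain B c where B: "finite B" "B \<subseteq> {u. sls_word isodd u}" "\<And>w. w \<in> B \<Longrightarrow> c w \<noteq> 0"
    "f = (\<Sum>w\<in>B. c w \<bullet>\<^sub>K std_elem isodd w)" by (rule span_image_explicit) blast
  then have "B \<noteq> {}" using f(2) by auto
  have "\<exists>d. d \<noteq> 0 \<and> lead_at (std_elem isodd w :: ('x, 'k) free_alg) w d" if "w \<in> B" for w
  proof -
    have "sls_word isodd w" using B that by blast
    then show ?thesis
    proof (cases rule: sls_wordE)
      case 1
      then show ?thesis using lead_at_std[of w isodd] by (intro exI[of _ 1]) (simp add: std_elem_def)
    next
      case (2 u)
      then show ?thesis using lead_at_std_square[of u isodd] two by (intro exI[of _ 2]) (simp add: std_elem_def)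
    qed
  qed
  then obtain d where d: "\<And>w. w \<in> B \<Longrightarrow> d w \<noteq> 0 \<and> lead_at (std_elem isodd w :: ('x, 'k) free_alg) w (d w)" by metis
  obtain u where "u \<in> B" "lead_at f u (c u * d u)"
    using lead_at_sum[OF B(1) \<open>B \<noteq> {}\<close>, of "std_elem isodd" d c] d B(4) by blast
  then show ?thesis using lead_at_lead(1)[of f u] B d by auto
qed

section \<open>Associative Groebner--Shirshov bases\<close>

definition terms_in :: "('x::linorder, 'k::field) free_alg set \<Rightarrow> 'x list set \<Rightarrow> ('x, 'k) free_alg set" where
  "terms_in S D = {word a * s * word b |a s b. s \<in> S \<and> a @ lead_word s @ b \<in> D}"

text \<open>For \<open>D = UNIV\<close> this is the two-sided ideal generated by \<open>S\<close> in
  the free associative algebra; for \<open>D = words_below w\<close> it consists of the elements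
  that are trivial modulo \<open>(S, w)\<close> in Shirshov's sense.\<close>

definition ideal_in :: "('x::linorder, 'k::field) free_alg set \<Rightarrow> 'x list set \<Rightarrow> ('x, 'k) free_alg set" where
  "ideal_in S D = scal.span (terms_in S D)"

abbreviation words_below :: "'x::linorder list \<Rightarrow> 'x list set" where
  "words_below w \<equiv> {v. v \<lless> w}"

abbreviation words_upto :: "'x::linorder list \<Rightarrow> 'x list set" where
  "words_upto w \<equiv> {v. v \<lless> w \<or> v = w}"

definition monic_set :: "('x::linorder, 'k::field) free_alg set \<Rightarrow> bool" where
  "monic_set S \<longleftrightarrow> (\<forall>s\<in>S. lead_at s (lead_word s) 1)"

lemma terms_in_mono: "S \<subseteq> S' \<Longrightarrow> D \<subseteq> D' \<Longrightarrow> terms_in S D \<subseteq> terms_in S' D'"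
  unfolding terms_in_def by blast

lemma ideal_in_mono: "S \<subseteq> S' \<Longrightarrow> D \<subseteq> D' \<Longrightarrow> ideal_in S D \<subseteq> ideal_in S' D'"
  unfolding ideal_in_def by (intro scal.span_mono terms_in_mono)

lemma ideal_in_term: "s \<in> S \<Longrightarrow> a @ lead_word s @ b \<in> D \<Longrightarrow> word a * s * word b \<in> ideal_in S D"
  unfolding ideal_in_def terms_in_def by (intro scal.span_base) blast

lemma ideal_in_0 [simp]: "0 \<in> ideal_in S D"
  by (simp add: ideal_in_def scal.span_zero)

lemma ideal_in_add: "f \<in> ideal_in S D \<Longrightarrow> g \<in> ideal_in S D \<Longrightarrow> f + g \<in> ideal_in S D"
  unfolding ideal_in_def by (rule scal.span_add)

lemma ideal_in_diff: "f \<in> ideal_in S D \<Longrightarrow> g \<in> ideal_in S D \<Longrightarrow> f - g \<in> ideal_in S D"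
  unfolding ideal_in_def by (rule scal.span_diff)

lemma ideal_in_scal: "f \<in> ideal_in S D \<Longrightarrow> c \<bullet>\<^sub>K f \<in> ideal_in S D"
  unfolding ideal_in_def by (rule scal.span_scale)

lemma ideal_in_sum: "(\<And>i. i \<in> A \<Longrightarrow> f i \<in> ideal_in S D) \<Longrightarrow> (\<Sum>i\<in>A. f i) \<in> ideal_in S D"
  unfolding ideal_in_def by (rule scal.span_sum)

lemma ideal_in_induct:
  assumes "f \<in> ideal_in S D" "scal.subspace V"
    "\<And>a s b. s \<in> S \<Longrightarrow> a @ lead_word s @ b \<in> D \<Longrightarrow> word a * s * word b \<in> V"
  shows "f \<in> V"
  using scal.span_minimal[of "terms_in S D" V] assms unfolding ideal_in_def terms_in_def by blast

lemma ideal_in_mult: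
  assumes "f \<in> ideal_in S D" "\<And>d. d \<in> D \<Longrightarrow> a @ d @ b \<in> D'"
  shows "word a * f * word b \<in> ideal_in S D'"
proof -
  have "f \<in> {f. word a * f * word b \<in> ideal_in S D'}"
    using assms(1)
  proof (rule ideal_in_induct)
    show "scal.subspace {f. word a * f * word b \<in> ideal_in S D'}"
      by (auto simp: scal.subspace_def distrib_left distrib_right intro: ideal_in_add ideal_in_scal)
    fix a' s b' assume "s \<in> S" "a' @ lead_word s @ b' \<in> D"
    then have "word (a @ a') * s * word (b' @ b) \<in> ideal_in S D'"
      using assms(2)[of "a' @ lead_word s @ b'"] by (intro ideal_in_term) auto
    moreover have "word (a @ a') * s * word (b' @ b) = word a * (word a' * s * word b') * word b"
      unfolding word_mult[symmetric] by (simp add: mult.assoc del: word_mult)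
    ultimately show "word a' * s * word b' \<in> {f. word a * f * word b \<in> ideal_in S D'}" by simp
  qed
  then show ?thesis by simp
qed

lemma ideal_in_mult_left:
  assumes "s \<in> S" "\<And>u. u \<in> keys p \<Longrightarrow> u @ lead_word s @ b \<in> D"
  shows "p * s * word b \<in> ideal_in S D"
proof -
  have "p * s * word b = (\<Sum>u\<in>keys p. lookup p u \<bullet>\<^sub>K (word u * s * word b))"
    by (subst poly_mapping_sum_words) (simp add: sum_distrib_right)
  also have "\<dots> \<in> ideal_in S D" using assms by (intro ideal_in_sum ideal_in_scal ideal_in_term) auto
  finally show ?thesis .
qed

lemma ideal_in_mult_right:
  assumes "s \<in> S" "\<And>u. u \<in> keys p \<Longrightarrow> a @ lead_word s @ u \<in> D"
  shows "word a * s * p \<in> ideal_in S D"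
proof -
  have "word a * s * p = (\<Sum>u\<in>keys p. lookup p u \<bullet>\<^sub>K (word a * s * word u))"
    by (subst poly_mapping_sum_words) (simp add: sum_distrib_left)
  also have "\<dots> \<in> ideal_in S D" using assms by (intro ideal_in_sum ideal_in_scal ideal_in_term) auto
  finally show ?thesis .
qed

lemma lead_at_term:
  "monic_set S \<Longrightarrow> s \<in> S \<Longrightarrow> lead_at (word a * s * word b) (a @ lead_word s @ b) 1"
  using lead_at_mult[OF lead_at_mult[OF lead_at_word, of s "lead_word s" 1 a] lead_at_word, of b]
  by (auto simp: monic_set_def)

section \<open>Lowering representations: the composition-diamond lemma\<close>

definition llex_closed :: "'x::linorder list set \<Rightarrow> bool" where
  "llex_closed D \<longleftrightarrow> (\<forall>v\<in>D. \<forall>u. u \<lless> v \<longrightarrow> u \<in> D)"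

lemma llex_closed_words_below: "llex_closed (words_below w)" "llex_closed (words_upto w)"
  by (auto simp: llex_closed_def intro: llex_less_trans)

lemma keys_ideal_in:
  assumes "monic_set S" "llex_closed D" "f \<in> ideal_in S D"
  shows "keys f \<subseteq> D"
proof -
  have "f \<in> {f. keys f \<subseteq> D}"
    using assms(3)
  proof (rule ideal_in_induct)
    show "scal.subspace {f. keys f \<subseteq> D}"
      by (auto simp: scal.subspace_def dest!: subsetD[OF keys_add] subsetD[OF keys_scal])
    fix a s b assume "s \<in> S" "a @ lead_word s @ b \<in> D"
    then show "word a * s * word b \<in> {f. keys f \<subseteq> D}"
      using lead_at_keys[OF lead_at_term[OF assms(1)], of s _ a b] assms(2) unfolding llex_closed_def by blast
  qed
  then show ?thesis by simp
qed

lemma ideal_in_words_below: "monic_set S \<Longrightarrow> f \<in> ideal_in S (words_below w) \<Longrightarrow> below f w"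
  using keys_ideal_in[OF _ llex_closed_words_below(1)] by (auto simp: below_def)

text \<open>A representation has finitely many terms, hence a largest leading word. This supplies
  the word on which the descent below is run; the empty representation is the case
  \<open>f = 0\<close>.\<close>

lemma ideal_in_max:
  assumes "f \<in> ideal_in S D"
  shows "f = 0 \<or> (\<exists>w\<in>D. f \<in> ideal_in S (words_upto w))"
  using assms unfolding ideal_in_def
proof (induction rule: scal.span_induct_alt)
  case (step c x y)
  obtain a s b where x: "x = word a * s * word b" "s \<in> S" "a @ lead_word s @ b \<in> D"
    using step(1) by (auto simp: terms_in_def)
  define w where "w = a @ lead_word s @ b"
  have xw: "x \<in> ideal_in S (words_upto w)" unfolding x by (rule ideal_in_term) (use x in \<open>auto simp: w_def\<close>)
  show ?case
  proof (cases "y = 0")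
    case True
    then show ?thesis using xw x by (auto simp: w_def[symmetric] ideal_in_def[symmetric] intro: ideal_in_scal)
  next
    case False
    then obtain w' where w': "w' \<in> D" "y \<in> ideal_in S (words_upto w')" using step by (auto simp: ideal_in_def)
    define m where "m = (if w \<lless> w' then w' else w)"
    have "words_upto w \<subseteq> words_upto m" "words_upto w' \<subseteq> words_upto m"
      using llex_less_linear[of w w'] by (auto simp: m_def intro: llex_less_trans)
    then have "c \<bullet>\<^sub>K x + y \<in> ideal_in S (words_upto m)"
      using xw w' ideal_in_mono[of S S] by (intro ideal_in_add ideal_in_scal) blast+
    moreover have "m \<in> D" using w' x by (auto simp: m_def w_def)
    ultimately show ?thesis by (auto simp: ideal_in_def)
  qed
qed simp

text \<open>All pairs of occurrences in a common word are meant, disjoint ones included;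
  \<open>resolvableI\<close> reduces them to overlaps and inclusions.\<close>

definition resolvable :: "('x::linorder, 'k::field) free_alg set \<Rightarrow> bool" where
  "resolvable S \<longleftrightarrow> (\<forall>a s b a' s' b'. s \<in> S \<and> s' \<in> S \<and> a @ lead_word s @ b = a' @ lead_word s' @ b' \<longrightarrow>
     word a * s * word b - word a' * s' * word b' \<in> ideal_in S (words_below (a @ lead_word s @ b)))"

text \<open>Modulo lower terms, all products \<open>asb\<close> with leading word \<open>w\<close>
  agree, so a single one of them accounts for the whole top layer of a representation.\<close>

lemma ideal_in_split:
  assumes S: "resolvable S" and f: "f \<in> ideal_in S (words_upto w)"
    and t: "t \<in> S" "a @ lead_word t @ b = w"
  shows "\<exists>c. f - c \<bullet>\<^sub>K (word a * t * word b) \<in> ideal_in S (words_below w)"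
proof -
  let ?t = "word a * t * word b"
  have "f \<in> scal.span (insert ?t (ideal_in S (words_below w)))"
    using f
  proof (rule ideal_in_induct)
    fix a' s b' assume s: "s \<in> S" "a' @ lead_word s @ b' \<in> words_upto w"
    show "word a' * s * word b' \<in> scal.span (insert ?t (ideal_in S (words_below w)))"
    proof (cases "a' @ lead_word s @ b' = w")
      case True
      then have "word a' * s * word b' - ?t \<in> ideal_in S (words_below w)"
        using S[unfolded resolvable_def, rule_format, of s t a' b' a b] s t by simp
      then have "(word a' * s * word b' - ?t) + ?t \<in> scal.span (insert ?t (ideal_in S (words_below w)))"
        by (intro scal.span_add scal.span_base) auto
      then show ?thesis by simp
    next
      case False
      then show ?thesis using s by (intro scal.span_base insertI2 ideal_in_term) auto
    qed
  qed (rule scal.subspace_span)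
  then show ?thesis
    by (simp add: scal.span_breakdown_eq ideal_in_def scal.span_span)
qed

lemma ideal_in_words_upto_no_term:
  assumes "\<And>a s b. s \<in> S \<Longrightarrow> a @ lead_word s @ b \<noteq> w"
  shows "ideal_in S (words_upto w) = ideal_in S (words_below w)"
proof -
  have "terms_in S (words_upto w) = terms_in S (words_below w)"
    using assms unfolding terms_in_def by blast
  then show ?thesis by (simp add: ideal_in_def)
qed

text \<open>The composition-diamond lemma: a representation whose largest term lies outside \<open>D\<close> can be
  lowered, because the terms at that word have to cancel.\<close>

lemma composition_diamond:
  fixes S :: "('x::linorder, 'k::field) free_alg set"
  assumes wf: "wfp ((<) :: 'x \<Rightarrow> 'x \<Rightarrow> bool)" and S: "monic_set S" "resolvable S"
    and D: "llex_closed D" and f: "f \<in> ideal_in S UNIV" "keys f \<subseteq> D"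
  shows "f \<in> ideal_in S D"
proof -
  have "f \<in> ideal_in S D" if "f \<in> ideal_in S (words_upto w)" for w
    using that
  proof (induction w rule: wfp_induct_rule[OF wfp_llex_less[OF wf]])
    case (1 w)
    show ?case
    proof (cases "w \<in> D")
      case True
      then have "words_upto w \<subseteq> D" using D by (auto simp: llex_closed_def)
      then show ?thesis using ideal_in_mono[of S S] 1(2) by blast
    next
      case False
      then have fw: "lookup f w = 0" using f(2) by (auto simp: in_keys_iff)
      have "f \<in> ideal_in S (words_below w)"
      proof (cases "\<exists>a s b. s \<in> S \<and> a @ lead_word s @ b = w")
        case True
        then obtain a s b where s: "s \<in> S" "a @ lead_word s @ b = w" by blast
        obtain c where c: "f - c \<bullet>\<^sub>K (word a * s * word b) \<in> ideal_in S (words_below w)"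
          using ideal_in_split[OF S(2) 1(2) s] by blast
        have "w \<notin> keys (f - c \<bullet>\<^sub>K (word a * s * word b))"
          using ideal_in_words_below[OF S(1) c, unfolded below_def] llex_less_irrefl by blast
        then have "lookup (f - c \<bullet>\<^sub>K (word a * s * word b)) w = 0" by (simp add: in_keys_iff)
        moreover have "lookup (word a * s * word b) w = 1"
          using lookup_lead_at[OF lead_at_term[OF S(1) s(1)], of a b] s(2) by simp
        ultimately have "c = 0" using fw by (simp add: lookup_minus)
        then show ?thesis using c by simp
      next
        case False
        then show ?thesis using ideal_in_words_upto_no_term[of S w] 1(2) by blast
      qed
      from ideal_in_max[OF this] show ?thesis using 1(1) by auto
    qed
  qed
  then show ?thesis using ideal_in_max[OF f(1)] by auto
qed

text \<open>A representation can be lowered to words up to the leading word of \<open>f\<close>. If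
  no product \<open>asb\<close> led with that word, all terms would lie strictly below it.\<close>

lemma composition_diamond_lead_word:
  fixes S :: "('x::linorder, 'k::field) free_alg set"
  assumes wf: "wfp ((<) :: 'x \<Rightarrow> 'x \<Rightarrow> bool)" and S: "monic_set S" "resolvable S"
    and f: "f \<in> ideal_in S UNIV" "f \<noteq> 0"
  shows "\<exists>s\<in>S. \<exists>a b. lead_word f = a @ lead_word s @ b"
proof (rule ccontr)
  assume neg: "\<not> ?thesis"
  have l: "lead_at f (lead_word f) (lead_cf f)" "lead_cf f \<noteq> 0" using lead_at_lead_word[OF f(2)] by auto
  have "keys f \<subseteq> words_upto (lead_word f)" using lead_at_keys[OF l(1)] by blast
  then have "f \<in> ideal_in S (words_upto (lead_word f))"
    by (intro composition_diamond[OF wf S llex_closed_words_below(2) f(1)])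
  then have "f \<in> ideal_in S (words_below (lead_word f))"
    using ideal_in_words_upto_no_term[of S "lead_word f"] neg by metis
  then have "below f (lead_word f)" by (rule ideal_in_words_below[OF S(1)])
  moreover have "lead_word f \<in> keys f" using lookup_lead_at[OF l(1)] l(2) by (simp add: in_keys_iff)
  ultimately show False unfolding below_def using llex_less_irrefl by blast
qed

text \<open>With \<open>s = v + r\<close> and \<open>s' = v' + r'\<close> for the leading words
  \<open>v\<close> and \<open>v'\<close>, the difference equals \<open>r c s' - s c r'\<close>, and
  both products stay below \<open>v c v'\<close>.\<close>

lemma resolvable_disjoint:
  assumes S: "monic_set S" "s \<in> S" "s' \<in> S"
  shows "s * word c * word (lead_word s') - word (lead_word s) * word c * s'
    \<in> ideal_in S (words_below (lead_word s @ c @ lead_word s'))"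
proof -
  let ?r = "s - word (lead_word s)" and ?r' = "s' - word (lead_word s')"
  have r: "below ?r (lead_word s)" "below ?r' (lead_word s')"
    using S by (auto simp: monic_set_def lead_at_def)
  have "(?r * word c) * s' * word [] \<in> ideal_in S (words_below (lead_word s @ c @ lead_word s'))"
  proof (rule ideal_in_mult_left[OF S(3)])
    fix u assume "u \<in> keys (?r * word c)"
    then obtain v where "v \<in> keys ?r" "u = v @ c" using keys_mult_append[of u ?r "word c"] by auto
    then show "u @ lead_word s' @ [] \<in> words_below (lead_word s @ c @ lead_word s')"
      using r llex_less_append[of v "lead_word s" "[]" "c @ lead_word s'"] by (auto simp: below_def)
  qed
  moreover have "word [] * s * (word c * ?r') \<in> ideal_in S (words_below (lead_word s @ c @ lead_word s'))"
  proof (rule ideal_in_mult_right[OF S(2)])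
    fix u assume "u \<in> keys (word c * ?r')"
    then obtain v where "v \<in> keys ?r'" "u = c @ v" using keys_mult_append[of u "word c" ?r'] by auto
    then show "[] @ lead_word s @ u \<in> words_below (lead_word s @ c @ lead_word s')"
      using r llex_less_append[of v "lead_word s'" "lead_word s @ c" "[]"] by (auto simp: below_def)
  qed
  ultimately have "(?r * word c) * s' * word [] - word [] * s * (word c * ?r')
    \<in> ideal_in S (words_below (lead_word s @ c @ lead_word s'))" by (rule ideal_in_diff)
  moreover have "(?r * word c) * s' * word [] - word [] * s * (word c * ?r')
    = s * word c * word (lead_word s') - word (lead_word s) * word c * s'"
    by (simp add: left_diff_distrib right_diff_distrib mult.assoc del: word_mult)
  ultimately show ?thesis by simp
qed

lemma append_eq_prefixE:
  assumes "a @ x = b @ y" "length a \<le> length b"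
  obtains d where "b = a @ d" "x = d @ y"
  using assms by (auto simp: append_eq_append_conv2)

text \<open>Up to exchanging the two terms, the second occurrence starts no earlier than the first.
  It is then disjoint from it, contained in it, or overlaps its end, and disjoint occurrences always
  resolve.\<close>

lemma resolvableI:
  fixes S :: "('x::linorder, 'k::field) free_alg set"
  assumes S: "monic_set S"
    and inclusion: "\<And>s s' d e. s \<in> S \<Longrightarrow> s' \<in> S \<Longrightarrow> lead_word s = d @ lead_word s' @ e \<Longrightarrow>
      s - word d * s' * word e \<in> ideal_in S (words_below (lead_word s))"
    and overlap: "\<And>s s' d e. s \<in> S \<Longrightarrow> s' \<in> S \<Longrightarrow> lead_word s @ e = d @ lead_word s' \<Longrightarrow>
      length d < length (lead_word s) \<Longrightarrow>
      s * word e - word d * s' \<in> ideal_in S (words_below (lead_word s @ e))"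
  shows "resolvable S"
proof -
  have mult: "word a * f * word b \<in> ideal_in S (words_below (a @ w @ b))"
    if "f \<in> ideal_in S (words_below w)" for f a b w
    using that by (rule ideal_in_mult) (auto intro: llex_less_append)
  have main: "word a * s * word b - word a' * s' * word b' \<in> ideal_in S (words_below (a @ lead_word s @ b))"
    if s: "s \<in> S" "s' \<in> S" and eq: "a @ lead_word s @ b = a' @ lead_word s' @ b'" and len: "length a \<le> length a'"
    for a s b a' s' b'
  proof -
    obtain d where d: "a' = a @ d" "lead_word s @ b = d @ lead_word s' @ b'"
      using append_eq_prefixE[OF eq len] by blast
    consider c where "d = lead_word s @ c" "b = c @ lead_word s' @ b'"
      | e1 where "lead_word s = d @ e1" "e1 \<noteq> []" "e1 @ b = lead_word s' @ b'"
    proof (cases "length (lead_word s) \<le> length d")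
      case True
      then show ?thesis using append_eq_prefixE[OF d(2)] that by blast
    next
      case False
      then obtain e1 where "lead_word s = d @ e1" "lead_word s' @ b' = e1 @ b"
        using append_eq_prefixE[OF d(2)[symmetric]] by (metis nat_le_linear)
      then show ?thesis using that(2)[of e1] False by auto
    qed
    then show ?thesis
    proof cases
      case 1
      have "word a * (s * word c * word (lead_word s') - word (lead_word s) * word c * s') * word b'
        \<in> ideal_in S (words_below (a @ (lead_word s @ c @ lead_word s') @ b'))"
        by (intro mult resolvable_disjoint S s)
      then show ?thesis
        unfolding d(1) 1 word_mult[symmetric]
        by (simp add: left_diff_distrib right_diff_distrib mult.assoc del: word_mult)
    next
      case 2
      \<comment> \<open>If both occurrences start at the same place and the second is longer, then
        \<open>d = []\<close> and the pair is treated as an overlap.\<close>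
      consider e where "e1 = lead_word s' @ e" "b' = e @ b" | e where "lead_word s' = e1 @ e" "b = e @ b'"
        using append_eq_prefixE[OF 2(3)] append_eq_prefixE[OF 2(3)[symmetric]] by (metis nat_le_linear)
      then show ?thesis
      proof cases
        case i: 1
        have "word a * (s - word d * s' * word e) * word b \<in> ideal_in S (words_below (a @ lead_word s @ b))"
          by (intro mult inclusion s) (use i 2 in auto)
        then show ?thesis
          unfolding d(1) i word_mult[symmetric]
          by (simp add: left_diff_distrib right_diff_distrib mult.assoc del: word_mult)
      next
        case o: 2
        have "word a * (s * word e - word d * s') * word b' \<in> ideal_in S (words_below (a @ (lead_word s @ e) @ b'))"
          by (intro mult overlap s) (use o 2 in auto)
        then show ?thesis
          unfolding d(1) o word_mult[symmetric]
          by (simp add: left_diff_distrib right_diff_distrib mult.assoc del: word_mult)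
      qed
    qed
  qed
  show ?thesis
    unfolding resolvable_def
  proof (intro allI impI; elim conjE)
    fix a s b a' s' b'
    assume *: "s \<in> S" "s' \<in> S" "a @ lead_word s @ b = a' @ lead_word s' @ b'"
    show "word a * s * word b - word a' * s' * word b' \<in> ideal_in S (words_below (a @ lead_word s @ b))"
    proof (cases "length a \<le> length a'")
      case True
      then show ?thesis using main * by blast
    next
      case False
      then have "word a' * s' * word b' - word a * s * word b \<in> ideal_in S (words_below (a @ lead_word s @ b))"
        using main[of s' s a' b' a b] * by simp
      from ideal_in_scal[OF this, of "-1"] show ?thesis by simp
    qed
  qed
qed

lemma resolvable_single:
  assumes s: "monic_set {s}" "ls_word (lead_word s)"
  shows "resolvable {s}"
proof (rule resolvableI[OF s(1)])
  fix p q d e assume *: "p \<in> {s}" "q \<in> {s}" "lead_word p = d @ lead_word q @ e"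
  then have "length (lead_word s) = length d + length (lead_word s) + length e" by (metis length_append singletonD add.assoc)
  then have "d = []" "e = []" by auto
  then show "p - word d * q * word e \<in> ideal_in {s} (words_below (lead_word p))" using * by simp
next
  fix p q d e assume *: "p \<in> {s}" "q \<in> {s}" "lead_word p @ e = d @ lead_word q" "length d < length (lead_word p)"
  then obtain x where x: "lead_word s = d @ x" "x @ e = lead_word s"
    by (auto simp: append_eq_append_conv2)
  then have "x \<noteq> []" using * by auto
  then have "d = []" using ls_word_unbordered[OF s(2) x(1) x(2)[symmetric]] by blast
  then have "e = []" using x by auto
  then show "p * word e - word d * q \<in> ideal_in {s} (words_below (lead_word p @ e))" using * \<open>d = []\<close> by simp
qed

section \<open>Two-sided ideals and the superbracket\<close>

lemma ideal_in_hom_part: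
  assumes "\<And>s. s \<in> S \<Longrightarrow> homogeneous isodd s" "f \<in> ideal_in S UNIV"
  shows "hom_part isodd i f \<in> ideal_in S UNIV"
proof -
  have "f \<in> {f. hom_part isodd i f \<in> ideal_in S UNIV}"
    using assms(2)
  proof (rule ideal_in_induct)
    show "scal.subspace {f. hom_part isodd i f \<in> ideal_in S UNIV}"
      by (auto simp: scal.subspace_def hom_part_add hom_part_scal intro: ideal_in_add ideal_in_scal)
    fix a s b assume s: "s \<in> S"
    then obtain j where "par isodd j s" using assms(1) homogeneous_iff by blast
    then obtain k where "par isodd k (word a * s * word b)" using par_mult par_word by metis
    then have "hom_part isodd i (word a * s * word b) = (if i = k then word a * s * word b else 0)"
      by (rule hom_part_par)
    then show "word a * s * word b \<in> {f. hom_part isodd i f \<in> ideal_in S UNIV}"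
      using ideal_in_term[OF s, of a b UNIV] by auto
  qed
  then show ?thesis by simp
qed

lemma ideal_in_UNIV_mult:
  assumes "f \<in> ideal_in S UNIV"
  shows "p * f \<in> ideal_in S UNIV" "f * p \<in> ideal_in S UNIV"
proof -
  have 1: "word a * f * word b \<in> ideal_in S UNIV" for a b using assms by (rule ideal_in_mult) simp
  have "word w * f \<in> ideal_in S UNIV" "f * word w \<in> ideal_in S UNIV" for w
    using 1[of w "[]"] 1[of "[]" w] by simp_all
  then show "p * f \<in> ideal_in S UNIV" "f * p \<in> ideal_in S UNIV"
    by (induction p rule: word_induct) (auto simp: distrib_left distrib_right intro: ideal_in_add ideal_in_scal)
qed

text \<open>The superbracket is defined through homogeneous parts, so closure under products does
  not suffice: the ideal has to be graded, which it is because its generators are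
  homogeneous.\<close>

lemma sbracket_ideal_in:
  assumes S: "\<And>s. s \<in> S \<Longrightarrow> homogeneous isodd s" and f: "f \<in> ideal_in S UNIV"
  shows "sbracket isodd p f \<in> ideal_in S UNIV" "sbracket isodd f p \<in> ideal_in S UNIV"
  unfolding sbracket_def Let_def
  by (intro ideal_in_sum ideal_in_diff ideal_in_UNIV_mult ideal_in_hom_part f S; assumption)+

lemma plug_Node [simp]: "plug isodd (Node m n) s = sbracket isodd (plug isodd m s) (plug isodd n s)"
  by (simp add: plug_def)

lemma plug_Leaf [simp]: "plug isodd (Leaf None) s = s" "plug isodd (Leaf (Some x)) s = letter x"
  by (simp_all add: plug_def)

lemma plug_ideal_in:
  assumes "homogeneous isodd s"
  shows "None \<in> set (und m) \<Longrightarrow> plug isodd m s \<in> ideal_in {s} UNIV"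
proof (induction m)
  case (Leaf y)
  then show ?case using ideal_in_term[of s "{s}" "[]" "[]" UNIV] by simp
next
  case (Node m n)
  then show ?case using sbracket_ideal_in[of "{s}" isodd] assms by auto
qed

text \<open>An arrangement around \<open>s\<close> lies in the two-sided ideal of \<open>s\<close>,
  but its expansion may contain products at or above \<open>w\<close> that cancel. The
  composition-diamond lemma for \<open>{s}\<close> alone replaces it by a representation with all
  terms below \<open>w\<close>.\<close>

lemma trivial_below_ideal_in:
  fixes S :: "('x::linorder, 'k::field) free_alg set"
  assumes wf: "wfp ((<) :: 'x \<Rightarrow> 'x \<Rightarrow> bool)" and S: "monic_set S"
    and ls: "\<And>s. s \<in> S \<Longrightarrow> ls_word (lead_word s)" and hom: "\<And>s. s \<in> S \<Longrightarrow> homogeneous isodd s"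
    and f: "trivial_below isodd S w f"
  shows "f \<in> ideal_in S (words_below w)"
proof -
  obtain ts :: "('k \<times> 'x option nword \<times> ('x, 'k) free_alg) list" where
    ts: "f = (\<Sum>(\<alpha>, m, s)\<leftarrow>ts. \<alpha> \<bullet>\<^sub>K plug isodd m s)"
    "\<forall>(\<alpha>, m, s)\<in>set ts. s \<in> S \<and> (\<exists>a b. arrangement a b m) \<and>
           plug isodd m s \<noteq> 0 \<and> lead_word (plug isodd m s) \<lless> w"
    using f unfolding trivial_below_def by blast
  have *: "plug isodd m s \<in> ideal_in S (words_below w)"
    if s: "s \<in> S" and m: "arrangement a b m" and p: "plug isodd m s \<noteq> 0" "lead_word (plug isodd m s) \<lless> w" for m s a b
  proof -
    have monic: "monic_set {s}" using S s by (auto simp: monic_set_def)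
    have ideal: "plug isodd m s \<in> ideal_in {s} UNIV"
      using m hom[OF s] by (intro plug_ideal_in) (auto simp: arrangement_def)
    have "keys (plug isodd m s) \<subseteq> words_below w"
      using lead_at_keys[OF lead_at_lead_word(1)[OF p(1)]] p(2) llex_less_trans by blast
    then have "plug isodd m s \<in> ideal_in {s} (words_below w)"
      by (rule composition_diamond[OF wf monic resolvable_single[OF monic ls[OF s]] llex_closed_words_below(1) ideal])
    then show ?thesis using ideal_in_mono[of "{s}" S] s by blast
  qed
  have "(\<Sum>(\<alpha>, m, s)\<leftarrow>ts. \<alpha> \<bullet>\<^sub>K plug isodd m s) \<in> ideal_in S (words_below w)"
    using ts(2) by (induction ts) (auto intro!: ideal_in_add ideal_in_scal *)
  then show ?thesis using ts(1) by simp
qed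

section \<open>Arrangements\<close>

text \<open>Every hole is filled, so that parities can be computed by induction over subtrees with
  or without a hole.\<close>

definition subst_word :: "'x list \<Rightarrow> 'x option list \<Rightarrow> 'x list" where
  "subst_word v ys = concat (map (case_option v (\<lambda>x. [x])) ys)"

lemma subst_word_append [simp]: "subst_word v (xs @ ys) = subst_word v xs @ subst_word v ys"
  by (simp add: subst_word_def)

lemma subst_word_Some [simp]: "subst_word v (map Some xs) = xs"
  by (induction xs) (auto simp: subst_word_def)

lemma subst_word_None [simp]: "subst_word v (None # ys) = v @ subst_word v ys"
  by (simp add: subst_word_def)

lemma subst_word_arrangement: "arrangement a b m \<Longrightarrow> subst_word v (und m) = a @ v @ b"
  by (simp add: arrangement_def)

lemma par_plug:
  assumes "par isodd (odd_word isodd v) p"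
  shows "par isodd (odd_word isodd (subst_word v (und m))) (plug isodd m p)"
proof (induction m)
  case (Leaf y)
  then show ?case using assms by (cases y) (simp_all add: subst_word_def letter_def)
next
  case (Node m n)
  then show ?case using par_sbracket by fastforce
qed

lemma plug_map_Some [simp]: "plug isodd (map_nword Some n) p = ev isodd letter n"
  by (induction n) auto

lemma und_map_nword [simp]: "und (map_nword f n) = map f (und n)"
  by (induction n) auto

text \<open>A \<open>good_arrangement\<close> speaks only about the standard monomial of
  \<open>v\<close>. Here the leading term is preserved for every entry of the right parity leading
  with \<open>v\<close>, so an element of \<open>S\<close> may be put into the hole.\<close>

definition monic_arrangement ::
  "'k::field itself \<Rightarrow> ('x::linorder \<Rightarrow> bool) \<Rightarrow> 'x list \<Rightarrow> 'x list \<Rightarrow> 'x list \<Rightarrow> 'x option nword \<Rightarrow> bool" where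
  "monic_arrangement _ isodd a v b m \<longleftrightarrow> arrangement a b m \<and>
     (\<forall>(p :: ('x, 'k) free_alg) c. par isodd (odd_word isodd v) p \<and> lead_at p v c \<longrightarrow>
        lead_at (plug isodd m p) (a @ v @ b) c)"

lemma monic_arrangement_Leaf: "monic_arrangement K isodd [] v [] (Leaf None)"
  by (simp add: monic_arrangement_def arrangement_def)

lemma monic_arrangement_right:
  assumes m: "monic_arrangement TYPE('k::field) isodd a v b m" and n: "ls_monomial n"
    and less: "und n @ a @ v @ b \<lless> a @ v @ b @ und n"
  shows "monic_arrangement TYPE('k) isodd a v (b @ und n) (Node m (map_nword Some n))"
  unfolding monic_arrangement_def
proof (intro conjI allI impI; (elim conjE)?)
  show "arrangement a (b @ und n) (Node m (map_nword Some n))"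
    using m by (simp add: monic_arrangement_def arrangement_def)
  fix p :: "('a, 'k) free_alg" and c assume p: "par isodd (odd_word isodd v) p" "lead_at p v c"
  then have "lead_at (plug isodd m p) (a @ v @ b) c" using m by (auto simp: monic_arrangement_def)
  then have "lead_at (sbracket isodd (plug isodd m p) (ev isodd letter n)) ((a @ v @ b) @ und n) (c * 1)"
    by (rule lead_at_sbracket[OF par_plug[OF p(1)] par_ev_letter _ lead_at_ev_ls_monomial[OF n]]) (use less in simp)
  then show "lead_at (plug isodd (Node m (map_nword Some n)) p) (a @ v @ b @ und n) c" by simp
qed

lemma monic_arrangement_left:
  assumes m: "monic_arrangement TYPE('k::field) isodd a v b m" and n: "ls_monomial n"
    and less: "(a @ v @ b) @ und n \<lless> und n @ a @ v @ b"
  shows "monic_arrangement TYPE('k) isodd (und n @ a) v b (Node (map_nword Some n) m)"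
  unfolding monic_arrangement_def
proof (intro conjI allI impI; (elim conjE)?)
  show "arrangement (und n @ a) b (Node (map_nword Some n) m)"
    using m by (simp add: monic_arrangement_def arrangement_def)
  fix p :: "('a, 'k) free_alg" and c assume p: "par isodd (odd_word isodd v) p" "lead_at p v c"
  then have "lead_at (plug isodd m p) (a @ v @ b) c" using m by (auto simp: monic_arrangement_def)
  then have "lead_at (sbracket isodd (ev isodd letter n) (plug isodd m p)) (und n @ a @ v @ b) (1 * c)"
    by (rule lead_at_sbracket[OF par_ev_letter par_plug[OF p(1)] lead_at_ev_ls_monomial[OF n] _ less])
  then show "lead_at (plug isodd (Node (map_nword Some n) m) p) ((und n @ a) @ v @ b) c" by simp
qed

lemma mless_take: "mless u (v @ t) \<Longrightarrow> length u \<le> length v \<Longrightarrow> mless u v"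
  by (induction u v rule: mless.induct) auto

lemma ls_fact_le_last: "ls_fact fs \<Longrightarrow> g \<in> set fs \<Longrightarrow> lex_le g (last fs)"
  by (induction fs) (auto simp: ls_fact_def lex_le_def)

text \<open>The factors of \<open>b\<close> in its nondecreasing factorization are attached to
  \<open>v\<close> one by one with left-normed brackets. Each factor is at most the last one, a
  proper suffix of \<open>v @ b\<close> and hence smaller than \<open>v @ b\<close>; so attaching it
  on the right gives the larger of the two products.\<close>

lemma monic_arrangement_prefix:
  assumes u: "ls_word (v @ b)" and v: "ls_word v"
  shows "\<exists>m. monic_arrangement TYPE('k::field) isodd [] v b m"
proof -
  obtain fs where fs: "ls_fact fs" "concat fs = b" using ls_fact_exists by blast
  have "\<exists>m. monic_arrangement TYPE('k) isodd [] v (concat gs) m" if "fs = gs @ hs" for gs hs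
    using that
  proof (induction gs arbitrary: hs rule: rev_induct)
    case Nil
    then show ?case using monic_arrangement_Leaf by auto
  next
    case (snoc g gs)
    then obtain m where m: "monic_arrangement TYPE('k) isodd [] v (concat gs) m" by force
    have g: "ls_word g" using snoc.prems fs by (auto simp: ls_fact_def)
    have split: "fs = butlast fs @ [last fs]" using snoc.prems by (metis append_butlast_last_id append_is_Nil_conv list.distinct(1))
    have last: "ls_word (last fs)" using snoc.prems fs by (auto simp: ls_fact_def)
    have "mless (last fs) (v @ b)"
    proof -
      have "b = concat (butlast fs) @ last fs" using fs(2) split by (metis append_Nil2 concat.simps concat_append)
      then show ?thesis using ls_word_suffix[of "v @ concat (butlast fs)" "last fs"] u ls_word_ne[OF v] ls_word_ne[OF last] by simp
    qed
    moreover have "lex_le g (last fs)" using snoc.prems fs by (intro ls_fact_le_last) auto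
    ultimately have "mless g (v @ b)" by (rule lex_mless_trans[rotated])
    then have "mless g ((v @ concat gs @ g) @ concat hs)" using fs(2) snoc.prems by auto
    \<comment> \<open>\<open>g\<close> is no longer than the word built so far, so the deciding
      letter lies inside that word.\<close>
    then have "mless g (v @ concat gs @ g)" by (rule mless_take) simp
    then have "mless (g @ v @ concat gs) (v @ concat gs @ g)"
      using mless_append[of g "v @ concat gs @ g" "v @ concat gs" "[]"] by simp
    then have "und (std isodd g) @ [] @ v @ concat gs \<lless> [] @ v @ concat gs @ und (std isodd g)"
      by (simp add: llex_less_iff std_ls_word[OF g])
    from monic_arrangement_right[OF m std_ls_word(1)[OF g] this] show ?case
      by (auto simp: std_ls_word[OF g])
  qed
  from this[of fs "[]"] show ?thesis using fs by simp
qed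

text \<open>Suppose \<open>a\<close> is nonempty and let \<open>f\<close>, \<open>g\<close> be the
  first and last factors of \<open>v1\<close>. As \<open>und n2\<close> is the longest proper
  Lyndon--Shirshov suffix, \<open>g <= und n2\<close>, and
  \<open>und n2 <= v2 < v1 @ v2 < f <= g\<close> is a contradiction.\<close>

lemma ls_monomial_crossing:
  assumes n: "ls_monomial (Node n1 n2)" and v: "ls_word (v1 @ v2)" "v1 \<noteq> []" "v2 \<noteq> []"
    and eq: "und n1 = a @ v1" "und n2 = v2 @ b"
  shows "a = []"
proof (rule ccontr)
  assume a: "a \<noteq> []"
  obtain f r l g where fg: "ls_word f" "ls_word g" "v1 = f @ r" "v1 = l @ g" "lex_le f g"
    using ls_fact_first_last[OF v(2)] by metis
  have ls2: "ls_word (und n2)" using n by (auto intro: ls_monomial_ls_word)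
  have "lex_le g (und n2)"
  proof (rule ccontr)
    assume "\<not> ?thesis"
    then have "ls_word (g @ und n2)" using fg ls2 by (intro ls_word_append) (auto simp: not_lex_le)
    then have "length (g @ und n2) \<le> length (und n2)"
      using ls_monomial_longest_suffix[OF n, of "a @ l" "g @ und n2"] a eq fg by auto
    then show False using ls_word_ne[OF fg(2)] by simp
  qed
  moreover have "lex_le (und n2) v2" using eq by (simp add: lex_le_prefix)
  moreover have "lex_less v2 (v1 @ v2)" using ls_word_suffix[OF v] by (rule mless_lex)
  moreover have "lex_less (v1 @ v2) f" using fg(3) v(3) lex_less_prefix[of "r @ v2" f] by simp
  ultimately show False using fg(5) by (meson lex_le_less_trans lex_less_trans lex_less_le_trans lex_less_irrefl)
qed

text \<open>This is Shirshov's special bracketing. The standard brackets are kept down to the node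
  whose split cuts \<open>v\<close>. There \<open>v\<close> begins the word of the node, and the
  brackets below it are rebuilt from the left.\<close>

lemma monic_arrangement_ls_monomial:
  assumes v: "ls_word v"
  shows "ls_monomial n \<Longrightarrow> und n = a @ v @ b \<Longrightarrow> \<exists>m. monic_arrangement TYPE('k::field) isodd a v b m"
proof (induction n arbitrary: a b)
  case (Leaf x)
  then have "a = []" "b = []" using ls_word_ne[OF v] by (cases a; auto simp: append_eq_Cons_conv Cons_eq_append_conv)+
  then show ?case using monic_arrangement_Leaf by auto
next
  case (Node n1 n2)
  have mon: "ls_monomial n1" "ls_monomial n2" using Node.prems by auto
  have swap: "und n2 @ und n1 \<lless> und n1 @ und n2"
    using Node.prems by (intro ls_swap_less) (auto intro: ls_monomial_ls_word)
  have eq: "und n1 @ und n2 = a @ v @ b" using Node.prems by simp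
  show ?case
  proof (cases "length (und n1) \<le> length a")
    case True
    then obtain a' where a': "a = und n1 @ a'" "und n2 = a' @ v @ b" using append_eq_prefixE[OF eq] by blast
    obtain m where "monic_arrangement TYPE('k) isodd a' v b m" using Node.IH(2)[OF mon(2) a'(2)] by blast
    then have "monic_arrangement TYPE('k) isodd (und n1 @ a') v b (Node (map_nword Some n1) m)"
      by (rule monic_arrangement_left[OF _ mon(1)]) (use swap a' in simp)
    then show ?thesis using a' by blast
  next
    case False
    then obtain v1 where v1: "und n1 = a @ v1" "v @ b = v1 @ und n2" "v1 \<noteq> []"
      using append_eq_prefixE[OF eq[symmetric]] by (metis append_Nil2 nat_le_linear order_refl)
    show ?thesis
    proof (cases "length v \<le> length v1")
      case True
      then obtain b' where b': "v1 = v @ b'" "b = b' @ und n2" using append_eq_prefixE[OF v1(2)] by blast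
      obtain m where "monic_arrangement TYPE('k) isodd a v b' m" using Node.IH(1)[OF mon(1), of a b'] v1 b' by auto
      then have "monic_arrangement TYPE('k) isodd a v (b' @ und n2) (Node m (map_nword Some n2))"
        by (rule monic_arrangement_right[OF _ mon(2)]) (use swap v1 b' in simp)
      then show ?thesis using b' by blast
    next
      case False
      then obtain v2 where v2: "v = v1 @ v2" "und n2 = v2 @ b"
        using append_eq_prefixE[OF v1(2)[symmetric]] by (metis nat_le_linear)
      then have "v2 \<noteq> []" using False by auto
      then have "a = []" using ls_monomial_crossing[OF Node.prems(1), of v1 v2 a b] v v1 v2 by auto
      then show ?thesis
        using monic_arrangement_prefix[OF _ v, of b] ls_monomial_ls_word[OF Node.prems(1)] Node.prems(2) by auto
    qed
  qed
qed

lemma monic_arrangement_exists: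
  "ls_word v \<Longrightarrow> ls_word (a @ v @ b) \<Longrightarrow> \<exists>m. monic_arrangement TYPE('k::field) isodd a v b m"
  using monic_arrangement_ls_monomial[of v "std isodd (a @ v @ b)" a b isodd] std_ls_word[of "a @ v @ b" isodd] by blast

lemma monic_arrangement_good:
  assumes m: "monic_arrangement TYPE('k::field) isodd a v b m" and v: "ls_word v"
  shows "good_arrangement TYPE('k) isodd a v b m"
proof -
  have "lead_at (plug_std isodd m v :: ('a, 'k) free_alg) (a @ v @ b) 1"
    using m par_std[OF v, of isodd] lead_at_std[OF v, of isodd] unfolding monic_arrangement_def plug_std_def by blast
  from lead_at_lead[OF this] show ?thesis
    using m by (simp add: good_arrangement_def monic_arrangement_def Let_def)
qed

text \<open>Arrangements are only available on Lyndon--Shirshov words, so the word of an overlap has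
  to be one. A suffix starting inside \<open>d\<close> extends a smaller suffix of
  \<open>d @ x\<close>; any later suffix is at most \<open>x @ e\<close>, which a letter of
  \<open>x\<close> puts below the whole word.\<close>

lemma ls_word_overlap:
  assumes "ls_word (d @ x)" "ls_word (x @ e)" "x \<noteq> []"
  shows "ls_word (d @ x @ e)"
proof (cases "d = []")
  case False
  have xw: "mless (x @ e) (d @ x @ e)"
    using mless_append[OF ls_word_suffix[OF assms(1) False assms(3)], of e e] by simp
  show ?thesis
  proof (rule ls_wordI)
    fix u t assume *: "d @ x @ e = u @ t" "u \<noteq> []" "t \<noteq> []"
    show "mless t (d @ x @ e)"
    proof (cases "length d \<le> length u")
      case True
      then obtain y where y: "x @ e = y @ t" using append_eq_prefixE[OF *(1)] by metis
      then have "lex_le t (x @ e)" using ls_word_suffix_le[of y t] assms * by simp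
      then show ?thesis using xw by (rule lex_mless_trans)
    next
      case False
      then obtain d' where d': "d = u @ d'" "t = d' @ x @ e"
        using append_eq_prefixE[OF *(1)[symmetric]] by (metis nat_le_linear)
      then have "mless (d' @ x) (d @ x)" using ls_word_suffix[of u "d' @ x"] assms * by simp
      from mless_append[OF this, of e e] show ?thesis using d' by simp
    qed
  qed (use assms in simp)
qed (use assms in simp)

section \<open>Expansion of an arrangement\<close>

text \<open>The pairs and coefficients do not depend on \<open>p\<close>, so the expansions of two
  entries can be compared term by term. The parity of \<open>p\<close> is fixed because it
  determines the signs.\<close>

definition bimodule_map :: "('x \<Rightarrow> bool) \<Rightarrow> bool \<Rightarrow> nat \<Rightarrow> (('x, 'k::field) free_alg \<Rightarrow> ('x, 'k) free_alg) \<Rightarrow> bool" where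
  "bimodule_map isodd i n F \<longleftrightarrow> (\<exists>J \<gamma>. finite J \<and> (\<forall>z\<in>J. length (fst z) + length (snd z) = n) \<and>
     (\<forall>p. par isodd i p \<longrightarrow> F p = (\<Sum>z\<in>J. \<gamma> z \<bullet>\<^sub>K (word (fst z) * p * word (snd z)))))"

lemma bimodule_map_cong:
  "bimodule_map isodd i n F \<Longrightarrow> (\<And>p. par isodd i p \<Longrightarrow> F p = G p) \<Longrightarrow> bimodule_map isodd i n G"
  unfolding bimodule_map_def by simp

lemma bimodule_map_id: "bimodule_map isodd i 0 (\<lambda>p. p)"
  unfolding bimodule_map_def by (rule exI[of _ "{([], [])}"], rule exI[of _ "\<lambda>_. 1"]) simp

lemma bimodule_map_0: "bimodule_map isodd i n (\<lambda>p. 0)"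
  unfolding bimodule_map_def by (rule exI[of _ "{}"]) simp

lemma bimodule_map_scal:
  assumes "bimodule_map isodd i n F"
  shows "bimodule_map isodd i n (\<lambda>p. c \<bullet>\<^sub>K F p)"
proof -
  obtain J \<gamma> where J: "finite J" "\<forall>z\<in>J. length (fst z) + length (snd z) = n"
    "\<And>p. par isodd i p \<Longrightarrow> F p = (\<Sum>z\<in>J. \<gamma> z \<bullet>\<^sub>K (word (fst z) * p * word (snd z)))"
    using assms unfolding bimodule_map_def by blast
  show ?thesis unfolding bimodule_map_def
    by (rule exI[of _ J], rule exI[of _ "\<lambda>z. c * \<gamma> z"]) (simp add: J scal.scale_sum_right)
qed

lemma bimodule_map_add:
  assumes "bimodule_map isodd i n F" "bimodule_map isodd i n G"
  shows "bimodule_map isodd i n (\<lambda>p. F p + G p)"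
proof -
  obtain J \<gamma> where J: "finite J" "\<forall>z\<in>J. length (fst z) + length (snd z) = n"
    "\<And>p. par isodd i p \<Longrightarrow> F p = (\<Sum>z\<in>J. \<gamma> z \<bullet>\<^sub>K (word (fst z) * p * word (snd z)))"
    using assms(1) unfolding bimodule_map_def by blast
  obtain J' \<gamma>' where J': "finite J'" "\<forall>z\<in>J'. length (fst z) + length (snd z) = n"
    "\<And>p. par isodd i p \<Longrightarrow> G p = (\<Sum>z\<in>J'. \<gamma>' z \<bullet>\<^sub>K (word (fst z) * p * word (snd z)))"
    using assms(2) unfolding bimodule_map_def by blast
  define \<delta> where "\<delta> = (\<lambda>z. (if z \<in> J then \<gamma> z else 0) + (if z \<in> J' then \<gamma>' z else 0))"
  have "F p + G p = (\<Sum>z\<in>J \<union> J'. \<delta> z \<bullet>\<^sub>K (word (fst z) * p * word (snd z)))" if p: "par isodd i p" for p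
  proof -
    have "F p = (\<Sum>z\<in>J \<union> J'. (if z \<in> J then \<gamma> z else 0) \<bullet>\<^sub>K (word (fst z) * p * word (snd z)))"
      unfolding J(3)[OF p] using J(1) J'(1) by (intro sum.mono_neutral_cong_left) auto
    moreover have "G p = (\<Sum>z\<in>J \<union> J'. (if z \<in> J' then \<gamma>' z else 0) \<bullet>\<^sub>K (word (fst z) * p * word (snd z)))"
      unfolding J'(3)[OF p] using J(1) J'(1) by (intro sum.mono_neutral_cong_left) auto
    ultimately show ?thesis by (simp add: \<delta>_def scal.scale_left_distrib sum.distrib)
  qed
  then show ?thesis unfolding bimodule_map_def using J J'
    by (intro exI[of _ "J \<union> J'"] exI[of _ \<delta>]) auto
qed

lemma bimodule_map_word:
  assumes "bimodule_map isodd i n F"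
  shows "bimodule_map isodd i (n + length w) (\<lambda>p. word w * F p)"
    "bimodule_map isodd i (n + length w) (\<lambda>p. F p * word w)"
proof -
  obtain J \<gamma> where J: "finite J" "\<forall>z\<in>J. length (fst z) + length (snd z) = n"
    "\<And>p. par isodd i p \<Longrightarrow> F p = (\<Sum>z\<in>J. \<gamma> z \<bullet>\<^sub>K (word (fst z) * p * word (snd z)))"
    using assms unfolding bimodule_map_def by blast
  \<comment> \<open>\<open>drop\<close>, and \<open>take\<close> in the mirrored case, undo the
    shift of the index pairs, so that each new pair recovers its old coefficient.\<close>
  have L: "word w * F p = (\<Sum>z\<in>(\<lambda>z. (w @ fst z, snd z)) ` J. \<gamma> (drop (length w) (fst z), snd z) \<bullet>\<^sub>K (word (fst z) * p * word (snd z)))"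
    if p: "par isodd i p" for p
    by (subst sum.reindex)
      (auto simp: J(3)[OF p] inj_on_def prod_eq_iff sum_distrib_left word_mult[symmetric] mult.assoc simp del: word_mult)
  have R: "F p * word w = (\<Sum>z\<in>(\<lambda>z. (fst z, snd z @ w)) ` J. \<gamma> (fst z, take (length (snd z) - length w) (snd z)) \<bullet>\<^sub>K (word (fst z) * p * word (snd z)))"
    if p: "par isodd i p" for p
    by (subst sum.reindex)
      (auto simp: J(3)[OF p] inj_on_def prod_eq_iff sum_distrib_right word_mult[symmetric] mult.assoc simp del: word_mult)
  show "bimodule_map isodd i (n + length w) (\<lambda>p. word w * F p)"
    unfolding bimodule_map_def
    by (rule exI[of _ "(\<lambda>z. (w @ fst z, snd z)) ` J"], rule exI[of _ "\<lambda>z. \<gamma> (drop (length w) (fst z), snd z)"])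
      (use J(1,2) L in auto)
  show "bimodule_map isodd i (n + length w) (\<lambda>p. F p * word w)"
    unfolding bimodule_map_def
    by (rule exI[of _ "(\<lambda>z. (fst z, snd z @ w)) ` J"], rule exI[of _ "\<lambda>z. \<gamma> (fst z, take (length (snd z) - length w) (snd z))"])
      (use J(1,2) R in auto)
qed

lemma bimodule_map_sum:
  "finite A \<Longrightarrow> (\<And>a. a \<in> A \<Longrightarrow> bimodule_map isodd i n (F a)) \<Longrightarrow> bimodule_map isodd i n (\<lambda>p. \<Sum>a\<in>A. F a p)"
  by (induction A rule: finite_induct) (auto intro: bimodule_map_0 bimodule_map_add)

lemma bimodule_map_mult:
  assumes F: "bimodule_map isodd i n F" and r: "\<And>w. w \<in> keys r \<Longrightarrow> length w = k"
  shows "bimodule_map isodd i (n + k) (\<lambda>p. r * F p)" "bimodule_map isodd i (n + k) (\<lambda>p. F p * r)"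
proof -
  have 1: "r * F p = (\<Sum>w\<in>keys r. lookup r w \<bullet>\<^sub>K (word w * F p))" for p
    by (subst poly_mapping_sum_words) (simp add: sum_distrib_right)
  have "bimodule_map isodd i (n + k) (\<lambda>p. word w * F p)" if "w \<in> keys r" for w
    using bimodule_map_word(1)[OF F, of w] r[OF that] by simp
  then show "bimodule_map isodd i (n + k) (\<lambda>p. r * F p)"
    unfolding 1 by (intro bimodule_map_sum bimodule_map_scal) auto
  have 2: "F p * r = (\<Sum>w\<in>keys r. lookup r w \<bullet>\<^sub>K (F p * word w))" for p
    by (subst poly_mapping_sum_words) (simp add: sum_distrib_left)
  have "bimodule_map isodd i (n + k) (\<lambda>p. F p * word w)" if "w \<in> keys r" for w
    using bimodule_map_word(2)[OF F, of w] r[OF that] by simp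
  then show "bimodule_map isodd i (n + k) (\<lambda>p. F p * r)"
    unfolding 2 by (intro bimodule_map_sum bimodule_map_scal) auto
qed

lemma keys_ev_letter: "w \<in> keys (ev isodd letter m :: ('x, 'k::field) free_alg) \<Longrightarrow> length w = length (und m)"
proof (induction m arbitrary: w)
  case (Leaf x)
  then show ?case by (simp add: letter_def)
next
  case (Node m n)
  have "w \<in> keys (ev isodd letter m * ev isodd letter n :: ('x, 'k) free_alg) \<or>
    w \<in> keys (ev isodd letter n * ev isodd letter m :: ('x, 'k) free_alg)"
    using Node.prems keys_scal
    by (auto simp: sbracket_par[OF par_ev_letter par_ev_letter] dest!: subsetD[OF keys_diff] subsetD[OF keys_scal])
  then show ?case using Node.IH by (fastforce dest!: keys_mult_append)
qed

lemma nword_no_None: "None \<notin> set (und m) \<Longrightarrow> \<exists>n. m = map_nword Some n"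
proof (induction m)
  case (Leaf y)
  then show ?case by (cases y) (auto intro: exI[of _ "Leaf _"])
next
  case (Node m n)
  then obtain m' n' where "m = map_nword Some m'" "n = map_nword Some n'" by auto
  then show ?case by (intro exI[of _ "Node m' n'"]) simp
qed

lemma bimodule_map_plug:
  "length (filter (\<lambda>y. y = None) (und m)) = 1 \<Longrightarrow>
    bimodule_map isodd (odd_word isodd v) (length (und m) - 1) (plug isodd m :: ('x, 'k::field) free_alg \<Rightarrow> _)"
proof (induction m)
  case (Leaf y)
  then show ?case using bimodule_map_id by (cases y) (auto intro: bimodule_map_cong)
next
  case (Node m n)
  have len: "length (und k) \<ge> 1" for k :: "'x option nword" using und_ne[of k] by (cases "und k") auto
  have none: "filter (\<lambda>y. y = None) ys = [] \<longleftrightarrow> None \<notin> set ys" for ys :: "'x option list"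
    by (induction ys) auto
  from Node.prems consider "length (filter (\<lambda>y. y = None) (und m)) = 1" "filter (\<lambda>y. y = None) (und n) = []"
    | "length (filter (\<lambda>y. y = None) (und n)) = 1" "filter (\<lambda>y. y = None) (und m) = []"
    by (auto simp: add_is_1)
  then show ?case
  proof cases
    case 1
    then obtain r where n: "n = map_nword Some r" using none nword_no_None by blast
    let ?r = "ev isodd letter r :: ('x, 'k) free_alg" and ?F = "plug isodd m :: ('x, 'k) free_alg \<Rightarrow> ('x, 'k) free_alg"
    have F: "bimodule_map isodd (odd_word isodd v) (length (und m) - 1) ?F" by (rule Node.IH(1)[OF 1(1)])
    have "bimodule_map isodd (odd_word isodd v) (length (und m) - 1 + length (und r))
      (\<lambda>p. ?F p * ?r + (- koszul_sign (odd_word isodd (subst_word v (und m))) (odd_word isodd (und r))) \<bullet>\<^sub>K (?r * ?F p))"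
      by (intro bimodule_map_add bimodule_map_scal bimodule_map_mult F keys_ev_letter)
    then have "bimodule_map isodd (odd_word isodd v) (length (und m) - 1 + length (und r)) (plug isodd (Node m n) :: ('x, 'k) free_alg \<Rightarrow> _)"
      by (rule bimodule_map_cong) (simp add: n sbracket_par[OF par_plug par_ev_letter])
    moreover have "length (und m) - 1 + length (und r) = length (und (Node m n)) - 1" using len[of m] n by simp
    ultimately show ?thesis by (simp only:)
  next
    case 2
    then obtain r where m: "m = map_nword Some r" using none nword_no_None by blast
    let ?r = "ev isodd letter r :: ('x, 'k) free_alg" and ?F = "plug isodd n :: ('x, 'k) free_alg \<Rightarrow> ('x, 'k) free_alg"
    have F: "bimodule_map isodd (odd_word isodd v) (length (und n) - 1) ?F" by (rule Node.IH(2)[OF 2(1)])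
    have "bimodule_map isodd (odd_word isodd v) (length (und n) - 1 + length (und r))
      (\<lambda>p. ?r * ?F p + (- koszul_sign (odd_word isodd (und r)) (odd_word isodd (subst_word v (und n)))) \<bullet>\<^sub>K (?F p * ?r))"
      by (intro bimodule_map_add bimodule_map_scal bimodule_map_mult F keys_ev_letter)
    then have "bimodule_map isodd (odd_word isodd v) (length (und n) - 1 + length (und r)) (plug isodd (Node m n) :: ('x, 'k) free_alg \<Rightarrow> _)"
      by (rule bimodule_map_cong) (simp add: m sbracket_par[OF par_ev_letter par_plug])
    moreover have "length (und n) - 1 + length (und r) = length (und (Node m n)) - 1" using len[of n] m by simp
    ultimately show ?thesis by (simp only:)
  qed
qed

text \<open>Two occurrences that both start within the first \<open>length v\<close> letters
  overlap, and if they were different their common part would be a border of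
  \<open>v\<close>.\<close>

lemma ls_word_occurrences:
  assumes v: "ls_word v" and eq: "x @ v @ y = x' @ v @ y'" and len: "length x < length v" "length x' < length v"
  shows "x = x'"
proof -
  have *: "x = x'" if eq: "x @ v @ y = x' @ v @ y'" and le: "length x \<le> length x'" and lt: "length x' < length v" for x x' y y'
  proof -
    obtain d where d: "x' = x @ d" "v @ y = d @ v @ y'" using append_eq_prefixE[OF eq le] by blast
    obtain s where s: "v = d @ s" "v @ y' = s @ y" using append_eq_prefixE[OF d(2)[symmetric]] lt d(1) by auto
    obtain t where "v = s @ t" using append_eq_prefixE[OF s(2)[symmetric]] s(1) by auto
    moreover have "s \<noteq> []" using s(1) d(1) lt by auto
    ultimately have "d = []" using ls_word_unbordered[OF v s(1)] by blast
    then show ?thesis using d by simp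
  qed
  show ?thesis using *[OF eq] *[OF eq[symmetric]] len by (metis nat_le_linear)
qed

text \<open>If the letters around the distinguished entry are fewer than the letters of the unbordered word \<open>v\<close>,
  then no word contains two of the occurrences of \<open>v\<close>, so no cancellation takes place and the leading word
  does not depend on the lower terms of the entry.\<close>

lemma lead_at_plug_transfer:
  fixes p q :: "('x::linorder, 'k::field) free_alg"
  assumes v: "ls_word v" and m: "arrangement a b m" and short: "length a + length b < length v"
    and p: "par isodd (odd_word isodd v) p" "lead_at p v 1"
    and q: "par isodd (odd_word isodd v) q" "lead_at q v 1"
    and lead: "lead_at (plug isodd m p) w c" "c \<noteq> 0"
  shows "lead_at (plug isodd m q) w c"
proof -
  have "length (filter (\<lambda>y. y = None) (und m)) = 1" "length (und m) - 1 = length a + length b"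
    using m by (auto simp: arrangement_def filter_map comp_def)
  then have "bimodule_map isodd (odd_word isodd v) (length a + length b) (plug isodd m :: ('x, 'k) free_alg \<Rightarrow> _)"
    using bimodule_map_plug[of m isodd v] by simp
  then obtain J \<gamma> where J: "finite J" "\<And>z. z \<in> J \<Longrightarrow> length (fst z) + length (snd z) = length a + length b"
    and sum: "\<And>p :: ('x, 'k) free_alg. par isodd (odd_word isodd v) p \<Longrightarrow>
      plug isodd m p = (\<Sum>z\<in>J. \<gamma> z \<bullet>\<^sub>K (word (fst z) * p * word (snd z)))"
    unfolding bimodule_map_def by blast
  define K where "K = {z\<in>J. \<gamma> z \<noteq> 0}"
  define k where "k = (\<lambda>z :: 'x list \<times> 'x list. fst z @ v @ snd z)"
  have K: "finite K" using J(1) by (simp add: K_def)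
  have sumK: "plug isodd m p = (\<Sum>z\<in>K. \<gamma> z \<bullet>\<^sub>K (word (fst z) * p * word (snd z)))"
    if "par isodd (odd_word isodd v) p" for p :: "('x, 'k) free_alg"
    unfolding sum[OF that] K_def using J(1) by (intro sum.mono_neutral_right) auto
  have "K \<noteq> {}" using sumK[OF p(1)] lead_at_lead(3)[OF lead] by auto
  then obtain z where z: "z \<in> K" "\<And>z'. z' \<in> K \<Longrightarrow> k z' \<lless> k z \<or> k z' = k z"
    using llex_max_exists[of "k ` K"] K by auto
  have inj: "z' = z" if "z' \<in> K" "k z' = k z" for z'
  proof -
    have "length (fst z') < length v" "length (fst z) < length v"
      using J(2)[of z'] J(2)[of z] that z short by (auto simp: K_def)
    then have "fst z' = fst z" using that(2) ls_word_occurrences[OF v, of "fst z'" "snd z'" "fst z" "snd z"] by (simp add: k_def)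
    then show ?thesis using that(2) by (simp add: k_def prod_eq_iff)
  qed
  have all: "lead_at (plug isodd m p) (k z) (\<gamma> z * 1)"
    if p: "par isodd (odd_word isodd v) p" "lead_at p v 1" for p :: "('x, 'k) free_alg"
    unfolding sumK[OF p(1)]
  proof (rule lead_at_sum_index[OF K z(1), where d = "\<lambda>_. 1"])
    show "k z' \<lless> k z" if "z' \<in> K" "z' \<noteq> z" for z' using z(2)[OF that(1)] inj[OF that(1)] that(2) by blast
    show "lead_at (word (fst z') * p * word (snd z')) (k z') 1" for z'
      using lead_at_mult[OF lead_at_mult[OF lead_at_word p(2)] lead_at_word, of "fst z'" "snd z'"] by (simp add: k_def)
  qed
  have "\<gamma> z \<noteq> 0" using z by (simp add: K_def)
  then show ?thesis using all[OF p] all[OF q] lead_at_lead(1,2)[OF lead] lead_at_lead(1,2)[OF all[OF p]] by simp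
qed

section \<open>Compositions\<close>

lemma field_two_neq_0:
  assumes "CHAR('k::field) \<noteq> 2"
  shows "(2 :: 'k) \<noteq> 0"
proof
  assume "(2 :: 'k) = 0"
  then have "CHAR('k) dvd 2" using of_nat_eq_0_iff_char_dvd[of 2, where 'a = 'k] by simp
  then have "CHAR('k) \<le> 2" "CHAR('k) \<noteq> 0" using dvd_imp_le[of "CHAR('k)" 2] by (auto intro: Nat.gr0I)
  then have "CHAR('k) = 1" using assms by linarith
  then show False using of_nat_eq_0_iff_char_dvd[of 1, where 'a = 'k] by simp
qed

lemma gs_basis_monic_set:
  assumes "gs_basis isodd arr S I"
  shows "monic_set S"
  unfolding monic_set_def
proof
  fix s assume "s \<in> S"
  then have "s \<noteq> 0" "lead_cf s = 1" using assms by (auto simp: gs_basis_def monic_poly_def)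
  then show "lead_at s (lead_word s) 1" using lead_at_lead_word(1)[of s] by simp
qed

lemma par_homogeneous:
  "homogeneous isodd s \<Longrightarrow> lead_at s v 1 \<Longrightarrow> par isodd (odd_word isodd v) s"
  using par_lead_at unfolding homogeneous_iff by fastforce

lemma trivial_below_below:
  fixes f :: "('x::linorder, 'k::field) free_alg"
  assumes "trivial_below isodd S w f"
  shows "below f w"
proof -
  obtain ts :: "('k \<times> 'x option nword \<times> ('x, 'k) free_alg) list" where
    ts: "f = (\<Sum>(\<alpha>, m, s)\<leftarrow>ts. \<alpha> \<bullet>\<^sub>K plug isodd m s)"
    "\<forall>(\<alpha>, m, s)\<in>set ts. s \<in> S \<and> (\<exists>a b. arrangement a b m) \<and>
           plug isodd m s \<noteq> 0 \<and> lead_word (plug isodd m s) \<lless> w"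
    using assms unfolding trivial_below_def by blast
  have *: "below (plug isodd m s) w" if "plug isodd m s \<noteq> 0" "lead_word (plug isodd m s) \<lless> w"
    for m and s :: "('x, 'k) free_alg"
    using lead_at_lower[OF lead_at_lead_word(1)[OF that(1)] that(2)] by (simp add: lead_at_0_iff)
  have "below (\<Sum>(\<alpha>, m, s)\<leftarrow>ts. \<alpha> \<bullet>\<^sub>K plug isodd m s) w"
    using ts(2) by (induction ts) (auto intro!: below_add below_scal *)
  then show ?thesis using ts(1) by simp
qed

text \<open>The composition of \<open>s\<close> with itself at \<open>w = uu\<close> is \<open>s - s/2\<close>, as the leading coefficient
  of \<open>[uu]\<close> is 2, and \<open>s/2\<close> is not a combination of elements with smaller leading words.\<close>

lemma gs_basis_ls_word:
  fixes S :: "('x::linorder, 'k::field) free_alg set"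
  assumes two: "(2 :: 'k) \<noteq> 0" and arr: "arrangement_choice TYPE('k) isodd arr"
    and gs: "gs_basis isodd arr S I" and s: "s \<in> S"
  shows "ls_word (lead_word s)"
proof -
  have lie: "s \<in> free_lie_set isodd" "s \<noteq> 0" using gs s by (auto simp: gs_basis_def monic_poly_def)
  have lead: "lead_at s (lead_word s) 1" using gs_basis_monic_set[OF gs] s by (simp add: monic_set_def)
  have sls: "sls_word isodd (lead_word s)" using sls_word_lead_word[OF two lie] .
  then show ?thesis
  proof (cases rule: sls_wordE)
    case (2 u)
    let ?v = "lead_word s"
    have std: "lead_at (plug_std isodd (Leaf None) ?v :: ('x, 'k) free_alg) ?v 2"
      using lead_at_std_square[OF 2(1,2)] 2(3) by (simp add: plug_std_def)
    \<comment> \<open>The bare hole witnesses that a good arrangement exists, which binds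
      \<open>arr\<close>. With nothing around the hole, \<open>arr\<close> can only have chosen the
      bare hole itself.\<close>
    have "good_arrangement TYPE('k) isodd [] ?v [] (Leaf None)"
      using lead_at_lead[OF std two] by (simp add: good_arrangement_def arrangement_def Let_def)
    then have "good_arrangement TYPE('k) isodd [] ?v [] (arr [] ?v [])"
      using arr[unfolded arrangement_choice_def, rule_format, of ?v "[]" "[]"] sls by auto
    then have "und (arr [] ?v []) = [None]" by (simp add: good_arrangement_def arrangement_def)
    then have "arr [] ?v [] = Leaf None"
      by (cases "arr [] ?v []") (auto simp: append_eq_Cons_conv)
    then have sub: "sub_elem isodd arr [] s [] = (1 / 2) \<bullet>\<^sub>K s"
      using lead_at_lead(2)[OF std two] by (simp add: sub_elem_def Let_def)
    have "lie_composition isodd arr s s ?v (s - sub_elem isodd arr [] s [])"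
      by (rule lie_composition.inclusion) auto
    then have "trivial_below isodd S ?v (s - sub_elem isodd arr [] s [])"
      using gs s by (auto simp: gs_basis_def closed_under_composition_def)
    then have low: "lead_at (s - (1 / 2) \<bullet>\<^sub>K s) ?v 0"
      using trivial_below_below by (simp add: sub lead_at_0_iff)
    have "lead_at (s - (1 / 2) \<bullet>\<^sub>K s) ?v (1 - 1 / 2 * 1)"
      by (intro lead_at_diff lead_at_scal lead)
    from lookup_lead_at[OF this] have "1 - 1 / 2 * 1 = (0 :: 'k)" using lookup_lead_at[OF low] by simp
    then show ?thesis using two by (simp add: field_simps)
  qed
qed

text \<open>The leading term after substituting \<open>s\<close> is derived for short surroundings
  and assumed in the second claim, where it may come from elsewhere. Given it, subtracting
  \<open>asb\<close> cancels the leading term inside the two-sided ideal of \<open>s\<close>, and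
  the composition-diamond lemma for \<open>{s}\<close> lowers the representation.\<close>

lemma sub_elem_props:
  fixes s :: "('x::linorder, 'k::field) free_alg"
  assumes wf: "wfp ((<) :: 'x \<Rightarrow> 'x \<Rightarrow> bool)" and two: "(2 :: 'k) \<noteq> 0"
    and arr: "arrangement_choice TYPE('k) isodd arr"
    and s: "monic_set {s}" "homogeneous isodd s" "ls_word (lead_word s)"
    and w: "ls_word (a @ lead_word s @ b)"
  shows "length a + length b < length (lead_word s) \<Longrightarrow>
      lead_at (sub_elem isodd arr a s b) (a @ lead_word s @ b) 1"
    and "lead_at (sub_elem isodd arr a s b) (a @ lead_word s @ b) 1 \<Longrightarrow>
      sub_elem isodd arr a s b - word a * s * word b \<in> ideal_in {s} (words_below (a @ lead_word s @ b))"
proof -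
  let ?v = "lead_word s"
  define m where "m = arr a ?v b"
  \<comment> \<open>\<open>arrangement_choice\<close> constrains \<open>arr\<close> only where some
    good arrangement exists; a monic arrangement is such a witness.\<close>
  obtain m' where "monic_arrangement TYPE('k) isodd a ?v b m'" using monic_arrangement_exists[OF s(3) w] by blast
  then have "good_arrangement TYPE('k) isodd a ?v b m'" using s(3) by (rule monic_arrangement_good)
  then have good: "good_arrangement TYPE('k) isodd a ?v b m"
    using arr s(3) w unfolding arrangement_choice_def m_def sls_word_def by blast
  define \<alpha> where "\<alpha> = lead_cf (plug_std isodd m ?v :: ('x, 'k) free_alg)"
  have p: "(plug_std isodd m ?v :: ('x, 'k) free_alg) \<noteq> 0"
    "lead_word (plug_std isodd m ?v :: ('x, 'k) free_alg) = a @ ?v @ b" "\<alpha> \<in> {1, 2}" "arrangement a b m"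
    using good by (auto simp: good_arrangement_def Let_def \<alpha>_def)
  have \<alpha>: "\<alpha> \<noteq> 0" using p(3) two by auto
  have lead: "lead_at (plug_std isodd m ?v :: ('x, 'k) free_alg) (a @ ?v @ b) \<alpha>"
    using lead_at_lead_word(1)[OF p(1)] p(2) by (simp add: \<alpha>_def)
  have sub: "sub_elem isodd arr a s b = (1 / \<alpha>) \<bullet>\<^sub>K plug isodd m s"
    by (simp add: sub_elem_def m_def \<alpha>_def Let_def)
  have ls: "lead_at s ?v 1" using s(1) by (simp add: monic_set_def)
  show "lead_at (sub_elem isodd arr a s b) (a @ ?v @ b) 1" if "length a + length b < length ?v"
  proof -
    have "lead_at (plug isodd m s) (a @ ?v @ b) \<alpha>"
      using lead_at_plug_transfer[OF s(3) p(4) that par_std[OF s(3)] lead_at_std[OF s(3)] par_homogeneous[OF s(2) ls] ls] lead \<alpha>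
      unfolding plug_std_def by blast
    from lead_at_scal[OF this, of "1 / \<alpha>"] show ?thesis using \<alpha> by (simp add: sub)
  qed
  assume one: "lead_at (sub_elem isodd arr a s b) (a @ ?v @ b) 1"
  have "sub_elem isodd arr a s b - word a * s * word b \<in> ideal_in {s} UNIV"
    unfolding sub using p(4) s(2)
    by (intro ideal_in_diff ideal_in_scal plug_ideal_in ideal_in_term) (auto simp: arrangement_def)
  moreover have "lead_at (sub_elem isodd arr a s b - word a * s * word b) (a @ ?v @ b) (1 - 1)"
    by (intro lead_at_diff one lead_at_term[OF s(1)]) simp
  then have "keys (sub_elem isodd arr a s b - word a * s * word b) \<subseteq> words_below (a @ ?v @ b)"
    by (auto simp: lead_at_0_iff below_def)
  ultimately show "sub_elem isodd arr a s b - word a * s * word b \<in> ideal_in {s} (words_below (a @ ?v @ b))"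
    by (rule composition_diamond[OF wf s(1) resolvable_single[OF s(1,3)] llex_closed_words_below(1)])
qed

lemma gs_basis_resolvable:
  fixes S :: "('x::linorder, 'k::field) free_alg set"
  assumes wf: "wfp ((<) :: 'x \<Rightarrow> 'x \<Rightarrow> bool)" and two: "(2 :: 'k) \<noteq> 0"
    and arr: "arrangement_choice TYPE('k) isodd arr" and gs: "gs_basis isodd arr S I"
  shows "resolvable S"
proof -
  have monic: "monic_set S" using gs by (rule gs_basis_monic_set)
  have monic1: "monic_set {s}" if "s \<in> S" for s using monic that by (simp add: monic_set_def)
  have lead: "lead_at s (lead_word s) 1" if "s \<in> S" for s using monic that by (simp add: monic_set_def)
  have ls: "ls_word (lead_word s)" if "s \<in> S" for s using gs_basis_ls_word[OF two arr gs that] .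
  have hom: "homogeneous isodd s" if "s \<in> S" for s using gs that by (simp add: gs_basis_def)
  have trivial: "f \<in> ideal_in S (words_below w)" if "lie_composition isodd arr p q w f" "p \<in> S" "q \<in> S" for p q w f
    using trivial_below_ideal_in[OF wf monic ls hom] that gs
    unfolding gs_basis_def closed_under_composition_def by blast
  note sub_lead = sub_elem_props(1)[OF wf two arr monic1 hom ls]
  have sub: "sub_elem isodd arr a s b - word a * s * word b \<in> ideal_in S (words_below (a @ lead_word s @ b))"
    if "s \<in> S" "ls_word (a @ lead_word s @ b)" "lead_at (sub_elem isodd arr a s b) (a @ lead_word s @ b) 1" for s a b
    using sub_elem_props(2)[OF wf two arr monic1 hom ls, of s a b] that ideal_in_mono[of "{s}" S] by blast
  show ?thesis
  proof (rule resolvableI[OF monic])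
    fix s s' d e assume s: "s \<in> S" "s' \<in> S" and w: "lead_word s = d @ lead_word s' @ e"
    let ?g = "sub_elem isodd arr d s' e"
    have f: "s - ?g \<in> ideal_in S (words_below (lead_word s))"
      by (rule trivial[OF lie_composition.inclusion s]) (use w in auto)
    \<comment> \<open>Triviality gives the leading term of \<open>?g\<close>, whatever the lengths
      of \<open>d\<close> and \<open>e\<close>: it differs from the monic \<open>s\<close> by an
      element below the leading word of \<open>s\<close>.\<close>
    then have "lead_at (s - (s - ?g)) (lead_word s) (1 - 0)"
      using ideal_in_words_below[OF monic] by (intro lead_at_diff lead s) (simp add: lead_at_0_iff)
    then have "?g - word d * s' * word e \<in> ideal_in S (words_below (lead_word s))"
      using sub[OF s(2), of d e] ls[OF s(1)] w by simp
    from ideal_in_add[OF f this] show "s - word d * s' * word e \<in> ideal_in S (words_below (lead_word s))"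
      by simp
  next
    fix s s' d e assume s: "s \<in> S" "s' \<in> S" and w: "lead_word s @ e = d @ lead_word s'"
      and len: "length d < length (lead_word s)"
    let ?w = "lead_word s @ e"
    let ?g = "sub_elem isodd arr [] s e" and ?h = "sub_elem isodd arr d s' []"
    obtain x where x: "lead_word s = d @ x" "lead_word s' = x @ e"
      using append_eq_prefixE[OF w[symmetric]] len by (metis less_imp_le)
    have "x \<noteq> []" using len x by auto
    then have lsw: "ls_word ?w" using ls_word_overlap[of d x e] ls[OF s(1)] ls[OF s(2)] x by simp
    have f: "?g - ?h \<in> ideal_in S (words_below ?w)"
      by (rule trivial[OF lie_composition.intersection s]) (use w len in auto)
    then have low: "lead_at (?g - ?h) ?w 0" using ideal_in_words_below[OF monic] by (simp add: lead_at_0_iff)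
    \<comment> \<open>The leading words are \<open>d @ x\<close> and \<open>x @ e\<close> with
      \<open>x\<close> nonempty, so \<open>e\<close> is shorter than the first or \<open>d\<close>
      is shorter than the second. One side therefore has its leading term by transfer, and the other
      inherits it because the composition lies below \<open>?w\<close>.\<close>
    have "lead_at ?g ?w 1 \<and> lead_at ?h ?w 1"
    proof (cases "length e < length (lead_word s)")
      case True
      then have "lead_at ?g ?w 1" using sub_lead[OF s(1) s(1) s(1), of "[]" e] lsw by simp
      with lead_at_diff[OF this low] show ?thesis by simp
    next
      case False
      moreover have "length x > 0" using len x by simp
      ultimately have "length d < length (lead_word s')" unfolding x length_append by linarith
      then have "lead_at ?h ?w 1" using sub_lead[OF s(2) s(2) s(2), of d "[]"] lsw w by simp
      with lead_at_add[OF low this] show ?thesis by simp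
    qed
    then have g: "?g - word [] * s * word e \<in> ideal_in S (words_below ?w)"
      and h: "?h - word d * s' * word [] \<in> ideal_in S (words_below ?w)"
      using sub[OF s(1), of "[]" e] sub[OF s(2), of d "[]"] lsw w by simp_all
    from ideal_in_add[OF ideal_in_diff[OF f g] h] show "s * word e - word d * s' \<in> ideal_in S (words_below ?w)"
      by simp
  qed
qed

section \<open>The ideal\<close>

lemma lie_ideal_free_lie_set: "lie_ideal isodd (free_lie_set isodd)"
  unfolding lie_ideal_def lin_subspace_iff by (simp add: subspace_free_lie_set sbracket_free_lie_set)

text \<open>The hull is an intersection. \<open>S\<close> lying in the free Lie superalgebra
  guarantees that some ideal contains \<open>S\<close>, so that the intersection is not the whole
  associative algebra.\<close>

lemma lie_ideal_hull:
  assumes "S \<subseteq> free_lie_set isodd"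
  shows "lie_ideal isodd (lie_ideal isodd hull S)"
proof -
  have "lie_ideal isodd hull S \<subseteq> free_lie_set isodd"
    using assms by (rule hull_minimal) (rule lie_ideal_free_lie_set)
  then show ?thesis unfolding hull_def by (auto simp: lie_ideal_def lin_subspace_def)
qed

lemma lie_ideal_hull_subset:
  assumes S: "S \<subseteq> free_lie_set isodd" "\<And>s. s \<in> S \<Longrightarrow> homogeneous isodd s"
  shows "lie_ideal isodd hull S \<subseteq> ideal_in S UNIV"
proof -
  have "lie_ideal isodd hull S \<subseteq> free_lie_set isodd \<inter> ideal_in S UNIV"
  proof (rule hull_minimal)
    show "S \<subseteq> free_lie_set isodd \<inter> ideal_in S UNIV"
      using S ideal_in_term[of _ S "[]" "[]" UNIV] by auto
    show "lie_ideal isodd (free_lie_set isodd \<inter> ideal_in S UNIV)"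
      unfolding lie_ideal_def lin_subspace_iff
    proof (intro conjI ballI)
      have "scal.subspace (ideal_in S UNIV)" unfolding ideal_in_def by (rule scal.subspace_span)
      then show "scal.subspace (free_lie_set isodd \<inter> ideal_in S UNIV)"
        by (rule scal.subspace_inter[OF subspace_free_lie_set])
    qed (auto intro: sbracket_free_lie_set sbracket_ideal_in[OF S(2)])
  qed
  then show ?thesis by blast
qed

lemma plug_lie_ideal:
  assumes I: "lie_ideal isodd I" and s: "s \<in> I"
  shows "plug isodd m s \<in> free_lie_set isodd \<and> (None \<in> set (und m) \<longrightarrow> plug isodd m s \<in> I)"
proof (induction m)
  case (Leaf y)
  then show ?case using I s letter_free_lie_set by (cases y) (auto simp: lie_ideal_def)
next
  case (Node m n)
  then show ?case using I sbracket_free_lie_set by (auto simp: lie_ideal_def)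
qed

text \<open>If \<open>v = v1 @ v2\<close> crossed the middle of the square, then
  \<open>v2 < v < v1\<close> since \<open>v\<close> is a Lyndon--Shirshov word starting with
  \<open>v1\<close>. On the other hand \<open>v1 <= k <= v2\<close>, as \<open>v1\<close> is a
  suffix and \<open>v2\<close> a prefix of \<open>k\<close>.\<close>

lemma ls_factor_square:
  assumes k: "ls_word k" and v: "ls_word v" and eq: "k @ k = a @ v @ b"
  shows "\<exists>a' b'. k = a' @ v @ b'"
proof (cases "length k \<le> length a")
  case True
  then show ?thesis using append_eq_prefixE[OF eq] by metis
next
  case False
  then obtain v1 where v1: "k = a @ v1" "v @ b = v1 @ k"
    using append_eq_prefixE[OF eq[symmetric]] by (metis nat_le_linear)
  show ?thesis
  proof (cases "length v \<le> length v1")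
    case True
    then show ?thesis using append_eq_prefixE[OF v1(2)] v1(1) by metis
  next
    case long: False
    then obtain v2 where v2: "v = v1 @ v2" "k = v2 @ b"
      using append_eq_prefixE[OF v1(2)[symmetric]] by (metis nat_le_linear)
    have ne: "v1 \<noteq> []" "v2 \<noteq> []" using False v1 long v2 by auto
    have "lex_less v2 v" using ls_word_suffix[of v1 v2] v v2 ne by (simp add: mless_lex)
    moreover have "lex_less v v1" using v2 ne by (simp add: lex_less_prefix)
    moreover have "lex_le v1 k" using ls_word_suffix_le[of a v1] k v1 ne by simp
    moreover have "lex_le k v2" using v2 by (simp add: lex_le_prefix)
    ultimately show ?thesis by (meson lex_less_irrefl lex_less_le_trans lex_less_trans)
  qed
qed

lemma reducible_lead_word:
  fixes s :: "('x::linorder, 'k::field) free_alg"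
  assumes two: "(2 :: 'k) \<noteq> 0" and I: "lie_ideal isodd I" "s \<in> I"
    and s: "homogeneous isodd s" "lead_at s v 1" "ls_word v"
    and u: "sls_word isodd u" "u = a @ v @ b"
  shows "\<exists>g\<in>I. \<exists>d. d \<noteq> 0 \<and> lead_at g u d"
proof -
  have ls: "\<exists>m. plug isodd m s \<in> I \<and> lead_at (plug isodd m s) k 1 \<and> par isodd (odd_word isodd k) (plug isodd m s)"
    if k: "ls_word k" "k = a @ v @ b" for k a b
  proof -
    obtain m where m: "monic_arrangement TYPE('k) isodd a v b m" using monic_arrangement_exists s(3) k by blast
    have par: "par isodd (odd_word isodd v) s" using par_homogeneous s by blast
    have "plug isodd m s \<in> I" using plug_lie_ideal[OF I, of m] m by (auto simp: monic_arrangement_def arrangement_def)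
    moreover have "lead_at (plug isodd m s) k 1" using m par s(2) k by (simp add: monic_arrangement_def)
    moreover have "par isodd (odd_word isodd k) (plug isodd m s)"
      using par_plug[OF par, of m] m k subst_word_arrangement[of a b m v] by (simp add: monic_arrangement_def)
    ultimately show ?thesis by blast
  qed
  from u(1) show ?thesis
  proof (cases rule: sls_wordE)
    case 1
    then show ?thesis using ls[of u a b] u by (metis zero_neq_one)
  next
    case (2 k)
    then obtain a' b' where "k = a' @ v @ b'" using ls_factor_square[of k v a b] s(3) u by auto
    then obtain m where m: "plug isodd m s \<in> I" "lead_at (plug isodd m s) k 1" "par isodd (odd_word isodd k) (plug isodd m s)"
      using ls[OF 2(1)] by blast
    \<comment> \<open>It suffices to put \<open>s\<close> into one of the two copies of
      \<open>k\<close>. Bracketing the result with the standard monomial of \<open>k\<close> stays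
      in \<open>I\<close> and has the leading term \<open>kk\<close> with coefficient 2.\<close>
    have "std_elem isodd k \<in> free_lie_set isodd"
      unfolding std_elem_def by (intro ev_free_lie_set letter_free_lie_set)
    then have "sbracket isodd (plug isodd m s) (std_elem isodd k) \<in> I"
      using I m by (auto simp: lie_ideal_def)
    moreover have "lead_at (sbracket isodd (plug isodd m s) (std_elem isodd k)) (k @ k) (2 * 1 * 1)"
      using m(3) 2(2) by (intro lead_at_sbracket_square m(2) par_std_elem_odd 2) (simp_all add: std_elem_def lead_at_std[OF 2(1)])
    ultimately show ?thesis using two 2(3) by (intro bexI[of _ "sbracket isodd (plug isodd m s) (std_elem isodd k)"] exI[of _ 2]) auto
  qed
qed

section \<open>Spanning and independence\<close>

text \<open>Gaussian elimination along leading words: every super-Lyndon--Shirshov word leads either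
  some \<open>e u\<close> or some element of \<open>I\<close>, so the leading term of
  \<open>f\<close> can be removed by one of these, and the remainder has a smaller leading
  word.\<close>

lemma span_mod_ideal:
  fixes e :: "'x::linorder list \<Rightarrow> ('x, 'k::field) free_alg"
  assumes wf: "wfp ((<) :: 'x \<Rightarrow> 'x \<Rightarrow> bool)" and two: "(2 :: 'k) \<noteq> 0"
    and I: "lie_ideal isodd I"
    and e: "\<And>u. u \<in> B \<Longrightarrow> e u \<in> free_lie_set isodd \<and> (\<exists>d. d \<noteq> 0 \<and> lead_at (e u) u d)"
    and red: "\<And>u. sls_word isodd u \<Longrightarrow> u \<notin> B \<Longrightarrow> \<exists>g\<in>I. \<exists>d. d \<noteq> 0 \<and> lead_at g u d"
    and f: "f \<in> free_lie_set isodd"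
  shows "\<exists>y\<in>scal.span (e ` B). f - y \<in> I"
proof -
  have subI: "scal.subspace I" "I \<subseteq> free_lie_set isodd" using I by (auto simp: lie_ideal_def lin_subspace_iff)
  have "\<exists>y\<in>scal.span (e ` B). f - y \<in> I" if "f \<in> free_lie_set isodd" "f \<noteq> 0" "lead_word f = w" for f w
    using that
  proof (induction w arbitrary: f rule: wfp_induct_rule[OF wfp_llex_less[OF wf]])
    case (1 w)
    have step: "\<exists>y\<in>scal.span (e ` B). f' - y \<in> I"
      if g: "g \<in> free_lie_set isodd" "lead_at g w d" "d \<noteq> 0" "f' = f - (lead_cf f / d) \<bullet>\<^sub>K g" for g d f'
    proof (cases "f' = 0")
      case True
      then show ?thesis using subI scal.span_zero[of "e ` B"] by (intro bexI[of _ 0]) (auto intro: scal.subspace_0)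
    next
      case False
      have "lead_at f' w (lead_cf f - lead_cf f / d * d)"
        unfolding g(4) using lead_at_lead_word(1)[OF 1(3)] 1(4) by (intro lead_at_diff lead_at_scal g) simp
      then have "below f' w" using g(3) by (simp add: lead_at_0_iff)
      moreover have "lead_word f' \<in> keys f'"
        using lookup_lead_at[OF lead_at_lead_word(1)[OF False]] lead_at_lead_word(2)[OF False] by (simp add: in_keys_iff)
      ultimately have "lead_word f' \<lless> w" by (simp add: below_def)
      moreover have "f' \<in> free_lie_set isodd"
        unfolding g(4) by (intro scal.subspace_diff scal.subspace_scale subspace_free_lie_set 1 g)
      ultimately show ?thesis using 1(1) False by blast
    qed
    have "sls_word isodd w" using sls_word_lead_word[OF two 1(2,3)] 1(4) by simp
    show ?case
    proof (cases "w \<in> B")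
      case True
      then obtain d where d: "d \<noteq> 0" "lead_at (e w) w d" "e w \<in> free_lie_set isodd" using e by blast
      then obtain y where y: "y \<in> scal.span (e ` B)" "f - (lead_cf f / d) \<bullet>\<^sub>K e w - y \<in> I" using step by blast
      have "y + (lead_cf f / d) \<bullet>\<^sub>K e w \<in> scal.span (e ` B)"
        using True by (intro scal.span_add y scal.span_scale scal.span_base imageI)
      moreover have "f - (y + (lead_cf f / d) \<bullet>\<^sub>K e w) \<in> I" using y(2) by (simp add: algebra_simps)
      ultimately show ?thesis by blast
    next
      case False
      then obtain g d where g: "g \<in> I" "d \<noteq> 0" "lead_at g w d" using red \<open>sls_word isodd w\<close> by blast
      then obtain y where y: "y \<in> scal.span (e ` B)" "f - (lead_cf f / d) \<bullet>\<^sub>K g - y \<in> I" using step subI by blast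
      have "(f - (lead_cf f / d) \<bullet>\<^sub>K g - y) + (lead_cf f / d) \<bullet>\<^sub>K g \<in> I"
        by (intro scal.subspace_add scal.subspace_scale subI y g)
      then have "f - y \<in> I" by (simp add: algebra_simps)
      then show ?thesis using y by blast
    qed
  qed
  moreover have "\<exists>y\<in>scal.span (e ` B). 0 - y \<in> I"
    using subI scal.span_zero[of "e ` B"] by (intro bexI[of _ 0]) (auto intro: scal.subspace_0)
  ultimately show ?thesis using f by blast
qed

text \<open>A nontrivial combination of the \<open>e u\<close> leads with one of its indices, since
  these are distinct leading words. Terms with coefficient 0 are dropped first, so that the largest
  remaining index has a nonzero coefficient.\<close>

lemma independent_mod_ideal:
  fixes e :: "'x::linorder list \<Rightarrow> ('x, 'k::field) free_alg"
  assumes e: "\<And>u. u \<in> C \<Longrightarrow> \<exists>d. d \<noteq> 0 \<and> lead_at (e u) u d"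
    and I: "\<And>f. f \<in> I \<Longrightarrow> f \<noteq> 0 \<Longrightarrow> lead_word f \<notin> C"
    and C: "finite C" "(\<Sum>u\<in>C. c u \<bullet>\<^sub>K e u) \<in> I" and u: "u \<in> C"
  shows "c u = 0"
proof (rule ccontr)
  assume "c u \<noteq> 0"
  define C' where "C' = {u\<in>C. c u \<noteq> 0}"
  have C': "finite C'" "C' \<noteq> {}" using C u \<open>c u \<noteq> 0\<close> by (auto simp: C'_def)
  obtain d where d: "\<And>u. u \<in> C \<Longrightarrow> d u \<noteq> 0 \<and> lead_at (e u) u (d u)" using e by metis
  have sum: "(\<Sum>u\<in>C. c u \<bullet>\<^sub>K e u) = (\<Sum>u\<in>C'. c u \<bullet>\<^sub>K e u)"
    unfolding C'_def using C(1) by (intro sum.mono_neutral_right) auto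
  have "\<And>w. w \<in> C' \<Longrightarrow> lead_at (e w) w (d w)" using d by (auto simp: C'_def)
  then obtain w where w: "w \<in> C'" "lead_at (\<Sum>u\<in>C. c u \<bullet>\<^sub>K e u) w (c w * d w)"
    unfolding sum using lead_at_sum[OF C'] by blast
  have "c w * d w \<noteq> 0" "w \<in> C" using w(1) d by (auto simp: C'_def)
  then show False using lead_at_lead[OF w(2)] I[OF C(2)] by auto
qed

section \<open>The quotient\<close>

lemma free_lie_simps [simp]:
  "carrier (free_lie isodd) = free_lie_set isodd" "add (free_lie isodd) = (+)"
  "zero (free_lie isodd) = 0" "smult (free_lie isodd) = scal"
  by (simp_all add: free_lie_def)

lemma vectorspace_free_lie: "vectorspace class_ring (free_lie isodd)"
proof (rule vs_criteria)
  show "\<forall>v\<in>carrier (free_lie isodd). \<exists>w\<in>carrier (free_lie isodd). v \<oplus>\<^bsub>free_lie isodd\<^esub> w = \<zero>\<^bsub>free_lie isodd\<^esub>"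
    using scal.subspace_neg[OF subspace_free_lie_set] by (metis add.right_inverse free_lie_simps(1,2,3))
qed (auto intro: class_field scal.subspace_0[OF subspace_free_lie_set] scal.subspace_add[OF subspace_free_lie_set]
    scal.subspace_scale[OF subspace_free_lie_set] simp: add_ac scal.scale_left_distrib scal.scale_right_distrib)

lemma submodule_lie_ideal:
  assumes "lie_ideal isodd I"
  shows "submodule class_ring I (free_lie isodd)"
proof -
  have "module class_ring (free_lie isodd)" using vectorspace_free_lie by (rule vectorspace.axioms)
  then show ?thesis using assms by (auto simp: submodule_def lie_ideal_def lin_subspace_def)
qed

lemma a_r_coset_free_lie: "I +>\<^bsub>free_lie isodd\<^esub> x = (\<lambda>i. i + x) ` I"
  by (auto simp: a_r_coset_def')

lemma a_r_coset_eq_iff: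
  assumes I: "scal.subspace I"
  shows "I +>\<^bsub>free_lie isodd\<^esub> x = I +>\<^bsub>free_lie isodd\<^esub> y \<longleftrightarrow> x - y \<in> I"
proof
  assume "I +>\<^bsub>free_lie isodd\<^esub> x = I +>\<^bsub>free_lie isodd\<^esub> y"
  moreover have "0 + x \<in> I +>\<^bsub>free_lie isodd\<^esub> x"
    unfolding a_r_coset_free_lie using scal.subspace_0[OF I] by (rule imageI)
  ultimately obtain i where "i \<in> I" "x = i + y" by (auto simp: a_r_coset_free_lie)
  then show "x - y \<in> I" by simp
next
  have sub: "I +>\<^bsub>free_lie isodd\<^esub> x \<subseteq> I +>\<^bsub>free_lie isodd\<^esub> y" if "x - y \<in> I" for x y
  proof
    fix z assume "z \<in> I +>\<^bsub>free_lie isodd\<^esub> x"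
    then obtain i where "i \<in> I" "z = (i + (x - y)) + y" by (auto simp: a_r_coset_free_lie)
    then show "z \<in> I +>\<^bsub>free_lie isodd\<^esub> y"
      unfolding a_r_coset_free_lie using scal.subspace_add[OF I _ that] by blast
  qed
  assume xy: "x - y \<in> I"
  moreover have "y - x \<in> I" using scal.subspace_neg[OF I xy] by simp
  ultimately show "I +>\<^bsub>free_lie isodd\<^esub> x = I +>\<^bsub>free_lie isodd\<^esub> y" using sub by blast
qed

text \<open>A basis is a set of cosets and cannot show whether two indices give the same coset.
  Injectivity is therefore a separate claim; it also translates coefficients on indices into
  coefficients on cosets.\<close>

lemma quotient_module_basis:
  fixes e :: "'u \<Rightarrow> ('x, 'k::field) free_alg"
  defines "coset \<equiv> \<lambda>isodd I u. I +>\<^bsub>free_lie isodd\<^esub> e u"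
  assumes I: "lie_ideal isodd I"
    and e: "\<And>u. u \<in> B \<Longrightarrow> e u \<in> free_lie_set isodd"
    and indep: "\<And>C c u. finite C \<Longrightarrow> C \<subseteq> B \<Longrightarrow> (\<Sum>u\<in>C. c u \<bullet>\<^sub>K e u) \<in> I \<Longrightarrow> u \<in> C \<Longrightarrow> c u = 0"
    and span: "\<And>f. f \<in> free_lie_set isodd \<Longrightarrow> \<exists>y\<in>scal.span (e ` B). f - y \<in> I"
  shows "inj_on (coset isodd I) B \<and>
    vectorspace.basis class_ring (quotient_module (free_lie isodd) I) (coset isodd I ` B)"
proof -
  let ?Q = "quotient_module (free_lie isodd) I" and ?c = "\<lambda>x. I +>\<^bsub>free_lie isodd\<^esub> x"
  have subI: "scal.subspace I" using I by (simp add: lie_ideal_def lin_subspace_iff)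
  interpret Q: vectorspace class_ring ?Q
    by (rule quotient_module_vectorspace[OF vectorspace_free_lie submodule_lie_ideal[OF I]])
  have carQ: "carrier ?Q = ?c ` free_lie_set isodd" by (auto simp: quotient_module_def A_RCOSETS_def')
  have zeroQ: "\<zero>\<^bsub>?Q\<^esub> = ?c 0" by (simp add: quotient_module_def a_r_coset_free_lie)
  have addQ: "?c x \<oplus>\<^bsub>?Q\<^esub> ?c y = ?c (x + y)" for x y
  proof -
    have "?c x \<oplus>\<^bsub>?Q\<^esub> ?c y = (\<Union>i\<in>I. \<Union>j\<in>I. {(i + x) + (j + y)})"
      by (auto simp: quotient_module_def set_add_def' a_r_coset_free_lie)
    also have "\<dots> = ?c (x + y)"
    proof (intro equalityI subsetI)
      fix z assume "z \<in> (\<Union>i\<in>I. \<Union>j\<in>I. {(i + x) + (j + y)})"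
      then obtain i j where ij: "i \<in> I" "j \<in> I" "z = (i + j) + (x + y)" by (auto simp: algebra_simps)
      then show "z \<in> ?c (x + y)" unfolding a_r_coset_free_lie using scal.subspace_add[OF subI ij(1,2)] by blast
    next
      fix z assume "z \<in> ?c (x + y)"
      then obtain i where "i \<in> I" "z = (i + x) + (0 + y)" by (auto simp: a_r_coset_free_lie algebra_simps)
      then show "z \<in> (\<Union>i\<in>I. \<Union>j\<in>I. {(i + x) + (j + y)})" using scal.subspace_0[OF subI] by blast
    qed
    finally show ?thesis .
  qed
  have smultQ: "d \<odot>\<^bsub>?Q\<^esub> ?c x = ?c (d \<bullet>\<^sub>K x)" for d x
  proof -
    have "?c (d \<bullet>\<^sub>K z) = ?c (d \<bullet>\<^sub>K x)" if z: "z \<in> ?c x" for z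
    proof -
      obtain i where "i \<in> I" "z = i + x" using z unfolding a_r_coset_free_lie by blast
      then have "d \<bullet>\<^sub>K z - d \<bullet>\<^sub>K x \<in> I" using scal.subspace_scale[OF subI, of i d] by (simp add: scal.scale_right_distrib)
      then show ?thesis by (simp add: a_r_coset_eq_iff[OF subI])
    qed
    moreover have "x \<in> ?c x" unfolding a_r_coset_free_lie using scal.subspace_0[OF subI] by force
    ultimately have "(\<Union>z\<in>?c x. ?c (d \<bullet>\<^sub>K z)) = ?c (d \<bullet>\<^sub>K x)" by blast
    then show ?thesis by (simp add: quotient_module_def)
  qed
  have c0: "?c x = \<zero>\<^bsub>?Q\<^esub> \<longleftrightarrow> x \<in> I" for x
    unfolding zeroQ a_r_coset_eq_iff[OF subI] by simp
  have inj: "inj_on (coset isodd I) B"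
  proof (rule inj_onI, rule ccontr)
    fix u v assume *: "u \<in> B" "v \<in> B" "coset isodd I u = coset isodd I v" "u \<noteq> v"
    then have "e u - e v \<in> I" by (simp add: coset_def a_r_coset_eq_iff[OF subI])
    \<comment> \<open>Equal cosets of two different indices give a relation with coefficients 1 and
      -1.\<close>
    then have "(\<Sum>w\<in>{u, v}. (if w = u then 1 else - 1) \<bullet>\<^sub>K e w) \<in> I" using *(4) by simp
    from indep[OF _ _ this, of u] * show False by auto
  qed
  have lincomb: "Q.lincomb a (coset isodd I ` C) = ?c (\<Sum>u\<in>C. a (coset isodd I u) \<bullet>\<^sub>K e u)"
    if "finite C" "C \<subseteq> B" for a C
    using that
  proof (induction C rule: finite_induct)
    case empty
    then show ?case by (simp add: Q.lincomb_def zeroQ)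
  next
    case (insert u C)
    have "coset isodd I u \<notin> coset isodd I ` C" using inj insert by (auto simp: inj_on_def)
    moreover have "a (coset isodd I v) \<odot>\<^bsub>?Q\<^esub> coset isodd I v \<in> carrier ?Q" if "v \<in> insert u C" for v
      unfolding coset_def smultQ carQ
      using e insert.prems that by (intro imageI scal.subspace_scale subspace_free_lie_set) auto
    ultimately have "Q.lincomb a (coset isodd I ` insert u C)
      = a (coset isodd I u) \<odot>\<^bsub>?Q\<^esub> coset isodd I u \<oplus>\<^bsub>?Q\<^esub> Q.lincomb a (coset isodd I ` C)"
      unfolding Q.lincomb_def image_insert using insert.hyps by (intro Q.finsum_insert) auto
    also have "\<dots> = ?c (\<Sum>u\<in>insert u C. a (coset isodd I u) \<bullet>\<^sub>K e u)"
      using insert by (simp add: coset_def smultQ addQ)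
    finally show ?case .
  qed
  have "Q.lin_indpt (coset isodd I ` B)"
  proof
    assume "Q.lin_dep (coset isodd I ` B)"
    then obtain A a v where A: "finite A" "A \<subseteq> coset isodd I ` B" "Q.lincomb a A = \<zero>\<^bsub>?Q\<^esub>" "v \<in> A" "a v \<noteq> 0"
      unfolding Q.lin_dep_def by auto
    obtain C where C: "C \<subseteq> B" "finite C" "A = coset isodd I ` C" using finite_subset_image[OF A(1,2)] by blast
    then obtain u where u: "u \<in> C" "v = coset isodd I u" using A(4) by blast
    have "(\<Sum>u\<in>C. a (coset isodd I u) \<bullet>\<^sub>K e u) \<in> I" using A(3) lincomb[OF C(2,1)] C(3) c0 by simp
    from indep[OF C(2,1) this u(1)] show False using A(5) u(2) by simp
  qed
  moreover have sub: "coset isodd I ` B \<subseteq> carrier ?Q" using e by (auto simp: coset_def carQ)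
  moreover have "Q.span (coset isodd I ` B) = carrier ?Q"
  proof
    show "Q.span (coset isodd I ` B) \<subseteq> carrier ?Q" by (rule Q.span_is_subset2[OF sub])
    show "carrier ?Q \<subseteq> Q.span (coset isodd I ` B)"
    proof
      fix X assume "X \<in> carrier ?Q"
      then obtain f where f: "f \<in> free_lie_set isodd" "X = ?c f" by (auto simp: carQ)
      obtain y where y: "y \<in> scal.span (e ` B)" "f - y \<in> I" using span[OF f(1)] by blast
      obtain C c where C: "finite C" "C \<subseteq> B" "y = (\<Sum>u\<in>C. c u \<bullet>\<^sub>K e u)" using y(1) by (rule span_image_explicit) blast
      \<comment> \<open>\<open>Q.lincomb\<close> expects coefficients on cosets; the inverse of the
        injective coset map carries them over from the indices.\<close>
      define a where "a = (\<lambda>X. c (the_inv_into B (coset isodd I) X))"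
      have "a (coset isodd I u) = c u" if "u \<in> C" for u
        unfolding a_def using the_inv_into_f_f[OF inj] that C(2) by auto
      then have "(\<Sum>u\<in>C. a (coset isodd I u) \<bullet>\<^sub>K e u) = y" unfolding C(3) by simp
      then have "X = Q.lincomb a (coset isodd I ` C)"
        unfolding lincomb[OF C(1,2)] using f(2) y(2) by (simp add: a_r_coset_eq_iff[OF subI])
      then show "X \<in> Q.span (coset isodd I ` B)" unfolding Q.span_def using C(1,2) by auto
    qed
  qed
  ultimately show ?thesis using inj by (simp add: Q.basis_def)
qed

theorem theorem2p8:
  fixes isodd :: "'x::linorder \<Rightarrow> bool"
    and S I :: "('x, 'k::field) free_alg set"
    and arr :: "'x list \<Rightarrow> 'x list \<Rightarrow> 'x list \<Rightarrow> 'x option nword"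
    and br :: "'x list \<Rightarrow> 'x nword"
  assumes char: "CHAR('k) \<noteq> 2" "CHAR('k) \<noteq> 3"
    and well_ordered: "wfp ((<) :: 'x \<Rightarrow> 'x \<Rightarrow> bool)"
    and arr: "arrangement_choice TYPE('k) isodd arr"
    and gsb: "gs_basis isodd arr S I"
    and br: "\<And>u. sls_word isodd u \<Longrightarrow> admissible TYPE('k) isodd u (br u)"
  shows "let B = {u. sls_word isodd u \<and> reduced S u};
             coset = (\<lambda>u. I +>\<^bsub>free_lie isodd\<^esub> ev isodd letter (br u))
         in inj_on coset B \<and>
            vectorspace.basis class_ring (quotient_module (free_lie isodd) I) (coset ` B)"
proof -
  define B where "B = {u. sls_word isodd u \<and> reduced S u}"
  let ?e = "\<lambda>u. ev isodd letter (br u) :: ('x, 'k) free_alg"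
  have two: "(2 :: 'k) \<noteq> 0" using char(1) by (rule field_two_neq_0)
  have monic: "monic_set S" using gsb by (rule gs_basis_monic_set)
  have resolvable: "resolvable S" using gs_basis_resolvable[OF well_ordered two arr gsb] .
  have S: "S \<subseteq> free_lie_set isodd" "\<And>s. s \<in> S \<Longrightarrow> homogeneous isodd s" and I_def: "I = lie_ideal isodd hull S"
    using gsb by (auto simp: gs_basis_def monic_poly_def)
  have I: "lie_ideal isodd I" "S \<subseteq> I" "I \<subseteq> ideal_in S UNIV"
    unfolding I_def by (rule lie_ideal_hull[OF S(1)], rule hull_subset, rule lie_ideal_hull_subset[OF S])
  have e: "?e u \<in> free_lie_set isodd \<and> (\<exists>d. d \<noteq> 0 \<and> lead_at (?e u) u d)" if "u \<in> B" for u
  proof -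
    have "?e u \<noteq> 0" "lead_word (?e u) = u"
      using br[of u] that by (auto simp: B_def admissible_def Let_def)
    then show ?thesis
      using lead_at_lead_word[of "?e u"] by (auto intro: ev_free_lie_set letter_free_lie_set)
  qed
  have red: "\<exists>g\<in>I. \<exists>d. d \<noteq> 0 \<and> lead_at g u d" if u: "sls_word isodd u" "u \<notin> B" for u
  proof -
    obtain s a b where s: "s \<in> S" "u = a @ lead_word s @ b" using u by (auto simp: B_def reduced_def)
    then have "lead_at s (lead_word s) 1" using monic by (simp add: monic_set_def)
    then show ?thesis
      using reducible_lead_word[OF two I(1) _ S(2)[OF s(1)] _ gs_basis_ls_word[OF two arr gsb s(1)] u(1) s(2)] s(1) I(2) by blast
  qed
  \<comment> \<open>Elements of \<open>I\<close> lie in the two-sided ideal of \<open>S\<close>, so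
    their leading words contain the leading word of an element of \<open>S\<close> and are not
    reduced.\<close>
  have reduced: "lead_word f \<notin> B" if "f \<in> I" "f \<noteq> 0" for f
    using composition_diamond_lead_word[OF well_ordered monic resolvable, of f] that I(3)
    by (auto simp: B_def reduced_def)
  have "inj_on (\<lambda>u. I +>\<^bsub>free_lie isodd\<^esub> ?e u) B \<and>
    vectorspace.basis class_ring (quotient_module (free_lie isodd) I) ((\<lambda>u. I +>\<^bsub>free_lie isodd\<^esub> ?e u) ` B)"
  proof (rule quotient_module_basis[OF I(1)])
    show "\<exists>y\<in>scal.span (?e ` B). f - y \<in> I" if "f \<in> free_lie_set isodd" for f
      using span_mod_ideal[OF well_ordered two I(1), of B ?e f] e red that by blast
    show "c u = 0" if "finite C" "C \<subseteq> B" "(\<Sum>u\<in>C. c u \<bullet>\<^sub>K ?e u) \<in> I" "u \<in> C" for C c u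
      using independent_mod_ideal[of C ?e I c u] e reduced that by blast
  qed (use e in blast)
  then show ?thesis unfolding B_def Let_def .
qed

end
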